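(* Let $n\ge 2$ be an integer, $k$ a field of characteristic prime to $n$, and $q\in k$ any primitive root of unity of order $n^2$. Let $H=H(q)$, its subalgebra $A=A(q)$ generated by $a=g^n$ and $x$, the twist $J$, and the data $\Delta_J,\varepsilon,\Phi_J,S_J$ be as defined in the context. Then, with $\Delta_J$, $\varepsilon$, $S_J$ restricted to $A(q)$, $(A(q),\Delta_J,\varepsilon,\Phi_J,S_J,a,1)$ (i.e. with $\alpha=a$ and $\beta=1$) is a basic quasi-Hopf algebra of dimension $n^3$ which is not twist equivalent to a Hopf algebra.
   Context: Quasi-Hopf algebras $(H,\Delta,\varepsilon,\Phi,S,\alpha,\beta)$ are in the sense of Drinfeld, with the conventions $(\mathrm{id}\otimes\Delta)\Delta(h)=\Phi(\Delta\otimes\mathrm{id})\Delta(h)\Phi^{-1}$ and, for $\Phi=\sum_i X_i\otimes Y_i\otimes Z_i$, $\sum_i X_i\beta S(Y_i)\alpha Z_i=1$. A finite dimensional algebra is basic if all its irreducible representations are $1$-dimensional. A twist for $H$ is an invertible $J=\sum_i f_i\otimes g_i\in H\otimes H$ with $(\varepsilon\otimes\mathrm{id})(J)=(\mathrm{id}\otimes\varepsilon)(J)=1$; write $J^{-1}=\sum_i\overline{f_i}\otimes\overline{g_i}$. Put $\alpha_J=\sum_i S(\overline{f_i})\alpha\overline{g_i}$, $\beta_J=\sum_i f_i\beta S(g_i)$. If $\beta_J$ is invertible, $H_J=(H,\Delta_J,\varepsilon,\Phi_J,S_J,\beta_J\alpha_J,1)$ is the quasi-Hopf algebra with the same underlying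 algebra and $\Delta_J(h)=J\Delta(h)J^{-1}$, $\Phi_J=(1\otimes J)(\mathrm{id}\otimes\Delta)(J)\,\Phi\,(\Delta\otimes\mathrm{id})(J^{-1})(J\otimes1)^{-1}$, $S_J(h)=\beta_JS(h)\beta_J^{-1}$. Two quasi-Hopf algebras are twist equivalent if one is isomorphic to a twist of the other. $H(q)$ is the Taft Hopf algebra of dimension $n^4$ generated by $g,x$ with relations $x^{n^2}=0$, $g^{n^2}=1$, $gx=qxg$, coproduct $\Delta(g)=g\otimes g$, $\Delta(x)=x\otimes g+1\otimes x$, counit $\varepsilon(g)=1$, $\varepsilon(x)=0$, antipode $S(g)=g^{-1}$, $S(x)=-xg^{-1}$ (so $\Phi=1$, $\alpha=\beta=1$). $A(q)$ is the subalgebra generated by $a:=g^n$ and $x$. For $0\le z\le n^2-1$ let $1_z$ be the primitive idempotents of $k[\mathbb{Z}/n^2\mathbb{Z}]=k[g]$ with $g1_z=q^z1_z$. For an integer $i$ let $i'$ be the remainder of division of $i$ by $n$. Here $$J=\sum_{z,y=0}^{n^2-1}q^{-z(y-y')}\,1_z\otimes1_y .$$ *)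

theory Defs
  imports Complex_Main "HOL-Library.Function_Algebras"
begin

section \<open>Algebras over a field\<close>

text \<open>
  An algebra is given by a carrier inside an ambient unital algebra, whose ring structure is the
  one of the type \<open>'a::ring_1\<close> and whose scalar multiplication is a field of the record. So a
  subalgebra is the same record with a smaller carrier, and its tensor powers are subsets of
  the tensor powers of the larger algebra.
\<close>

record ('k, 'a) alg =
  carr :: "'a set"
  scl :: "'k \<Rightarrow> 'a \<Rightarrow> 'a"

definition subalgebra :: "('k::field \<Rightarrow> 'a::ring_1 \<Rightarrow> 'a) \<Rightarrow> 'a set \<Rightarrow> bool" where
  "subalgebra s B \<longleftrightarrow> module.subspace s B \<and> 1 \<in> B \<and> (\<forall>a\<in>B. \<forall>b\<in>B. a * b \<in> B)"

definition generated_subalgebra :: "('k::field \<Rightarrow> 'a::ring_1 \<Rightarrow> 'a) \<Rightarrow> 'a set \<Rightarrow> 'a set" where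
  "generated_subalgebra s X = \<Inter>{B. subalgebra s B \<and> X \<subseteq> B}"

locale k_algebra = vector_space "scl A"
  for A :: "('k::field, 'a::ring_1, 'm) alg_scheme" +
  assumes scl_mult_left: "scl A c (a * b) = scl A c a * b"
    and scl_mult_right: "scl A c (a * b) = a * scl A c b"
    and subalgebra_carr: "subalgebra (scl A) (carr A)"

definition alg_dim :: "('k::field, 'a::ring_1, 'm) alg_scheme \<Rightarrow> nat" where
  "alg_dim A = vector_space.dim (scl A) (carr A)"

definition finite_dimensional :: "('k::field, 'a::ring_1, 'm) alg_scheme \<Rightarrow> bool" where
  "finite_dimensional A \<longleftrightarrow> (\<exists>B. finite B \<and> carr A \<subseteq> module.span (scl A) B)"

definition alg_inverse :: "('k::field, 'a::ring_1, 'm) alg_scheme \<Rightarrow> 'a \<Rightarrow> 'a" where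
  "alg_inverse A a = (THE b. b \<in> carr A \<and> a * b = 1 \<and> b * a = 1)"

definition alg_invertible :: "('k::field, 'a::ring_1, 'm) alg_scheme \<Rightarrow> 'a \<Rightarrow> bool" where
  "alg_invertible A a \<longleftrightarrow> a \<in> carr A \<and> (\<exists>b\<in>carr A. a * b = 1 \<and> b * a = 1)"


section \<open>Basic algebras\<close>

text \<open>A representation is a subspace \<open>W\<close> of a vector space on the type \<open>'v\<close> together with an action.\<close>

definition representation ::
    "('k::field, 'a::ring_1, 'm) alg_scheme \<Rightarrow> ('k \<Rightarrow> 'v::ab_group_add \<Rightarrow> 'v) \<Rightarrow> 'v set
      \<Rightarrow> ('a \<Rightarrow> 'v \<Rightarrow> 'v) \<Rightarrow> bool" where
  "representation A sV W \<rho> \<longleftrightarrow>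
     vector_space sV \<and> module.subspace sV W \<and>
     (\<forall>a\<in>carr A. \<forall>v\<in>W. \<rho> a v \<in> W) \<and>
     (\<forall>a\<in>carr A. \<forall>v\<in>W. \<forall>w\<in>W. \<rho> a (v + w) = \<rho> a v + \<rho> a w) \<and>
     (\<forall>a\<in>carr A. \<forall>c. \<forall>v\<in>W. \<rho> a (sV c v) = sV c (\<rho> a v)) \<and>
     (\<forall>a\<in>carr A. \<forall>b\<in>carr A. \<forall>v\<in>W. \<rho> (a + b) v = \<rho> a v + \<rho> b v) \<and>
     (\<forall>a\<in>carr A. \<forall>c. \<forall>v\<in>W. \<rho> (scl A c a) v = sV c (\<rho> a v)) \<and>
     (\<forall>a\<in>carr A. \<forall>b\<in>carr A. \<forall>v\<in>W. \<rho> (a * b) v = \<rho> a (\<rho> b v)) \<and>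
     (\<forall>v\<in>W. \<rho> 1 v = v)"

definition irreducible_representation ::
    "('k::field, 'a::ring_1, 'm) alg_scheme \<Rightarrow> ('k \<Rightarrow> 'v::ab_group_add \<Rightarrow> 'v) \<Rightarrow> 'v set
      \<Rightarrow> ('a \<Rightarrow> 'v \<Rightarrow> 'v) \<Rightarrow> bool" where
  "irreducible_representation A sV W \<rho> \<longleftrightarrow>
     representation A sV W \<rho> \<and> W \<noteq> {0} \<and>
     (\<forall>U. module.subspace sV U \<and> U \<subseteq> W \<and> (\<forall>a\<in>carr A. \<forall>v\<in>U. \<rho> a v \<in> U)
        \<longrightarrow> U = {0} \<or> U = W)"

text \<open>
  The type argument says where the representation spaces live. Being a free type variable in
  a theorem, it makes the statement one about representations on arbitrary vector spaces.
\<close>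

definition basic_algebra ::
    "'v::ab_group_add itself \<Rightarrow> ('k::field, 'a::ring_1, 'm) alg_scheme \<Rightarrow> bool" where
  "basic_algebra _ A \<longleftrightarrow> finite_dimensional A \<and>
     (\<forall>(sV :: 'k \<Rightarrow> 'v \<Rightarrow> 'v) W \<rho>.
        irreducible_representation A sV W \<rho> \<longrightarrow> vector_space.dim sV W = 1)"


section \<open>Tensor powers\<close>

text \<open>
  A pure tensor \<open>v\<^sub>1 \<otimes> \<dots> \<otimes> v\<^sub>m\<close> is realised as the multilinear form
  \<open>(f\<^sub>1, \<dots>, f\<^sub>m) \<mapsto> f\<^sub>1(v\<^sub>1) \<cdots> f\<^sub>m(v\<^sub>m)\<close> on the dual space, and a tensor as a finite sum of pure
  tensors. Over a field the canonical map from \<open>V \<otimes> \<dots> \<otimes> V\<close> to these multilinear forms is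
  injective (without any finiteness assumption), so this is the tensor power of \<open>V\<close>, and for
  a subspace \<open>C\<close> the sums of pure tensors with entries in \<open>C\<close> form the tensor power of \<open>C\<close>.
  Arguments of a wrong length, or containing non-linear functions, are sent to \<open>0\<close>.
  Pitfall: tensors are functions, so they are added pointwise, but the pointwise \<open>*\<close> and \<open>1\<close>
  on functions are not the multiplication and the unit of the tensor powers of an algebra;
  those are \<open>tmul\<close> and \<open>tone\<close> below.
\<close>

type_synonym ('k, 'a) tensor = "('a \<Rightarrow> 'k) list \<Rightarrow> 'k"

definition ptensor :: "('k::field, 'a::ring_1, 'm) alg_scheme \<Rightarrow> 'a list \<Rightarrow> ('k, 'a) tensor" where
  "ptensor A v = (\<lambda>fs. if length fs = length v \<and> (\<forall>f\<in>set fs. Vector_Spaces.linear (scl A) (*) f)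
                       then \<Prod>i<length v. (fs ! i) (v ! i) else 0)"

definition tscale :: "'k::field \<Rightarrow> ('k, 'a) tensor \<Rightarrow> ('k, 'a) tensor" where
  "tscale c t = (\<lambda>fs. c * t fs)"

definition is_decomposition ::
    "('k::field, 'a::ring_1, 'm) alg_scheme \<Rightarrow> nat \<Rightarrow> ('k, 'a) tensor \<Rightarrow> 'a list list \<Rightarrow> bool" where
  "is_decomposition A m t vs \<longleftrightarrow>
     (\<forall>v\<in>set vs. length v = m \<and> set v \<subseteq> carr A) \<and> t = (\<Sum>v\<leftarrow>vs. ptensor A v)"

definition tpower ::
    "('k::field, 'a::ring_1, 'm) alg_scheme \<Rightarrow> nat \<Rightarrow> ('k, 'a) tensor set" where
  "tpower A m = {t. \<exists>vs. is_decomposition A m t vs}"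

text \<open>
  Linear extension: if \<open>t = \<Sum>\<^sub>i v\<^sub>i\<^sub>1 \<otimes> \<dots> \<otimes> v\<^sub>i\<^sub>m\<close> then \<open>tlift A m \<phi> t = \<Sum>\<^sub>i \<phi> [v\<^sub>i\<^sub>1, \<dots>, v\<^sub>i\<^sub>m]\<close>.
  It is only used with \<open>\<phi>\<close> multilinear on the carrier, where the value does not depend on the
  chosen decomposition.
\<close>

definition tlift ::
    "('k::field, 'a::ring_1, 'm) alg_scheme \<Rightarrow> nat \<Rightarrow> ('a list \<Rightarrow> 'c::comm_monoid_add)
      \<Rightarrow> ('k, 'a) tensor \<Rightarrow> 'c" where
  "tlift A m \<phi> t = (\<Sum>v\<leftarrow>(SOME vs. is_decomposition A m t vs). \<phi> v)"

abbreviation tlift2 ::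
    "('k::field, 'a::ring_1, 'm) alg_scheme \<Rightarrow> ('a \<Rightarrow> 'a \<Rightarrow> 'c::comm_monoid_add)
      \<Rightarrow> ('k, 'a) tensor \<Rightarrow> 'c" where
  "tlift2 A \<phi> t \<equiv> tlift A 2 (\<lambda>v. \<phi> (v ! 0) (v ! 1)) t"

abbreviation tlift3 ::
    "('k::field, 'a::ring_1, 'm) alg_scheme \<Rightarrow> ('a \<Rightarrow> 'a \<Rightarrow> 'a \<Rightarrow> 'c::comm_monoid_add)
      \<Rightarrow> ('k, 'a) tensor \<Rightarrow> 'c" where
  "tlift3 A \<phi> t \<equiv> tlift A 3 (\<lambda>v. \<phi> (v ! 0) (v ! 1) (v ! 2)) t"

definition tone :: "('k::field, 'a::ring_1, 'm) alg_scheme \<Rightarrow> nat \<Rightarrow> ('k, 'a) tensor" where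
  "tone A m = ptensor A (replicate m 1)"

definition tmul ::
    "('k::field, 'a::ring_1, 'm) alg_scheme \<Rightarrow> nat \<Rightarrow> ('k, 'a) tensor \<Rightarrow> ('k, 'a) tensor
      \<Rightarrow> ('k, 'a) tensor" where
  "tmul A m t u = tlift A m (\<lambda>v. tlift A m (\<lambda>w. ptensor A (map2 (*) v w)) u) t"

definition tinvertible ::
    "('k::field, 'a::ring_1, 'm) alg_scheme \<Rightarrow> nat \<Rightarrow> ('k, 'a) tensor \<Rightarrow> bool" where
  "tinvertible A m t \<longleftrightarrow> t \<in> tpower A m \<and>
     (\<exists>u\<in>tpower A m. tmul A m t u = tone A m \<and> tmul A m u t = tone A m)"

definition tinverse ::
    "('k::field, 'a::ring_1, 'm) alg_scheme \<Rightarrow> nat \<Rightarrow> ('k, 'a) tensor \<Rightarrow> ('k, 'a) tensor" where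
  "tinverse A m t = (THE u. u \<in> tpower A m \<and> tmul A m t u = tone A m \<and> tmul A m u t = tone A m)"

text \<open>\<open>t \<mapsto> 1 \<otimes> t\<close> and \<open>t \<mapsto> t \<otimes> 1\<close>, for \<open>t\<close> of degree \<open>m\<close>.\<close>

definition one_tensor ::
    "('k::field, 'a::ring_1, 'm) alg_scheme \<Rightarrow> nat \<Rightarrow> ('k, 'a) tensor \<Rightarrow> ('k, 'a) tensor" where
  "one_tensor A m t = tlift A m (\<lambda>v. ptensor A (1 # v)) t"

definition tensor_one ::
    "('k::field, 'a::ring_1, 'm) alg_scheme \<Rightarrow> nat \<Rightarrow> ('k, 'a) tensor \<Rightarrow> ('k, 'a) tensor" where
  "tensor_one A m t = tlift A m (\<lambda>v. ptensor A (v @ [1])) t"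


section \<open>Quasi-Hopf algebras\<close>

text \<open>The fields are \<open>\<Delta>\<close>, \<open>\<epsilon>\<close>, \<open>\<Phi>\<close>, \<open>S\<close>, \<open>\<alpha>\<close>, \<open>\<beta>\<close>; the maps are only relevant on the carrier.\<close>

record ('k, 'a) qhopf = "('k, 'a) alg" +
  comult :: "'a \<Rightarrow> ('k, 'a) tensor"
  counit :: "'a \<Rightarrow> 'k"
  assoc :: "('k, 'a) tensor"
  antip :: "'a \<Rightarrow> 'a"
  alph :: 'a
  bet :: 'a

text \<open>
  For \<open>t\<close> of degree \<open>m\<close>, \<open>comult_at H i m t\<close> applies \<open>\<Delta>\<close> to the tensor factor that has \<open>i\<close>
  factors on its left: \<open>comult_at H 0 2 = \<Delta> \<otimes> id\<close>, \<open>comult_at H 1 2 = id \<otimes> \<Delta>\<close>, and so on.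
\<close>

definition comult_at ::
    "('k::field, 'a::ring_1) qhopf \<Rightarrow> nat \<Rightarrow> nat \<Rightarrow> ('k, 'a) tensor \<Rightarrow> ('k, 'a) tensor" where
  "comult_at H i m t =
     tlift H m (\<lambda>v. tlift H 2 (\<lambda>d. ptensor H (take i v @ d @ drop (Suc i) v)) (comult H (v ! i))) t"

locale quasi_hopf_algebra = k_algebra H
  for H :: "('k::field, 'a::ring_1) qhopf" +
  assumes comult_closed: "h \<in> carr H \<Longrightarrow> comult H h \<in> tpower H 2"
    and comult_add: "h \<in> carr H \<Longrightarrow> h' \<in> carr H \<Longrightarrow> comult H (h + h') = comult H h + comult H h'"
    and comult_scl: "h \<in> carr H \<Longrightarrow> comult H (scl H c h) = tscale c (comult H h)"
    and comult_mult:
      "h \<in> carr H \<Longrightarrow> h' \<in> carr H \<Longrightarrow> comult H (h * h') = tmul H 2 (comult H h) (comult H h')"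
    and comult_one: "comult H 1 = tone H 2"
    and counit_add: "h \<in> carr H \<Longrightarrow> h' \<in> carr H \<Longrightarrow> counit H (h + h') = counit H h + counit H h'"
    and counit_scl: "h \<in> carr H \<Longrightarrow> counit H (scl H c h) = c * counit H h"
    and counit_mult: "h \<in> carr H \<Longrightarrow> h' \<in> carr H \<Longrightarrow> counit H (h * h') = counit H h * counit H h'"
    and counit_one: "counit H 1 = 1"
    and counit_left: "h \<in> carr H \<Longrightarrow> tlift2 H (\<lambda>a b. scl H (counit H a) b) (comult H h) = h"
    and counit_right: "h \<in> carr H \<Longrightarrow> tlift2 H (\<lambda>a b. scl H (counit H b) a) (comult H h) = h"
    and assoc_invertible: "tinvertible H 3 (assoc H)"
    and quasi_coassoc: "h \<in> carr H \<Longrightarrow>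
      comult_at H 1 2 (comult H h) =
        tmul H 3 (tmul H 3 (assoc H) (comult_at H 0 2 (comult H h))) (tinverse H 3 (assoc H))"
    and pentagon:
      "tmul H 4 (comult_at H 2 3 (assoc H)) (comult_at H 0 3 (assoc H)) =
        tmul H 4 (tmul H 4 (one_tensor H 3 (assoc H)) (comult_at H 1 3 (assoc H)))
          (tensor_one H 3 (assoc H))"
    and assoc_counit:
      "tlift3 H (\<lambda>x y z. ptensor H [scl H (counit H y) x, z]) (assoc H) = tone H 2"
    and antip_bij: "bij_betw (antip H) (carr H) (carr H)"
    and antip_add: "h \<in> carr H \<Longrightarrow> h' \<in> carr H \<Longrightarrow> antip H (h + h') = antip H h + antip H h'"
    and antip_scl: "h \<in> carr H \<Longrightarrow> antip H (scl H c h) = scl H c (antip H h)"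
    and antip_mult: "h \<in> carr H \<Longrightarrow> h' \<in> carr H \<Longrightarrow> antip H (h * h') = antip H h' * antip H h"
    and antip_one: "antip H 1 = 1"
    and alph_closed: "alph H \<in> carr H"
    and bet_closed: "bet H \<in> carr H"
    and antip_alph: "h \<in> carr H \<Longrightarrow>
      tlift2 H (\<lambda>a b. antip H a * alph H * b) (comult H h) = scl H (counit H h) (alph H)"
    and antip_bet: "h \<in> carr H \<Longrightarrow>
      tlift2 H (\<lambda>a b. a * bet H * antip H b) (comult H h) = scl H (counit H h) (bet H)"
    and assoc_antip: "tlift3 H (\<lambda>x y z. x * bet H * antip H y * alph H * z) (assoc H) = 1"
    and assoc_inverse_antip:
      "tlift3 H (\<lambda>x y z. antip H x * alph H * y * bet H * antip H z) (tinverse H 3 (assoc H)) = 1"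

text \<open>
  A Hopf algebra is regarded as a quasi-Hopf algebra in the standard way: with trivial
  associator and \<open>\<alpha> = \<beta> = 1\<close> the axioms above become the usual Hopf algebra axioms (with
  bijective antipode, which is automatic in finite dimension).
\<close>

locale hopf_algebra = quasi_hopf_algebra H
  for H :: "('k::field, 'a::ring_1) qhopf" +
  assumes assoc_trivial: "assoc H = tone H 3"
    and alph_trivial: "alph H = 1"
    and bet_trivial: "bet H = 1"


section \<open>Twisting\<close>

definition is_twist :: "('k::field, 'a::ring_1) qhopf \<Rightarrow> ('k, 'a) tensor \<Rightarrow> bool" where
  "is_twist H J \<longleftrightarrow> tinvertible H 2 J \<and>
     tlift2 H (\<lambda>f g. scl H (counit H f) g) J = 1 \<and>
     tlift2 H (\<lambda>f g. scl H (counit H g) f) J = 1"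

definition twist_alpha :: "('k::field, 'a::ring_1) qhopf \<Rightarrow> ('k, 'a) tensor \<Rightarrow> 'a" where
  "twist_alpha H J = tlift2 H (\<lambda>f g. antip H f * alph H * g) (tinverse H 2 J)"

definition twist_beta :: "('k::field, 'a::ring_1) qhopf \<Rightarrow> ('k, 'a) tensor \<Rightarrow> 'a" where
  "twist_beta H J = tlift2 H (\<lambda>f g. f * bet H * antip H g) J"

definition twist_comult ::
    "('k::field, 'a::ring_1) qhopf \<Rightarrow> ('k, 'a) tensor \<Rightarrow> 'a \<Rightarrow> ('k, 'a) tensor" where
  "twist_comult H J h = tmul H 2 (tmul H 2 J (comult H h)) (tinverse H 2 J)"

definition twist_assoc ::
    "('k::field, 'a::ring_1) qhopf \<Rightarrow> ('k, 'a) tensor \<Rightarrow> ('k, 'a) tensor" where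
  "twist_assoc H J =
     tmul H 3 (tmul H 3 (tmul H 3 (tmul H 3
       (one_tensor H 2 J) (comult_at H 1 2 J)) (assoc H))
       (comult_at H 0 2 (tinverse H 2 J))) (tinverse H 3 (tensor_one H 2 J))"

definition twist_antip :: "('k::field, 'a::ring_1) qhopf \<Rightarrow> ('k, 'a) tensor \<Rightarrow> 'a \<Rightarrow> 'a" where
  "twist_antip H J h = twist_beta H J * antip H h * alg_inverse H (twist_beta H J)"

definition twisted :: "('k::field, 'a::ring_1) qhopf \<Rightarrow> ('k, 'a) tensor \<Rightarrow> ('k, 'a) qhopf" where
  "twisted H J =
     \<lparr>carr = carr H, scl = scl H, comult = twist_comult H J, counit = counit H,
      assoc = twist_assoc H J, antip = twist_antip H J,
      alph = twist_beta H J * twist_alpha H J, bet = 1\<rparr>"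

definition quasi_hopf_iso ::
    "('k::field, 'a::ring_1) qhopf \<Rightarrow> ('k, 'b::ring_1) qhopf \<Rightarrow> ('a \<Rightarrow> 'b) \<Rightarrow> bool" where
  "quasi_hopf_iso H K f \<longleftrightarrow>
     bij_betw f (carr H) (carr K) \<and>
     (\<forall>a\<in>carr H. \<forall>b\<in>carr H. f (a + b) = f a + f b) \<and>
     (\<forall>c. \<forall>a\<in>carr H. f (scl H c a) = scl K c (f a)) \<and>
     (\<forall>a\<in>carr H. \<forall>b\<in>carr H. f (a * b) = f a * f b) \<and>
     f 1 = 1 \<and>
     (\<forall>h\<in>carr H. comult K (f h) = tlift H 2 (\<lambda>v. ptensor K (map f v)) (comult H h)) \<and>
     (\<forall>h\<in>carr H. counit K (f h) = counit H h) \<and>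
     assoc K = tlift H 3 (\<lambda>v. ptensor K (map f v)) (assoc H) \<and>
     (\<forall>h\<in>carr H. antip K (f h) = f (antip H h)) \<and>
     f (alph H) = alph K \<and>
     f (bet H) = bet K"

definition isomorphic_to_twist ::
    "('k::field, 'a::ring_1) qhopf \<Rightarrow> ('k, 'b::ring_1) qhopf \<Rightarrow> bool" where
  "isomorphic_to_twist H K \<longleftrightarrow>
     (\<exists>J f. is_twist K J \<and> alg_invertible K (twist_beta K J) \<and> quasi_hopf_iso H (twisted K J) f)"

definition twist_equivalent ::
    "('k::field, 'a::ring_1) qhopf \<Rightarrow> ('k, 'b::ring_1) qhopf \<Rightarrow> bool" where
  "twist_equivalent H K \<longleftrightarrow> isomorphic_to_twist H K \<or> isomorphic_to_twist K H"


section \<open>The Taft Hopf algebra and its twist\<close>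

definition primitive_root_of_unity :: "nat \<Rightarrow> 'k::field \<Rightarrow> bool" where
  "primitive_root_of_unity N q \<longleftrightarrow> N > 0 \<and> q ^ N = 1 \<and> (\<forall>m. 0 < m \<and> m < N \<longrightarrow> q ^ m \<noteq> 1)"

text \<open>
  \<open>taft n q H g x\<close>: the Hopf algebra \<open>H\<close>, with distinguished elements \<open>g\<close> and \<open>x\<close>, is \<open>H(q)\<close>.
  The relations make the monomials \<open>g\<^sup>i x\<^sup>j\<close> with \<open>i, j < n\<^sup>2\<close> span \<open>H\<close>; by the dimension
  condition they form a basis, so that there are no further relations.
\<close>

locale taft = hopf_algebra H
  for n :: nat and q :: "'k::field" and H :: "('k, 'a::ring_1) qhopf" and g x :: 'a +
  assumes g_closed: "g \<in> carr H"
    and x_closed: "x \<in> carr H"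
    and generated: "carr H = generated_subalgebra (scl H) {g, x}"
    and dimension: "alg_dim H = n ^ 4"
    and x_power: "x ^ (n\<^sup>2) = 0"
    and g_power: "g ^ (n\<^sup>2) = 1"
    and g_x: "g * x = scl H q (x * g)"
    and comult_g: "comult H g = ptensor H [g, g]"
    and comult_x: "comult H x = ptensor H [x, g] + ptensor H [1, x]"
    and counit_g: "counit H g = 1"
    and counit_x: "counit H x = 0"
    and antip_g: "antip H g = alg_inverse H g"
    and antip_x: "antip H x = - (x * alg_inverse H g)"

definition primitive_idempotent :: "'a::ring_1 set \<Rightarrow> 'a \<Rightarrow> bool" where
  "primitive_idempotent R e \<longleftrightarrow> e \<in> R \<and> e * e = e \<and> e \<noteq> 0 \<and>
     (\<forall>e1\<in>R. \<forall>e2\<in>R. e1 * e1 = e1 \<and> e2 * e2 = e2 \<and> e1 * e2 = 0 \<and> e2 * e1 = 0 \<and> e = e1 + e2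
        \<longrightarrow> e1 = 0 \<or> e2 = 0)"

definition idem :: "'k::field \<Rightarrow> ('k, 'a::ring_1) qhopf \<Rightarrow> 'a \<Rightarrow> nat \<Rightarrow> 'a" where
  "idem q H g z = (THE e. primitive_idempotent (generated_subalgebra (scl H) {g}) e \<and>
                          g * e = scl H (q ^ z) e)"

definition taft_twist ::
    "nat \<Rightarrow> 'k::field \<Rightarrow> ('k, 'a::ring_1) qhopf \<Rightarrow> 'a \<Rightarrow> ('k, 'a) tensor" where
  "taft_twist n q H g =
     (\<Sum>z<n\<^sup>2. \<Sum>y<n\<^sup>2. tscale (q powi (- (int z * (int y - int (y mod n)))))
                          (ptensor H [idem q H g z, idem q H g y]))"

definition A_taft ::
    "nat \<Rightarrow> 'k::field \<Rightarrow> ('k, 'a::ring_1) qhopf \<Rightarrow> 'a \<Rightarrow> 'a \<Rightarrow> ('k, 'a) qhopf" where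
  "A_taft n q H g x = (let J = taft_twist n q H g in
     \<lparr>carr = generated_subalgebra (scl H) {g ^ n, x}, scl = scl H,
      comult = twist_comult H J, counit = counit H, assoc = twist_assoc H J,
      antip = twist_antip H J, alph = g ^ n, bet = 1\<rparr>)"

end

theory Submission
  imports Defs
begin

text \<open>
  In terms of the idempotents \<open>1\<^sub>z\<close> all tensors built from \<open>J\<close> alone are diagonal. In particular
  \<open>\<Phi>\<^sub>J = \<Sum> q\<^bsup>-z(y' + w' - (y+w)')\<^esup> 1\<^sub>z \<otimes> 1\<^sub>y \<otimes> 1\<^sub>w\<close>, whose coefficients depend on the indices modulo \<open>n\<close>
  only, so it lies in the third tensor power of \<open>A(q)\<close>; the same happens for \<open>\<Delta>\<^sub>J\<close> and \<open>S\<^sub>J\<close> on the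
  generators. The axioms for \<open>A(q)\<close> are then inherited from the twist of \<open>H(q)\<close>, except for those that
  involve only \<open>\<Phi>\<^sub>J\<close>, which are identities between diagonal coefficients. Restricted to the
  one-dimensional representations of \<open>A(q)\<close>, the associator is a 3-cocycle on \<open>\<int>/n\<close>, which twisting
  changes by a coboundary. It is not a coboundary, since for \<open>z = w = 1\<close> its product over
  \<open>y\<close> is \<open>q\<^bsup>-n\<^esup>\<close>, while every coboundary has product \<open>1\<close>.
\<close>

section \<open>Multilinear maps and tensor powers\<close>

text \<open>The associator records the carry in adding last digits to the base n. Over Z/n this
  3-cocycle is nontrivial, but pulled back to Z/n^2 it is the coboundary of the inverse of
  \<open>K z y\<close>, because \<open>K\<close> reads the upper digit \<open>y div n\<close>, which
  absorbs the carry. Hence the root of order n^2: the twist exists over the large Hopf algebra only,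
  since its coefficients are not functions of residues modulo n, while the associator that it
  produces descends. That the structure maps preserve \<open>A(q)\<close> therefore has to be
  computed; it cannot be read off from where \<open>J\<close> lies. The value
  \<open>\<alpha> = a\<close> is the product \<open>\<beta>\<^sub>J \<alpha>\<^sub>J\<close>, with
  coefficient q^(n z) at the index z. A technical obstacle shapes the first half:
  \<open>tlift\<close> evaluates on an arbitrarily chosen decomposition over the carrier, so lifts
  over \<open>A(q)\<close> and over \<open>H(q)\<close> may choose differently. Each map to be
  lifted is first shown to be multilinear; then the choice does not matter, and identities of
  tensors reduce to pure tensors.\<close>

definition tuples :: "'z set \<Rightarrow> nat \<Rightarrow> 'z list set" where
  "tuples Z m = {zs. set zs \<subseteq> Z \<and> length zs = m}"

lemma tuples_0 [simp]: "tuples Z 0 = {[]}"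
  by (auto simp: tuples_def)

lemma Cons_in_tuples [simp]: "z # zs \<in> tuples Z (Suc m) \<longleftrightarrow> z \<in> Z \<and> zs \<in> tuples Z m"
  by (auto simp: tuples_def)

lemma finite_tuples: "finite Z \<Longrightarrow> finite (tuples Z m)"
  unfolding tuples_def by (rule finite_lists_length_eq)

lemma tuples_length: "zs \<in> tuples Z m \<Longrightarrow> length zs = m"
  by (simp add: tuples_def)

lemma tuples_nth: "zs \<in> tuples Z m \<Longrightarrow> i < m \<Longrightarrow> zs ! i \<in> Z"
  by (auto simp: tuples_def)

lemma tuples_iff_nth: "zs \<in> tuples Z m \<longleftrightarrow> length zs = m \<and> (\<forall>i<m. zs ! i \<in> Z)"
  by (fastforce simp: tuples_def in_set_conv_nth)

lemma tuples_update: "zs \<in> tuples Z m \<Longrightarrow> z \<in> Z \<Longrightarrow> zs[i := z] \<in> tuples Z m"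
  using set_update_subset_insert[of zs i z] by (auto simp: tuples_def)

lemma sum_tuples_Suc:
  "(\<Sum>zs\<in>tuples Z (Suc m). f zs) = (\<Sum>z\<in>Z. \<Sum>zs\<in>tuples Z m. f (z # zs))"
proof -
  have "(\<Sum>z\<in>Z. \<Sum>zs\<in>tuples Z m. f (z # zs)) = (\<Sum>(z, zs)\<in>Z \<times> tuples Z m. f (z # zs))"
    by (rule sum.cartesian_product)
  also have "\<dots> = (\<Sum>zs\<in>tuples Z (Suc m). f zs)"
    by (rule sum.reindex_bij_witness[where i = "\<lambda>zs. (hd zs, tl zs)" and j = "\<lambda>(z, zs). z # zs"])
       (auto simp: tuples_def length_Suc_conv)
  finally show ?thesis ..
qed

lemma sum_tuples_2: "(\<Sum>zs\<in>tuples Z 2. f zs) = (\<Sum>y\<in>Z. \<Sum>z\<in>Z. f [y, z])"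
  by (simp add: numeral_2_eq_2 sum_tuples_Suc)

lemma sum_tuples_3: "(\<Sum>zs\<in>tuples Z 3. f zs) = (\<Sum>x\<in>Z. \<Sum>y\<in>Z. \<Sum>z\<in>Z. f [x, y, z])"
  by (simp add: numeral_3_eq_3 sum_tuples_Suc)

lemma tuples_2E:
  assumes "v \<in> tuples Z 2"
  obtains a b where "v = [a, b]" "a \<in> Z" "b \<in> Z"
  using assms by (auto simp: tuples_def length_Suc_conv numeral_2_eq_2)

lemma tuples_3E:
  assumes "v \<in> tuples Z 3"
  obtains a b c where "v = [a, b, c]" "a \<in> Z" "b \<in> Z" "c \<in> Z"
  using assms by (auto simp: tuples_def length_Suc_conv numeral_3_eq_3)

lemma tuples_2I [simp]: "[a, b] \<in> tuples Z 2 \<longleftrightarrow> a \<in> Z \<and> b \<in> Z"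
  by (simp add: tuples_def)

lemma tuples_3I [simp]: "[a, b, c] \<in> tuples Z 3 \<longleftrightarrow> a \<in> Z \<and> b \<in> Z \<and> c \<in> Z"
  by (auto simp: tuples_def)

text \<open>
  The pointwise rules would rewrite inside tensors, which are functions.
\<close>

declare plus_fun_apply [simp del] zero_fun_apply [simp del] times_fun_apply [simp del]

lemma sum_list_fun_apply: "(\<Sum>v\<leftarrow>vs. F v) x = (\<Sum>v\<leftarrow>vs. F v x)"
  by (induction vs) (auto simp: plus_fun_apply zero_fun_apply)

lemma vector_space_tscale: "vector_space tscale"
  by unfold_locales (auto simp: tscale_def fun_eq_iff algebra_simps plus_fun_apply)

lemma vector_space_mult: "vector_space ((*) :: 'k::field \<Rightarrow> 'k \<Rightarrow> 'k)"
  by unfold_locales (auto simp: algebra_simps)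

interpretation tvs: vector_space tscale
  by (rule vector_space_tscale)

text \<open>List updates express multilinearity in all degrees at once. It is restricted to entries
  in the carrier because counits, antipodes and characters are constrained only there. The scalar
  multiplication of the target is a parameter, since targets are algebras, tensor powers and the
  field.\<close>

definition mlin ::
    "('k::field, 'a::ring_1, 'm) alg_scheme \<Rightarrow> ('k \<Rightarrow> 'c \<Rightarrow> 'c::ab_group_add) \<Rightarrow> nat
      \<Rightarrow> ('a list \<Rightarrow> 'c) \<Rightarrow> bool" where
  "mlin A sC m \<phi> \<longleftrightarrow> vector_space sC \<and>
     (\<forall>v\<in>tuples (carr A) m. \<forall>i<m.
        (\<forall>x\<in>carr A. \<forall>y\<in>carr A. \<phi> (v[i := x + y]) = \<phi> (v[i := x]) + \<phi> (v[i := y])) \<and>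
        (\<forall>c. \<forall>x\<in>carr A. \<phi> (v[i := scl A c x]) = sC c (\<phi> (v[i := x]))))"

lemma mlinI:
  assumes "vector_space sC"
    and "\<And>v i x y. v \<in> tuples (carr A) m \<Longrightarrow> i < m \<Longrightarrow> x \<in> carr A \<Longrightarrow> y \<in> carr A \<Longrightarrow>
           \<phi> (v[i := x + y]) = \<phi> (v[i := x]) + \<phi> (v[i := y])"
    and "\<And>v i c x. v \<in> tuples (carr A) m \<Longrightarrow> i < m \<Longrightarrow> x \<in> carr A \<Longrightarrow>
           \<phi> (v[i := scl A c x]) = sC c (\<phi> (v[i := x]))"
  shows "mlin A sC m \<phi>"
  using assms by (simp add: mlin_def)

lemma mlinD:
  assumes "mlin A sC m \<phi>"
  shows "vector_space sC"
    and "v \<in> tuples (carr A) m \<Longrightarrow> i < m \<Longrightarrow> x \<in> carr A \<Longrightarrow> y \<in> carr A \<Longrightarrow>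
           \<phi> (v[i := x + y]) = \<phi> (v[i := x]) + \<phi> (v[i := y])"
    and "v \<in> tuples (carr A) m \<Longrightarrow> i < m \<Longrightarrow> x \<in> carr A \<Longrightarrow>
           \<phi> (v[i := scl A c x]) = sC c (\<phi> (v[i := x]))"
  using assms by (auto simp: mlin_def)

lemma mlin_2I:
  assumes "vector_space sC"
    and "\<And>x x' y. x \<in> carr A \<Longrightarrow> x' \<in> carr A \<Longrightarrow> y \<in> carr A \<Longrightarrow> \<phi> (x + x') y = \<phi> x y + \<phi> x' y"
    and "\<And>x y y'. x \<in> carr A \<Longrightarrow> y \<in> carr A \<Longrightarrow> y' \<in> carr A \<Longrightarrow> \<phi> x (y + y') = \<phi> x y + \<phi> x y'"
    and "\<And>c x y. x \<in> carr A \<Longrightarrow> y \<in> carr A \<Longrightarrow> \<phi> (scl A c x) y = sC c (\<phi> x y)"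
    and "\<And>c x y. x \<in> carr A \<Longrightarrow> y \<in> carr A \<Longrightarrow> \<phi> x (scl A c y) = sC c (\<phi> x y)"
  shows "mlin A sC 2 (\<lambda>v. \<phi> (v ! 0) (v ! 1))"
  using assms by (intro mlinI) (auto elim!: tuples_2E simp: less_2_cases_iff)

lemma mlin_3I:
  assumes "vector_space sC"
    and "\<And>x x' y z. x \<in> carr A \<Longrightarrow> x' \<in> carr A \<Longrightarrow> y \<in> carr A \<Longrightarrow> z \<in> carr A \<Longrightarrow>
           \<phi> (x + x') y z = \<phi> x y z + \<phi> x' y z"
    and "\<And>x y y' z. x \<in> carr A \<Longrightarrow> y \<in> carr A \<Longrightarrow> y' \<in> carr A \<Longrightarrow> z \<in> carr A \<Longrightarrow>
           \<phi> x (y + y') z = \<phi> x y z + \<phi> x y' z"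
    and "\<And>x y z z'. x \<in> carr A \<Longrightarrow> y \<in> carr A \<Longrightarrow> z \<in> carr A \<Longrightarrow> z' \<in> carr A \<Longrightarrow>
           \<phi> x y (z + z') = \<phi> x y z + \<phi> x y z'"
    and "\<And>c x y z. x \<in> carr A \<Longrightarrow> y \<in> carr A \<Longrightarrow> z \<in> carr A \<Longrightarrow> \<phi> (scl A c x) y z = sC c (\<phi> x y z)"
    and "\<And>c x y z. x \<in> carr A \<Longrightarrow> y \<in> carr A \<Longrightarrow> z \<in> carr A \<Longrightarrow> \<phi> x (scl A c y) z = sC c (\<phi> x y z)"
    and "\<And>c x y z. x \<in> carr A \<Longrightarrow> y \<in> carr A \<Longrightarrow> z \<in> carr A \<Longrightarrow> \<phi> x y (scl A c z) = sC c (\<phi> x y z)"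
  shows "mlin A sC 3 (\<lambda>v. \<phi> (v ! 0) (v ! 1) (v ! 2))"
proof (rule mlinI)
  have 3: "i < 3 \<longleftrightarrow> i = 0 \<or> i = 1 \<or> i = (2::nat)" for i by auto
  fix v and i :: nat and x y assume "v \<in> tuples (carr A) 3" "i < 3" "x \<in> carr A" "y \<in> carr A"
  then show "\<phi> (v[i := x + y] ! 0) (v[i := x + y] ! 1) (v[i := x + y] ! 2) =
       \<phi> (v[i := x] ! 0) (v[i := x] ! 1) (v[i := x] ! 2) +
       \<phi> (v[i := y] ! 0) (v[i := y] ! 1) (v[i := y] ! 2)"
    using assms by (auto elim!: tuples_3E simp: 3)
next
  have 3: "i < 3 \<longleftrightarrow> i = 0 \<or> i = 1 \<or> i = (2::nat)" for i by auto
  fix v and i :: nat and c x assume "v \<in> tuples (carr A) 3" "i < 3" "x \<in> carr A"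
  then show "\<phi> (v[i := scl A c x] ! 0) (v[i := scl A c x] ! 1) (v[i := scl A c x] ! 2) =
       sC c (\<phi> (v[i := x] ! 0) (v[i := x] ! 1) (v[i := x] ! 2))"
    using assms by (auto elim!: tuples_3E simp: 3)
qed (fact assms)

text \<open>Restricted to \<open>tpower A m\<close>: a tensor outside has no decomposition, and
  \<open>tlift\<close> then takes an arbitrary value.\<close>

definition tlin ::
    "('k::field, 'a::ring_1, 'm) alg_scheme \<Rightarrow> nat \<Rightarrow> ('k \<Rightarrow> 'c \<Rightarrow> 'c::ab_group_add)
      \<Rightarrow> (('k, 'a) tensor \<Rightarrow> 'c) \<Rightarrow> bool" where
  "tlin A m sC F \<longleftrightarrow> (\<forall>t\<in>tpower A m. \<forall>u\<in>tpower A m. F (t + u) = F t + F u) \<and>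
     (\<forall>c. \<forall>t\<in>tpower A m. F (tscale c t) = sC c (F t))"

lemma tlinI:
  assumes "\<And>t u. t \<in> tpower A m \<Longrightarrow> u \<in> tpower A m \<Longrightarrow> F (t + u) = F t + F u"
    and "\<And>c t. t \<in> tpower A m \<Longrightarrow> F (tscale c t) = sC c (F t)"
  shows "tlin A m sC F"
  using assms by (simp add: tlin_def)

lemma tlinD:
  assumes "tlin A m sC F"
  shows "t \<in> tpower A m \<Longrightarrow> u \<in> tpower A m \<Longrightarrow> F (t + u) = F t + F u"
    and "t \<in> tpower A m \<Longrightarrow> F (tscale c t) = sC c (F t)"
  using assms by (auto simp: tlin_def)

context k_algebra
begin

lemma carr_add [intro, simp]: "a \<in> carr A \<Longrightarrow> b \<in> carr A \<Longrightarrow> a + b \<in> carr A"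
  and carr_scl [intro, simp]: "a \<in> carr A \<Longrightarrow> scl A c a \<in> carr A"
  and carr_0 [intro, simp]: "0 \<in> carr A"
  and carr_1 [intro, simp]: "1 \<in> carr A"
  and carr_mult [intro, simp]: "a \<in> carr A \<Longrightarrow> b \<in> carr A \<Longrightarrow> a * b \<in> carr A"
  using subalgebra_carr by (auto simp: subalgebra_def subspace_def)

lemma subspace_carr: "subspace (carr A)"
  using subalgebra_carr by (auto simp: subalgebra_def)

lemma carr_sum: "(\<And>i. i \<in> I \<Longrightarrow> f i \<in> carr A) \<Longrightarrow> (\<Sum>i\<in>I. f i) \<in> carr A"
  by (rule subspace_sum[OF subspace_carr])

lemma carr_uminus [intro, simp]: "a \<in> carr A \<Longrightarrow> - a \<in> carr A"
  by (rule subspace_neg[OF subspace_carr])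

lemma carr_power [intro, simp]: "a \<in> carr A \<Longrightarrow> a ^ j \<in> carr A"
  by (induction j) auto

lemma scl_mult_simps [simp]:
  "scl A c a * b = scl A c (a * b)" "a * scl A c b = scl A c (a * b)"
  by (simp_all add: scl_mult_left scl_mult_right[symmetric])

lemma mlin_sum:
  assumes "mlin A sC m \<phi>" "length us + length ws + 1 = m" "set us \<subseteq> carr A" "set ws \<subseteq> carr A"
    and "\<And>z. z \<in> Z \<Longrightarrow> u z \<in> carr A"
  shows "\<phi> (us @ (\<Sum>z\<in>Z. scl A (c z) (u z)) # ws) = (\<Sum>z\<in>Z. sC (c z) (\<phi> (us @ u z # ws)))"
proof -
  interpret C: vector_space sC by (rule mlinD(1)[OF assms(1)])
  let ?v = "us @ 0 # ws"
  have v: "?v \<in> tuples (carr A) m" "length us < m"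
    using assms by (auto simp: tuples_def)
  have add: "\<phi> (us @ (x + y) # ws) = \<phi> (us @ x # ws) + \<phi> (us @ y # ws)"
    if "x \<in> carr A" "y \<in> carr A" for x y
    using mlinD(2)[OF assms(1) v that] by simp
  have scale: "\<phi> (us @ scl A a x # ws) = sC a (\<phi> (us @ x # ws))" if "x \<in> carr A" for a x
    using mlinD(3)[OF assms(1) v that] by simp
  have 0: "\<phi> (us @ 0 # ws) = 0"
    using scale[of 0 0] by simp
  show ?thesis using assms(5)
  proof (induction Z rule: infinite_finite_induct)
    case (insert z Z)
    have "\<phi> (us @ (scl A (c z) (u z) + (\<Sum>z\<in>Z. scl A (c z) (u z))) # ws) =
        \<phi> (us @ scl A (c z) (u z) # ws) + \<phi> (us @ (\<Sum>z\<in>Z. scl A (c z) (u z)) # ws)"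
      by (rule add) (use insert in \<open>auto intro!: carr_sum\<close>)
    also have "\<phi> (us @ scl A (c z) (u z) # ws) = sC (c z) (\<phi> (us @ u z # ws))"
      by (rule scale) (use insert in auto)
    finally show ?case using insert by simp
  qed (auto simp: 0)
qed

text \<open>The arguments are expanded one at a time from the left. The prefix \<open>us\<close>
  holds the vectors already chosen, and the induction generalises over it.\<close>

lemma mlin_expand:
  assumes \<phi>: "mlin A sC m \<phi>" and "\<And>z. z \<in> Z \<Longrightarrow> u z \<in> carr A"
    and "length us + length cs = m" "set us \<subseteq> carr A"
  shows "\<phi> (us @ map (\<lambda>c. \<Sum>z\<in>Z. scl A (c z) (u z)) cs) =
    (\<Sum>zs\<in>tuples Z (length cs). sC (\<Prod>i<length cs. (cs ! i) (zs ! i)) (\<phi> (us @ map u zs)))"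
  using assms(3,4)
proof (induction cs arbitrary: us)
  case Nil
  interpret C: vector_space sC by (rule mlinD(1)[OF assms(1)])
  show ?case by simp
next
  case (Cons c cs)
  interpret C: vector_space sC by (rule mlinD(1)[OF assms(1)])
  let ?f = "\<lambda>c. \<Sum>z\<in>Z. scl A (c z) (u z)"
  have "\<phi> (us @ map ?f (c # cs)) = \<phi> (us @ ?f c # map ?f cs)" by simp
  also have "\<dots> = (\<Sum>z\<in>Z. sC (c z) (\<phi> (us @ u z # map ?f cs)))"
    by (rule mlin_sum[OF \<phi>]) (use Cons.prems assms(2) in \<open>auto intro!: carr_sum\<close>)
  also have "\<dots> = (\<Sum>z\<in>Z. sC (c z) (\<Sum>zs\<in>tuples Z (length cs).
      sC (\<Prod>i<length cs. (cs ! i) (zs ! i)) (\<phi> (us @ u z # map u zs))))"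
  proof (intro sum.cong refl)
    fix z assume "z \<in> Z"
    then show "sC (c z) (\<phi> (us @ u z # map ?f cs)) = sC (c z) (\<Sum>zs\<in>tuples Z (length cs).
      sC (\<Prod>i<length cs. (cs ! i) (zs ! i)) (\<phi> (us @ u z # map u zs)))"
      using Cons.IH[of "us @ [u z]"] Cons.prems assms(2) by simp
  qed
  also have "\<dots> = (\<Sum>zs\<in>tuples Z (length (c # cs)).
      sC (\<Prod>i<length (c # cs). ((c # cs) ! i) (zs ! i)) (\<phi> (us @ map u zs)))"
    by (simp add: sum_tuples_Suc C.scale_sum_right prod.lessThan_Suc_shift
        del: prod.lessThan_Suc)
  finally show ?case .
qed

lemma linear_nth:
  assumes "\<forall>f\<in>set fs. Vector_Spaces.linear (scl A) (*) f" "i < length fs"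
  shows "(fs ! i) (x + y) = (fs ! i) x + (fs ! i) y" "(fs ! i) (scl A c x) = c * (fs ! i) x"
proof -
  interpret f: Vector_Spaces.linear "scl A" "(*)" "fs ! i"
    using assms by auto
  show "(fs ! i) (x + y) = (fs ! i) x + (fs ! i) y" "(fs ! i) (scl A c x) = c * (fs ! i) x"
    by (rule f.add, rule f.scale)
qed

lemma mlin_ptensor: "mlin A tscale m (ptensor A)"
proof (rule mlinI[OF vector_space_tscale])
  fix v i x y assume v: "v \<in> tuples (carr A) m" and i: "i < m"
  have [simp]: "length v = m" using v by (simp add: tuples_length)
  have P: "(\<Prod>j<m. (fs ! j) (v[i := z] ! j)) = (fs ! i) z * (\<Prod>j\<in>{..<m} - {i}. (fs ! j) (v ! j))"
    for fs :: "('a \<Rightarrow> 'k) list" and z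
    using i by (subst prod.remove[of _ i]) (auto intro!: prod.cong)
  show "ptensor A (v[i := x + y]) = ptensor A (v[i := x]) + ptensor A (v[i := y])"
    using i by (auto simp: fun_eq_iff plus_fun_apply ptensor_def P distrib_right linear_nth(1))
next
  fix v i c x assume v: "v \<in> tuples (carr A) m" and i: "i < m"
  have [simp]: "length v = m" using v by (simp add: tuples_length)
  have P: "(\<Prod>j<m. (fs ! j) (v[i := z] ! j)) = (fs ! i) z * (\<Prod>j\<in>{..<m} - {i}. (fs ! j) (v ! j))"
    for fs :: "('a \<Rightarrow> 'k) list" and z
    using i by (subst prod.remove[of _ i]) (auto intro!: prod.cong)
  show "ptensor A (v[i := scl A c x]) = tscale c (ptensor A (v[i := x]))"
    using i by (auto simp: fun_eq_iff ptensor_def tscale_def P linear_nth(2))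
qed

text \<open>\<open>ptensor\<close> tests only against functionals that are linear on the whole
  ambient type, so a basis \<open>B0\<close> of the carrier is extended to an ambient basis
  \<open>E\<close>, whose coordinate functionals are used. Elements of \<open>X\<close> lie in the
  span of \<open>B0\<close>, hence their coordinates vanish off \<open>B0\<close>, and finitely many
  vectors of the carrier suffice.\<close>

lemma dual_basis_exists:
  assumes "finite X" "X \<subseteq> carr A"
  obtains B d where "finite B" "B \<subseteq> carr A"
    and "\<And>b. Vector_Spaces.linear (scl A) (*) (d b)"
    and "\<And>x. x \<in> X \<Longrightarrow> x = (\<Sum>b\<in>B. scl A (d b x) b)"
proof -
  obtain B0 where B0: "B0 \<subseteq> carr A" "independent B0" "carr A \<subseteq> span B0"
    using maximal_independent_subset[of "carr A"] by blast
  define E where "E = extend_basis B0"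
  have E: "B0 \<subseteq> E" "independent E" "span E = UNIV"
    using B0 extend_basis_superset independent_extend_basis span_extend_basis
    by (auto simp: E_def)
  define d where "d = (\<lambda>b x. representation E x b)"
  define B where "B = (\<Union>x\<in>X. {b. representation B0 x b \<noteq> 0})"
  have "finite B"
    unfolding B_def using assms(1) finite_representation by auto
  moreover have "B \<subseteq> carr A"
    unfolding B_def using representation_ne_zero B0(1) by blast
  moreover have "Vector_Spaces.linear (scl A) (*) (d b)" for b
    using linear_representation[OF E(2,3), of b] by (simp add: d_def)
  moreover have "x = (\<Sum>b\<in>B. scl A (d b x) b)" if "x \<in> X" for x
  proof -
    have sp: "x \<in> span B0" using that assms B0 by blast
    have r: "representation E x = representation B0 x"
      using representation_extend[OF E(2) sp E(1)] .
    have "(\<Sum>b\<in>B. scl A (d b x) b) = (\<Sum>b\<in>{b. representation B0 x b \<noteq> 0}. scl A (d b x) b)"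
      using \<open>finite B\<close> that by (intro sum.mono_neutral_right) (auto simp: B_def d_def r)
    also have "\<dots> = x"
      using sum_nonzero_representation_eq[OF B0(2) sp] by (simp add: d_def r)
    finally show ?thesis ..
  qed
  ultimately show ?thesis using that by blast
qed

text \<open>
  Expanding all entries in a finite dual basis expresses \<open>\<Sum>\<^sub>i \<phi>(v\<^sub>i)\<close> through the values of the
  tensor \<open>\<Sum>\<^sub>i v\<^sub>i\<^sub>1 \<otimes> \<dots> \<otimes> v\<^sub>i\<^sub>m\<close> alone.
\<close>

lemma tlift_eq:
  assumes \<phi>: "mlin A sC m \<phi>" and t: "is_decomposition A m t vs"
  shows "tlift A m \<phi> t = (\<Sum>v\<leftarrow>vs. \<phi> v)"
proof -
  define ws where "ws = (SOME vs. is_decomposition A m t vs)"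
  have ws: "is_decomposition A m t ws"
    unfolding ws_def by (rule someI[where P = "is_decomposition A m t", OF t])
  interpret C: vector_space sC by (rule mlinD(1)[OF assms(1)])
  have fin: "finite (\<Union>v\<in>set vs \<union> set ws. set v)" by auto
  have sub: "(\<Union>v\<in>set vs \<union> set ws. set v) \<subseteq> carr A"
    using t ws by (auto simp: is_decomposition_def)
  obtain B d where B: "finite B" "B \<subseteq> carr A"
    and d: "\<And>b. Vector_Spaces.linear (scl A) (*) (d b)"
    and x: "\<And>x. x \<in> (\<Union>v\<in>set vs \<union> set ws. set v) \<Longrightarrow> x = (\<Sum>b\<in>B. scl A (d b x) b)"
    using dual_basis_exists[OF fin sub] by metis
  have vals: "\<phi> v = (\<Sum>bs\<in>tuples B m. sC (ptensor A v (map d bs)) (\<phi> bs))"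
    if v: "v \<in> set vs \<union> set ws" for v
  proof -
    have len: "length v = m" using v t ws by (auto simp: is_decomposition_def)
    have "(\<Sum>b\<in>B. scl A (d b y) b) = y" if "y \<in> set v" for y
      by (rule x[symmetric]) (use that v in auto)
    then have "\<phi> v = \<phi> ([] @ map (\<lambda>c. \<Sum>b\<in>B. scl A (c b) b) (map (\<lambda>x b. d b x) v))"
      by (auto intro!: arg_cong[of _ _ \<phi>] map_idI[symmetric])
    also have "\<dots> = (\<Sum>bs\<in>tuples B m. sC (\<Prod>i<m. (map (\<lambda>x b. d b x) v ! i) (bs ! i)) (\<phi> bs))"
      by (subst mlin_expand[OF \<phi>]) (use len B in auto)
    also have "\<dots> = (\<Sum>bs\<in>tuples B m. sC (ptensor A v (map d bs)) (\<phi> bs))"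
      using len d by (intro sum.cong) (auto simp: ptensor_def tuples_def intro!: arg_cong2[of _ _ _ _ sC] prod.cong)
    finally show ?thesis .
  qed
  have main: "(\<Sum>v\<leftarrow>us. \<phi> v) = (\<Sum>bs\<in>tuples B m. sC (t (map d bs)) (\<phi> bs))"
    if us: "set us \<subseteq> set vs \<union> set ws" "t = (\<Sum>v\<leftarrow>us. ptensor A v)" for us
  proof -
    have "(\<Sum>v\<leftarrow>us. \<phi> v) = (\<Sum>bs\<in>tuples B m. sC (\<Sum>v\<leftarrow>us. ptensor A v (map d bs)) (\<phi> bs))"
      using us(1) by (induction us) (auto simp: vals C.scale_left_distrib sum.distrib)
    then show ?thesis by (simp add: us(2) sum_list_fun_apply)
  qed
  have "tlift A m \<phi> t = (\<Sum>v\<leftarrow>ws. \<phi> v)"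
    by (simp add: tlift_def ws_def)
  also have "\<dots> = (\<Sum>v\<leftarrow>vs. \<phi> v)"
    using main[of vs] main[of ws] t ws by (simp add: is_decomposition_def)
  finally show ?thesis .
qed

lemma tpowerE:
  assumes "t \<in> tpower A m"
  obtains vs where "is_decomposition A m t vs" "set vs \<subseteq> tuples (carr A) m"
    "t = (\<Sum>v\<leftarrow>vs. ptensor A v)"
  using assms by (auto simp: tpower_def is_decomposition_def tuples_def)

lemma is_decompositionI:
  "set vs \<subseteq> tuples (carr A) m \<Longrightarrow> t = (\<Sum>v\<leftarrow>vs. ptensor A v) \<Longrightarrow> is_decomposition A m t vs"
  by (auto simp: is_decomposition_def tuples_def)

lemma tpower_0 [simp, intro]: "0 \<in> tpower A m"
  unfolding tpower_def using is_decompositionI[of "[]" m 0] by auto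

lemma tpower_ptensor: "v \<in> tuples (carr A) m \<Longrightarrow> ptensor A v \<in> tpower A m"
  unfolding tpower_def using is_decompositionI[of "[v]" m "ptensor A v"] by auto

lemma tpower_add [simp, intro]:
  assumes "t \<in> tpower A m" "u \<in> tpower A m"
  shows "t + u \<in> tpower A m"
proof -
  obtain vs ws where "set vs \<subseteq> tuples (carr A) m" "t = (\<Sum>v\<leftarrow>vs. ptensor A v)"
    "set ws \<subseteq> tuples (carr A) m" "u = (\<Sum>v\<leftarrow>ws. ptensor A v)"
    using assms by (elim tpowerE)
  then have "is_decomposition A m (t + u) (vs @ ws)"
    by (intro is_decompositionI) auto
  then show ?thesis by (auto simp: tpower_def)
qed

lemma tlift_ptensor:
  "mlin A sC m \<phi> \<Longrightarrow> v \<in> tuples (carr A) m \<Longrightarrow> tlift A m \<phi> (ptensor A v) = \<phi> v"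
  using tlift_eq[of sC m \<phi> "ptensor A v" "[v]"] is_decompositionI[of "[v]" m "ptensor A v"] by simp

lemma tlift_add:
  assumes "mlin A sC m \<phi>" "t \<in> tpower A m" "u \<in> tpower A m"
  shows "tlift A m \<phi> (t + u) = tlift A m \<phi> t + tlift A m \<phi> u"
proof -
  obtain vs ws where *: "set vs \<subseteq> tuples (carr A) m" "t = (\<Sum>v\<leftarrow>vs. ptensor A v)"
    "set ws \<subseteq> tuples (carr A) m" "u = (\<Sum>v\<leftarrow>ws. ptensor A v)"
    "is_decomposition A m t vs" "is_decomposition A m u ws"
    using assms(2,3) by (elim tpowerE)
  then have "is_decomposition A m (t + u) (vs @ ws)"
    by (intro is_decompositionI) auto
  from tlift_eq[OF assms(1) this] show ?thesis
    using tlift_eq[OF assms(1) *(5)] tlift_eq[OF assms(1) *(6)] by simp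
qed

lemma tuples_scaled_head:
  assumes "v \<in> tuples (carr A) (Suc m)"
  shows "v[0 := scl A c (v ! 0)] \<in> tuples (carr A) (Suc m)"
  using assms by (auto intro!: tuples_update intro: tuples_nth)

lemma sum_list_mlin_scale:
  assumes "mlin A sC (Suc m) \<phi>" "set vs \<subseteq> tuples (carr A) (Suc m)"
  shows "(\<Sum>v\<leftarrow>map (\<lambda>v. v[0 := scl A c (v ! 0)]) vs. \<phi> v) = sC c (\<Sum>v\<leftarrow>vs. \<phi> v)"
proof -
  interpret C: vector_space sC by (rule mlinD(1)[OF assms(1)])
  show ?thesis
    using assms(2)
  proof (induction vs)
    case (Cons v vs)
    have "\<phi> (v[0 := scl A c (v ! 0)]) = sC c (\<phi> (v[0 := v ! 0]))"
      using Cons.prems by (intro mlinD(3)[OF assms(1)]) (auto intro: tuples_nth)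
    then show ?case using Cons by (simp add: C.scale_right_distrib)
  qed simp
qed

text \<open>Scaling is only considered in positive degree: sums of empty tuples are integer multiples of \<open>1\<close>.\<close>

lemma
  assumes t: "t \<in> tpower A m" and m: "m > 0"
  shows tpower_tscale [simp, intro]: "tscale c t \<in> tpower A m"
    and tlift_tscale: "mlin A sC m \<phi> \<Longrightarrow> tlift A m \<phi> (tscale c t) = sC c (tlift A m \<phi> t)"
proof -
  obtain m' where m': "m = Suc m'" using m by (cases m) auto
  obtain vs where vs: "is_decomposition A m t vs" "set vs \<subseteq> tuples (carr A) m"
     "t = (\<Sum>v\<leftarrow>vs. ptensor A v)"
    using t by (elim tpowerE)
  let ?vs = "map (\<lambda>v. v[0 := scl A c (v ! 0)]) vs"
  have dec: "is_decomposition A m (tscale c t) ?vs"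
  proof (rule is_decompositionI)
    show "set ?vs \<subseteq> tuples (carr A) m"
      using vs tuples_scaled_head by (auto simp: m')
    show "tscale c t = (\<Sum>v\<leftarrow>?vs. ptensor A v)"
      unfolding vs(3) by (rule sum_list_mlin_scale[OF mlin_ptensor, symmetric]) (use vs(2) m' in simp)
  qed
  show "tscale c t \<in> tpower A m" using dec by (auto simp: tpower_def)
  assume \<phi>: "mlin A sC m \<phi>"
  show "tlift A m \<phi> (tscale c t) = sC c (tlift A m \<phi> t)"
    unfolding tlift_eq[OF \<phi> dec] tlift_eq[OF \<phi> vs(1)]
    by (rule sum_list_mlin_scale) (use \<phi> vs(2) m' in simp_all)
qed

lemma tpower_sum: "(\<And>i. i \<in> I \<Longrightarrow> f i \<in> tpower A m) \<Longrightarrow> (\<Sum>i\<in>I. f i) \<in> tpower A m"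
  by (induction I rule: infinite_finite_induct) auto

lemma tlin_tlift: "mlin A sC m \<phi> \<Longrightarrow> m > 0 \<Longrightarrow> tlin A m sC (tlift A m \<phi>)"
  by (intro tlinI tlift_add tlift_tscale)

lemma tlin_0: "tlin A m sC F \<Longrightarrow> F 0 = 0"
  using tlinD(1)[of A m sC F 0 0] by simp

lemma tlin_sum:
  assumes "tlin A m sC F" "\<And>i. i \<in> I \<Longrightarrow> f i \<in> tpower A m"
  shows "F (\<Sum>i\<in>I. f i) = (\<Sum>i\<in>I. F (f i))"
  using assms(2)
  by (induction I rule: infinite_finite_induct)
     (auto simp: tlin_0[OF assms(1)] tlinD(1)[OF assms(1)] tpower_sum)

text \<open>Scalar multiples need no case of their own, since a tensor is by definition a plain sum
  of pure tensors.\<close>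

lemma tpower_induct [consumes 1, case_names zero pure add]:
  assumes "t \<in> tpower A m" "P 0" "\<And>v. v \<in> tuples (carr A) m \<Longrightarrow> P (ptensor A v)"
    and "\<And>t u. t \<in> tpower A m \<Longrightarrow> u \<in> tpower A m \<Longrightarrow> P t \<Longrightarrow> P u \<Longrightarrow> P (t + u)"
  shows "P t"
proof -
  have "P (\<Sum>v\<leftarrow>vs. ptensor A v) \<and> (\<Sum>v\<leftarrow>vs. ptensor A v) \<in> tpower A m"
    if "set vs \<subseteq> tuples (carr A) m" for vs
    using that by (induction vs) (auto intro!: assms tpower_ptensor)
  then show ?thesis using assms(1) by (elim tpowerE) auto
qed

text \<open>Most tensor identities below are proved by this reduction to pure tensors, applied once
  for each tensor argument.\<close>

lemma tlin_eqI:
  assumes "t \<in> tpower A m" "tlin A m sC F" "tlin A m sC' G"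
    and "\<And>v. v \<in> tuples (carr A) m \<Longrightarrow> F (ptensor A v) = G (ptensor A v)"
  shows "F t = G t"
  using assms(1)
  by (induction t rule: tpower_induct)
     (auto simp: assms(4) tlin_0[OF assms(2)] tlin_0[OF assms(3)] tlinD(1)[OF assms(2)]
        tlinD(1)[OF assms(3)])

lemma tlin_closed:
  assumes "t \<in> tpower A m" "tlin A m sC F"
    and "\<And>v. v \<in> tuples (carr A) m \<Longrightarrow> F (ptensor A v) \<in> T"
    and "0 \<in> T" "\<And>x y. x \<in> T \<Longrightarrow> y \<in> T \<Longrightarrow> x + y \<in> T"
  shows "F t \<in> T"
  using assms(1)
  by (induction t rule: tpower_induct)
     (auto simp: assms(3-5) tlin_0[OF assms(2)] tlinD(1)[OF assms(2)])

lemma tlin_comp: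
  assumes "tlin A m tscale F" "\<And>t. t \<in> tpower A m \<Longrightarrow> F t \<in> tpower B m'" "tlin B m' sC G"
  shows "tlin A m sC (\<lambda>t. G (F t))"
  using assms by (auto simp: tlin_def)

lemma tlin_id: "tlin A m tscale (\<lambda>t. t)"
  by (simp add: tlin_def)

end

section \<open>The algebra structure of the tensor powers\<close>

lemma map2_update_left:
  "length v = length w \<Longrightarrow> i < length v \<Longrightarrow> map2 f (v[i := x]) w = (map2 f v w)[i := f x (w ! i)]"
  by (rule nth_equalityI) (auto simp: nth_list_update)

lemma map2_update_right:
  "length v = length w \<Longrightarrow> i < length v \<Longrightarrow> map2 f v (w[i := x]) = (map2 f v w)[i := f (v ! i) x]"
  by (rule nth_equalityI) (auto simp: nth_list_update)

lemma tuples_append: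
  "v \<in> tuples Z m \<Longrightarrow> w \<in> tuples Z m' \<Longrightarrow> v @ w \<in> tuples Z (m + m')"
  by (auto simp: tuples_def)

lemma tuples_take: "v \<in> tuples Z m \<Longrightarrow> i \<le> m \<Longrightarrow> take i v \<in> tuples Z i"
  by (auto simp: tuples_def dest: in_set_takeD)

lemma tuples_drop: "v \<in> tuples Z m \<Longrightarrow> drop i v \<in> tuples Z (m - i)"
  by (auto simp: tuples_def dest: in_set_dropD)

context k_algebra
begin

lemma tuples_map2 [intro, simp]:
  "v \<in> tuples (carr A) m \<Longrightarrow> w \<in> tuples (carr A) m \<Longrightarrow> map2 (*) v w \<in> tuples (carr A) m"
  by (auto simp: tuples_iff_nth)

lemma tuples_ones [intro, simp]: "replicate m 1 \<in> tuples (carr A) m"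
  by (auto simp: tuples_def)

lemma tuples_insert_at:
  assumes "v \<in> tuples (carr A) m" "i < m" "d \<in> tuples (carr A) 2"
  shows "take i v @ d @ drop (Suc i) v \<in> tuples (carr A) (Suc m)"
proof -
  have "take i v @ d @ drop (Suc i) v \<in> tuples (carr A) (i + (2 + (m - Suc i)))"
    using assms by (intro tuples_append tuples_take tuples_drop) auto
  then show ?thesis using assms(2) by simp
qed

lemma mlin_map2_left:
  assumes "mlin A sC m \<phi>" "w \<in> tuples (carr A) m"
  shows "mlin A sC m (\<lambda>v. \<phi> (map2 (*) v w))"
proof (rule mlinI)
  show "vector_space sC" using assms(1) by (rule mlinD(1))
next
  fix v i x y assume *: "v \<in> tuples (carr A) m" "i < m" "x \<in> carr A" "y \<in> carr A"
  then show "\<phi> (map2 (*) (v[i := x + y]) w) = \<phi> (map2 (*) (v[i := x]) w) + \<phi> (map2 (*) (v[i := y]) w)"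
    using assms(2) mlinD(2)[OF assms(1) tuples_map2[OF *(1) assms(2)] *(2)]
    by (simp add: map2_update_left tuples_length tuples_nth distrib_right)
next
  fix v i c x assume *: "v \<in> tuples (carr A) m" "i < m" "x \<in> carr A"
  then show "\<phi> (map2 (*) (v[i := scl A c x]) w) = sC c (\<phi> (map2 (*) (v[i := x]) w))"
    using assms(2) mlinD(3)[OF assms(1) tuples_map2[OF *(1) assms(2)] *(2)]
    by (simp add: map2_update_left tuples_length tuples_nth)
qed

lemma mlin_map2_right:
  assumes "mlin A sC m \<phi>" "w \<in> tuples (carr A) m"
  shows "mlin A sC m (\<lambda>v. \<phi> (map2 (*) w v))"
proof (rule mlinI)
  show "vector_space sC" using assms(1) by (rule mlinD(1))
next
  fix v i x y assume *: "v \<in> tuples (carr A) m" "i < m" "x \<in> carr A" "y \<in> carr A"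
  then show "\<phi> (map2 (*) w (v[i := x + y])) = \<phi> (map2 (*) w (v[i := x])) + \<phi> (map2 (*) w (v[i := y]))"
    using assms(2) mlinD(2)[OF assms(1) tuples_map2[OF assms(2) *(1)] *(2)]
    by (simp add: map2_update_right tuples_length tuples_nth distrib_left)
next
  fix v i c x assume *: "v \<in> tuples (carr A) m" "i < m" "x \<in> carr A"
  then show "\<phi> (map2 (*) w (v[i := scl A c x])) = sC c (\<phi> (map2 (*) w (v[i := x])))"
    using assms(2) mlinD(3)[OF assms(1) tuples_map2[OF assms(2) *(1)] *(2)]
    by (simp add: map2_update_right tuples_length tuples_nth)
qed

lemma mlin_append:
  assumes "mlin A sC (p + m + r) \<phi>" "ps \<in> tuples (carr A) p" "rs \<in> tuples (carr A) r"
  shows "mlin A sC m (\<lambda>v. \<phi> (ps @ v @ rs))"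
proof (rule mlinI)
  show "vector_space sC" using assms(1) by (rule mlinD(1))
next
  have upd: "(ps @ v @ rs)[p + i := x] = ps @ v[i := x] @ rs" if "length v = m" "i < m" for v i x
    using that tuples_length[OF assms(2)] by (simp add: list_update_append)
  have tup: "ps @ v @ rs \<in> tuples (carr A) (p + m + r)" if "v \<in> tuples (carr A) m" for v
    using that assms(2,3) by (auto simp: tuples_def)
  { fix v i x y assume *: "v \<in> tuples (carr A) m" "i < m" "x \<in> carr A" "y \<in> carr A"
    then show "\<phi> (ps @ v[i := x + y] @ rs) = \<phi> (ps @ v[i := x] @ rs) + \<phi> (ps @ v[i := y] @ rs)"
      using mlinD(2)[OF assms(1) tup[OF *(1)], of "p + i"] by (simp add: upd tuples_length)
  next
    fix v i c x assume *: "v \<in> tuples (carr A) m" "i < m" "x \<in> carr A"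
    then show "\<phi> (ps @ v[i := scl A c x] @ rs) = sC c (\<phi> (ps @ v[i := x] @ rs))"
      using mlinD(3)[OF assms(1) tup[OF *(1)], of "p + i"] by (simp add: upd tuples_length) }
qed

lemma tlin_add_fun:
  assumes "vector_space sC" "tlin A m sC F" "tlin A m sC G"
  shows "tlin A m sC (\<lambda>t. F t + G t)"
proof -
  interpret C: vector_space sC by fact
  show ?thesis
    using assms by (auto simp: tlin_def C.scale_right_distrib)
qed

lemma tlin_scale_fun:
  assumes "vector_space sC" "tlin A m sC F"
  shows "tlin A m sC (\<lambda>t. sC c (F t))"
proof -
  interpret C: vector_space sC by fact
  show ?thesis
    using assms by (auto simp: tlin_def C.scale_right_distrib mult.commute)
qed

text \<open>Needed for nested lifts such as \<open>tmul\<close>: the outer lift is well defined only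
  if the inner one depends multilinearly on the outer entries. This is checked on pure inner
  tensors.\<close>

lemma mlin_tlift_param:
  assumes 1: "\<And>v. v \<in> tuples (carr A) m \<Longrightarrow> mlin A sC m' (\<psi> v)"
    and 2: "\<And>w. w \<in> tuples (carr A) m' \<Longrightarrow> mlin A sC m (\<lambda>v. \<psi> v w)"
    and u: "u \<in> tpower A m'" and m': "m' > 0" and sC: "vector_space sC"
  shows "mlin A sC m (\<lambda>v. tlift A m' (\<psi> v) u)"
proof (rule mlinI[OF sC])
  fix v i x y assume *: "v \<in> tuples (carr A) m" "i < m" "x \<in> carr A" "y \<in> carr A"
  have upd: "v[i := z] \<in> tuples (carr A) m" if "z \<in> carr A" for z
    using * that by (intro tuples_update)
  note lin = tlin_tlift[OF 1[OF upd] m']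
  show "tlift A m' (\<psi> (v[i := x + y])) u = tlift A m' (\<psi> (v[i := x])) u + tlift A m' (\<psi> (v[i := y])) u"
    by (rule tlin_eqI[OF u lin tlin_add_fun[OF sC lin lin]])
       (use * 1 upd mlinD(2)[OF 2 *] in \<open>simp_all add: tlift_ptensor[OF 1]\<close>)
next
  fix v i c x assume *: "v \<in> tuples (carr A) m" "i < m" "x \<in> carr A"
  have upd: "v[i := z] \<in> tuples (carr A) m" if "z \<in> carr A" for z
    using * that by (intro tuples_update)
  note lin = tlin_tlift[OF 1[OF upd] m']
  show "tlift A m' (\<psi> (v[i := scl A c x])) u = sC c (tlift A m' (\<psi> (v[i := x])) u)"
    by (rule tlin_eqI[OF u lin tlin_scale_fun[OF sC lin]])
       (use * 1 upd mlinD(3)[OF 2 *] in \<open>simp_all add: tlift_ptensor[OF 1]\<close>)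
qed

lemma mlin_mul_ptensor_right:
  "v \<in> tuples (carr A) m \<Longrightarrow> mlin A tscale m (\<lambda>w. ptensor A (map2 (*) v w))"
  by (rule mlin_map2_right[OF mlin_ptensor])

lemma mlin_tmul:
  assumes "u \<in> tpower A m" "m > 0"
  shows "mlin A tscale m (\<lambda>v. tlift A m (\<lambda>w. ptensor A (map2 (*) v w)) u)"
  using assms
  by (intro mlin_tlift_param mlin_mul_ptensor_right mlin_map2_left[OF mlin_ptensor] vector_space_tscale)

lemma tlin_tmul_left: "u \<in> tpower A m \<Longrightarrow> m > 0 \<Longrightarrow> tlin A m tscale (\<lambda>t. tmul A m t u)"
  unfolding tmul_def by (rule tlin_tlift[OF mlin_tmul])

lemma tmul_ptensor_left:
  assumes "v \<in> tuples (carr A) m" "u \<in> tpower A m" "m > 0"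
  shows "tmul A m (ptensor A v) u = tlift A m (\<lambda>w. ptensor A (map2 (*) v w)) u"
  unfolding tmul_def using assms by (intro tlift_ptensor[OF mlin_tmul])

lemma tmul_ptensor:
  assumes "v \<in> tuples (carr A) m" "w \<in> tuples (carr A) m" "m > 0"
  shows "tmul A m (ptensor A v) (ptensor A w) = ptensor A (map2 (*) v w)"
  using assms
  by (simp add: tmul_ptensor_left tpower_ptensor tlift_ptensor[OF mlin_mul_ptensor_right])

text \<open>Linearity in the right factor is hidden under the lift over the left one. Once the left
  factor is pure, it is the linearity of a single lift.\<close>

lemma tlin_tmul_right:
  assumes t: "t \<in> tpower A m" and m: "m > 0"
  shows "tlin A m tscale (\<lambda>u. tmul A m t u)"
proof (rule tlinI)
  have *: "tlin A m tscale (\<lambda>u. tmul A m (ptensor A v) u)" if "v \<in> tuples (carr A) m" for v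
    using tlin_tlift[OF mlin_mul_ptensor_right[OF that] m] that m
    by (auto simp: tlin_def tmul_ptensor_left)
  show "tmul A m t (u + u') = tmul A m t u + tmul A m t u'"
    if u: "u \<in> tpower A m" "u' \<in> tpower A m" for u u'
  proof (rule tlin_eqI[OF t])
    show "tlin A m tscale (\<lambda>t. tmul A m t (u + u'))"
      using u m by (intro tlin_tmul_left) auto
    show "tlin A m tscale (\<lambda>t. tmul A m t u + tmul A m t u')"
      using u m by (intro tlin_add_fun tlin_tmul_left vector_space_tscale) auto
  qed (use tlinD(1)[OF * u] in simp)
  show "tmul A m t (tscale c u) = tscale c (tmul A m t u)" if u: "u \<in> tpower A m" for u c
  proof (rule tlin_eqI[OF t])
    show "tlin A m tscale (\<lambda>t. tmul A m t (tscale c u))"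
      using u m by (intro tlin_tmul_left) auto
    show "tlin A m tscale (\<lambda>t. tscale c (tmul A m t u))"
      using u m by (intro tlin_scale_fun tlin_tmul_left vector_space_tscale) auto
  qed (use tlinD(2)[OF * u] in simp)
qed

lemma tmul_closed [intro, simp]:
  assumes "t \<in> tpower A m" "u \<in> tpower A m" "m > 0"
  shows "tmul A m t u \<in> tpower A m"
proof (rule tlin_closed[OF assms(1) tlin_tmul_left[OF assms(2,3)]])
  fix v assume v: "v \<in> tuples (carr A) m"
  show "tmul A m (ptensor A v) u \<in> tpower A m"
    by (rule tlin_closed[OF assms(2) tlin_tmul_right])
       (use v assms(3) in \<open>auto simp: tmul_ptensor intro!: tpower_ptensor\<close>)
qed auto

lemma tmul_assoc:
  assumes t: "t \<in> tpower A m" and u: "u \<in> tpower A m" and w: "w \<in> tpower A m" and m: "m > 0"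
  shows "tmul A m (tmul A m t u) w = tmul A m t (tmul A m u w)"
proof (rule tlin_eqI[OF t])
  show "tlin A m tscale (\<lambda>t. tmul A m (tmul A m t u) w)"
    using u w m by (intro tlin_comp[OF tlin_tmul_left _ tlin_tmul_left]) auto
  show "tlin A m tscale (\<lambda>t. tmul A m t (tmul A m u w))"
    using u w m by (intro tlin_tmul_left) auto
  fix a assume a: "a \<in> tuples (carr A) m"
  note pa = tpower_ptensor[OF a]
  show "tmul A m (tmul A m (ptensor A a) u) w = tmul A m (ptensor A a) (tmul A m u w)"
  proof (rule tlin_eqI[OF u])
    show "tlin A m tscale (\<lambda>u. tmul A m (tmul A m (ptensor A a) u) w)"
      using pa w m by (intro tlin_comp[OF tlin_tmul_right _ tlin_tmul_left]) auto
    show "tlin A m tscale (\<lambda>u. tmul A m (ptensor A a) (tmul A m u w))"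
      using pa w m by (intro tlin_comp[OF tlin_tmul_left _ tlin_tmul_right]) auto
    fix b assume b: "b \<in> tuples (carr A) m"
    note pb = tpower_ptensor[OF b]
    show "tmul A m (tmul A m (ptensor A a) (ptensor A b)) w
        = tmul A m (ptensor A a) (tmul A m (ptensor A b) w)"
    proof (rule tlin_eqI[OF w])
      show "tlin A m tscale (\<lambda>w. tmul A m (tmul A m (ptensor A a) (ptensor A b)) w)"
        using pa pb m by (intro tlin_tmul_right) auto
      show "tlin A m tscale (\<lambda>w. tmul A m (ptensor A a) (tmul A m (ptensor A b) w))"
        using pa pb m by (intro tlin_comp[OF tlin_tmul_right _ tlin_tmul_right]) auto
      fix c assume c: "c \<in> tuples (carr A) m"
      have "map2 (*) (map2 (*) a b) c = map2 (*) a (map2 (*) b c)"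
        using a b c by (intro nth_equalityI) (auto simp: tuples_length mult.assoc)
      then show "tmul A m (tmul A m (ptensor A a) (ptensor A b)) (ptensor A c)
        = tmul A m (ptensor A a) (tmul A m (ptensor A b) (ptensor A c))"
        using a b c m by (simp add: tmul_ptensor)
    qed
  qed
qed

lemma tone_closed [intro, simp]: "tone A m \<in> tpower A m"
  unfolding tone_def by (intro tpower_ptensor tuples_ones)

lemma tmul_one_left [simp]:
  assumes "t \<in> tpower A m" "m > 0"
  shows "tmul A m (tone A m) t = t"
proof (rule tlin_eqI[OF assms(1) tlin_tmul_right[OF tone_closed assms(2)] tlin_id])
  fix v assume v: "v \<in> tuples (carr A) m"
  have "map2 (*) (replicate m 1) v = v"
    using v by (intro nth_equalityI) (auto simp: tuples_length)
  then show "tmul A m (tone A m) (ptensor A v) = ptensor A v"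
    using v assms(2) by (simp add: tone_def tmul_ptensor)
qed

lemma tmul_one_right [simp]:
  assumes "t \<in> tpower A m" "m > 0"
  shows "tmul A m t (tone A m) = t"
proof (rule tlin_eqI[OF assms(1) tlin_tmul_left[OF tone_closed assms(2)] tlin_id])
  fix v assume v: "v \<in> tuples (carr A) m"
  have "map2 (*) v (replicate m 1) = v"
    using v by (intro nth_equalityI) (auto simp: tuples_length)
  then show "tmul A m (ptensor A v) (tone A m) = ptensor A v"
    using v assms(2) by (simp add: tone_def tmul_ptensor)
qed

lemma tinverse_eqI:
  assumes "t \<in> tpower A m" "u \<in> tpower A m" "tmul A m t u = tone A m" "tmul A m u t = tone A m" "m > 0"
  shows "tinverse A m t = u"
  unfolding tinverse_def
proof (rule the_equality)
  fix w assume w: "w \<in> tpower A m \<and> tmul A m t w = tone A m \<and> tmul A m w t = tone A m"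
  have "w = tmul A m w (tmul A m t u)" using assms w by simp
  also have "\<dots> = tmul A m (tmul A m w t) u"
    using assms w by (intro tmul_assoc[symmetric]) auto
  also have "\<dots> = u" using assms w by simp
  finally show "w = u" .
qed (use assms in auto)

lemma tinvertibleD:
  assumes "tinvertible A m t" "m > 0"
  shows "t \<in> tpower A m" "tinverse A m t \<in> tpower A m"
    "tmul A m t (tinverse A m t) = tone A m" "tmul A m (tinverse A m t) t = tone A m"
  using assms tinverse_eqI[of t m] by (auto simp: tinvertible_def)

lemma tinverse_tone: "m > 0 \<Longrightarrow> tinverse A m (tone A m) = tone A m"
  by (rule tinverse_eqI) auto

lemma alg_inverse_eqI:
  assumes "a \<in> carr A" "b \<in> carr A" "a * b = 1" "b * a = 1"
  shows "alg_inverse A a = b"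
  unfolding alg_inverse_def
proof (rule the_equality)
  fix c assume "c \<in> carr A \<and> a * c = 1 \<and> c * a = 1"
  then show "c = b" by (metis assms(3) mult.assoc mult_1_left mult_1_right)
qed (use assms in auto)

lemma mlin_Cons: "mlin A tscale m (\<lambda>v. ptensor A (1 # v))"
  using mlin_append[OF mlin_ptensor, where p = 1 and m = m and r = 0 and ps = "[1]" and rs = "[]"] by (simp add: tuples_def)

lemma mlin_snoc: "mlin A tscale m (\<lambda>v. ptensor A (v @ [1]))"
  using mlin_append[OF mlin_ptensor, where p = 0 and m = m and r = 1 and ps = "[]" and rs = "[1]"] by (simp add: tuples_def)

lemma one_tensor_ptensor:
  "v \<in> tuples (carr A) m \<Longrightarrow> one_tensor A m (ptensor A v) = ptensor A (1 # v)"
  unfolding one_tensor_def by (rule tlift_ptensor[OF mlin_Cons])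

lemma tensor_one_ptensor:
  "v \<in> tuples (carr A) m \<Longrightarrow> tensor_one A m (ptensor A v) = ptensor A (v @ [1])"
  unfolding tensor_one_def by (rule tlift_ptensor[OF mlin_snoc])

lemma tlin_one_tensor: "m > 0 \<Longrightarrow> tlin A m tscale (one_tensor A m)"
  using tlin_tlift[OF mlin_Cons] by (simp add: one_tensor_def[abs_def])

lemma tlin_tensor_one: "m > 0 \<Longrightarrow> tlin A m tscale (tensor_one A m)"
  using tlin_tlift[OF mlin_snoc] by (simp add: tensor_one_def[abs_def])

lemma one_tensor_closed [intro, simp]:
  "t \<in> tpower A m \<Longrightarrow> m > 0 \<Longrightarrow> one_tensor A m t \<in> tpower A (Suc m)"
  by (erule tlin_closed[OF _ tlin_one_tensor])
     (auto simp: one_tensor_ptensor intro!: tpower_ptensor)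

lemma tensor_one_closed [intro, simp]:
  "t \<in> tpower A m \<Longrightarrow> m > 0 \<Longrightarrow> tensor_one A m t \<in> tpower A (Suc m)"
  by (erule tlin_closed[OF _ tlin_tensor_one])
     (auto simp: tensor_one_ptensor tuples_def intro!: tpower_ptensor)

lemma tmul_homI:
  assumes F: "tlin A m tscale F" "\<And>t. t \<in> tpower A m \<Longrightarrow> F t \<in> tpower B m'"
    and B: "k_algebra B" and m: "m > 0" "m' > 0"
    and pure: "\<And>v w. v \<in> tuples (carr A) m \<Longrightarrow> w \<in> tuples (carr A) m \<Longrightarrow>
          F (ptensor A (map2 (*) v w)) = tmul B m' (F (ptensor A v)) (F (ptensor A w))"
    and t: "t \<in> tpower A m" and u: "u \<in> tpower A m"
  shows "F (tmul A m t u) = tmul B m' (F t) (F u)"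
proof -
  interpret B: k_algebra B by fact
  show ?thesis
  proof (rule tlin_eqI[OF t])
    show "tlin A m tscale (\<lambda>t. F (tmul A m t u))"
      using u m by (intro tlin_comp[OF tlin_tmul_left _ F(1)]) auto
    show "tlin A m tscale (\<lambda>t. tmul B m' (F t) (F u))"
      using u m F by (intro tlin_comp[OF F(1) _ B.tlin_tmul_left]) auto
    fix v assume v: "v \<in> tuples (carr A) m"
    show "F (tmul A m (ptensor A v) u) = tmul B m' (F (ptensor A v)) (F u)"
    proof (rule tlin_eqI[OF u])
      show "tlin A m tscale (\<lambda>u. F (tmul A m (ptensor A v) u))"
        using v m by (intro tlin_comp[OF tlin_tmul_right _ F(1)]) (auto simp: tpower_ptensor)
      show "tlin A m tscale (\<lambda>u. tmul B m' (F (ptensor A v)) (F u))"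
        using v m F by (intro tlin_comp[OF F(1) _ B.tlin_tmul_right]) (auto simp: tpower_ptensor)
    qed (use v m pure in \<open>simp add: tmul_ptensor\<close>)
  qed
qed

lemma one_tensor_mult:
  assumes "t \<in> tpower A m" "u \<in> tpower A m" "m > 0"
  shows "one_tensor A m (tmul A m t u) = tmul A (Suc m) (one_tensor A m t) (one_tensor A m u)"
proof (rule tmul_homI[OF tlin_one_tensor _ k_algebra_axioms])
  fix v w assume "v \<in> tuples (carr A) m" "w \<in> tuples (carr A) m"
  then show "one_tensor A m (ptensor A (map2 (*) v w)) =
      tmul A (Suc m) (one_tensor A m (ptensor A v)) (one_tensor A m (ptensor A w))"
    by (simp add: one_tensor_ptensor tmul_ptensor)
qed (use assms in auto)

lemma tensor_one_mult:
  assumes "t \<in> tpower A m" "u \<in> tpower A m" "m > 0"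
  shows "tensor_one A m (tmul A m t u) = tmul A (Suc m) (tensor_one A m t) (tensor_one A m u)"
proof (rule tmul_homI[OF tlin_tensor_one _ k_algebra_axioms])
  fix v w assume *: "v \<in> tuples (carr A) m" "w \<in> tuples (carr A) m"
  then have "v @ [1] \<in> tuples (carr A) (Suc m)" "w @ [1] \<in> tuples (carr A) (Suc m)"
    by (auto simp: tuples_def)
  then show "tensor_one A m (ptensor A (map2 (*) v w)) =
      tmul A (Suc m) (tensor_one A m (ptensor A v)) (tensor_one A m (ptensor A w))"
    using * by (simp add: tensor_one_ptensor tmul_ptensor tuples_length)
qed (use assms in auto)

lemma one_tensor_tone: "one_tensor A m (tone A m) = tone A (Suc m)"
  by (simp add: tone_def one_tensor_ptensor)

lemma tensor_one_tone: "tensor_one A m (tone A m) = tone A (Suc m)"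
  by (simp add: tone_def tensor_one_ptensor replicate_append_same)

end

section \<open>Tensors over a subalgebra\<close>

lemma ptensor_cong_scl: "scl B = scl A \<Longrightarrow> ptensor B = ptensor A"
  unfolding ptensor_def by simp

locale k_subalgebra = A: k_algebra A + B: k_algebra B
  for A :: "('k::field, 'a::ring_1, 'm) alg_scheme" and B :: "('k, 'a, 'n) alg_scheme" +
  assumes scl_eq: "scl B = scl A" and carr_sub: "carr B \<subseteq> carr A"
begin

lemmas ptensor_eq = ptensor_cong_scl[OF scl_eq]

lemma tone_eq: "tone B m = tone A m"
  by (simp add: tone_def ptensor_eq)

lemma tuples_sub: "v \<in> tuples (carr B) m \<Longrightarrow> v \<in> tuples (carr A) m"
  using carr_sub by (auto simp: tuples_def)

lemma mlin_sub: "mlin A sC m \<phi> \<Longrightarrow> mlin B sC m \<phi>"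
  using carr_sub by (fastforce simp: mlin_def tuples_def scl_eq)

lemma tpower_sub: "t \<in> tpower B m \<Longrightarrow> t \<in> tpower A m"
  by (induction t rule: B.tpower_induct) (auto simp: ptensor_eq intro!: A.tpower_ptensor tuples_sub)

text \<open>Both algebras share the ambient type, so a tensor over \<open>B\<close> is literally a
  tensor over \<open>A\<close>, and so is its decomposition. By \<open>tlift_eq\<close> either lift
  may be evaluated on that decomposition.\<close>

lemma tlift_sub:
  assumes "mlin A sC m \<phi>" "t \<in> tpower B m"
  shows "tlift B m \<phi> t = tlift A m \<phi> t"
proof -
  obtain vs where vs: "is_decomposition B m t vs"
    using assms(2) by (auto simp: tpower_def)
  then have "is_decomposition A m t vs"
    using carr_sub by (auto simp: is_decomposition_def ptensor_eq)
  then show ?thesis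
    using B.tlift_eq[OF mlin_sub[OF assms(1)] vs] A.tlift_eq[OF assms(1)] by simp
qed

lemma tmul_sub:
  assumes "t \<in> tpower B m" "u \<in> tpower B m" "m > 0"
  shows "tmul B m t u = tmul A m t u"
proof (rule B.tlin_eqI[OF assms(1) B.tlin_tmul_left[OF assms(2,3)]])
  show "tlin B m tscale (\<lambda>t. tmul A m t u)"
    using A.tlin_tmul_left[OF tpower_sub[OF assms(2)] assms(3)] tpower_sub
    by (auto simp: tlin_def)
  fix v assume v: "v \<in> tuples (carr B) m"
  have "tmul B m (ptensor B v) u = tlift B m (\<lambda>w. ptensor A (map2 (*) v w)) u"
    using B.tmul_ptensor_left[OF v assms(2,3)] by (simp add: ptensor_eq)
  also have "\<dots> = tlift A m (\<lambda>w. ptensor A (map2 (*) v w)) u"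
    by (rule tlift_sub[OF A.mlin_mul_ptensor_right[OF tuples_sub[OF v]] assms(2)])
  also have "\<dots> = tmul A m (ptensor A v) u"
    using A.tmul_ptensor_left[OF tuples_sub[OF v] tpower_sub[OF assms(2)] assms(3)] by simp
  finally show "tmul B m (ptensor B v) u = tmul A m (ptensor B v) u"
    by (simp add: ptensor_eq)
qed

lemma one_tensor_sub: "t \<in> tpower B m \<Longrightarrow> one_tensor B m t = one_tensor A m t"
  using tlift_sub[OF A.mlin_Cons] by (simp add: one_tensor_def ptensor_eq)

lemma tensor_one_sub: "t \<in> tpower B m \<Longrightarrow> tensor_one B m t = tensor_one A m t"
  using tlift_sub[OF A.mlin_snoc] by (simp add: tensor_one_def ptensor_eq)

end

section \<open>Comultiplications\<close>

text \<open>Isolates what \<open>comult_at\<close> requires. \<open>H\<close>, its twist and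
  \<open>A(q)\<close> all satisfy it before the latter two are known to be quasi-Hopf
  algebras.\<close>

locale comult_algebra = k_algebra H
  for H :: "('k::field, 'a::ring_1) qhopf" +
  assumes delta_closed [simp, intro]: "h \<in> carr H \<Longrightarrow> comult H h \<in> tpower H 2"
    and delta_add: "h \<in> carr H \<Longrightarrow> h' \<in> carr H \<Longrightarrow> comult H (h + h') = comult H h + comult H h'"
    and delta_scl: "h \<in> carr H \<Longrightarrow> comult H (scl H c h) = tscale c (comult H h)"
    and delta_mult:
      "h \<in> carr H \<Longrightarrow> h' \<in> carr H \<Longrightarrow> comult H (h * h') = tmul H 2 (comult H h) (comult H h')"
    and delta_one: "comult H 1 = tone H 2"
begin

text \<open>The entry \<open>v ! i\<close> is discarded and the two legs of \<open>t\<close> take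
  its place. So \<open>comult_at\<close> on a pure tensor is an insertion, which is linear in
  \<open>t\<close> for fixed \<open>v\<close>.\<close>

definition insert_at :: "nat \<Rightarrow> 'a list \<Rightarrow> ('k, 'a) tensor \<Rightarrow> ('k, 'a) tensor" where
  "insert_at i v t = tlift H 2 (\<lambda>d. ptensor H (take i v @ d @ drop (Suc i) v)) t"

lemma mlin_insert_at:
  assumes "v \<in> tuples (carr H) m" "i < m"
  shows "mlin H tscale 2 (\<lambda>d. ptensor H (take i v @ d @ drop (Suc i) v))"
  using assms
  by (intro mlin_append[of _ i _ "m - Suc i"] mlin_ptensor tuples_take tuples_drop) auto

lemma tlin_insert_at:
  "v \<in> tuples (carr H) m \<Longrightarrow> i < m \<Longrightarrow> tlin H 2 tscale (insert_at i v)"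
  unfolding insert_at_def[abs_def] using tlin_tlift[OF mlin_insert_at] by auto

lemma insert_at_ptensor:
  "v \<in> tuples (carr H) m \<Longrightarrow> i < m \<Longrightarrow> d \<in> tuples (carr H) 2 \<Longrightarrow>
    insert_at i v (ptensor H d) = ptensor H (take i v @ d @ drop (Suc i) v)"
  unfolding insert_at_def by (rule tlift_ptensor[OF mlin_insert_at])

lemma insert_at_closed:
  "v \<in> tuples (carr H) m \<Longrightarrow> i < m \<Longrightarrow> t \<in> tpower H 2 \<Longrightarrow> insert_at i v t \<in> tpower H (Suc m)"
  by (erule tlin_closed[OF _ tlin_insert_at])
     (auto simp: insert_at_ptensor intro!: tpower_ptensor tuples_insert_at)

lemma insert_at_mult:
  assumes v: "v \<in> tuples (carr H) m" and w: "w \<in> tuples (carr H) m" and i: "i < m"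
    and t: "t \<in> tpower H 2" and u: "u \<in> tpower H 2"
  shows "insert_at i (map2 (*) v w) (tmul H 2 t u) = tmul H (Suc m) (insert_at i v t) (insert_at i w u)"
proof (rule tlin_eqI[OF t])
  note vw = tuples_map2[OF v w]
  show "tlin H 2 tscale (\<lambda>t. insert_at i (map2 (*) v w) (tmul H 2 t u))"
    using u i vw by (intro tlin_comp[OF tlin_tmul_left _ tlin_insert_at]) auto
  show "tlin H 2 tscale (\<lambda>t. tmul H (Suc m) (insert_at i v t) (insert_at i w u))"
    using u i v w insert_at_closed by (intro tlin_comp[OF tlin_insert_at _ tlin_tmul_left]) auto
  fix d assume d: "d \<in> tuples (carr H) 2"
  show "insert_at i (map2 (*) v w) (tmul H 2 (ptensor H d) u)
      = tmul H (Suc m) (insert_at i v (ptensor H d)) (insert_at i w u)"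
  proof (rule tlin_eqI[OF u])
    show "tlin H 2 tscale (\<lambda>u. insert_at i (map2 (*) v w) (tmul H 2 (ptensor H d) u))"
      using d i vw by (intro tlin_comp[OF tlin_tmul_right _ tlin_insert_at]) (auto simp: tpower_ptensor)
    show "tlin H 2 tscale (\<lambda>u. tmul H (Suc m) (insert_at i v (ptensor H d)) (insert_at i w u))"
      using d i v w insert_at_closed
      by (intro tlin_comp[OF tlin_insert_at _ tlin_tmul_right]) (auto simp: tpower_ptensor)
    fix d' assume d': "d' \<in> tuples (carr H) 2"
    have "map2 (*) (take i v @ d @ drop (Suc i) v) (take i w @ d' @ drop (Suc i) w)
        = take i (map2 (*) v w) @ map2 (*) d d' @ drop (Suc i) (map2 (*) v w)"
      using tuples_length[OF v] tuples_length[OF w] tuples_length[OF d] tuples_length[OF d']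
      by (simp add: take_map drop_map take_zip drop_zip)
    then show "insert_at i (map2 (*) v w) (tmul H 2 (ptensor H d) (ptensor H d'))
      = tmul H (Suc m) (insert_at i v (ptensor H d)) (insert_at i w (ptensor H d'))"
      using d d' v w i by (simp add: tmul_ptensor insert_at_ptensor[OF _ i] tuples_insert_at)
  qed
qed

lemma mlin_comult_at:
  assumes i: "i < m"
  shows "mlin H tscale m (\<lambda>v. insert_at i v (comult H (v ! i)))"
proof (rule mlinI[OF vector_space_tscale])
  \<comment> \<open>The variable \<open>mlin_pos\<close> abbreviates both linearity claims for a
    slot different from \<open>i\<close>; instantiating its defining equation by \<open>refl\<close>
    returns them together.\<close>
  have other: "mlin_pos"
    if "mlin_pos = ((\<forall>x\<in>carr H. \<forall>y\<in>carr H. insert_at i (v[j := x + y]) u =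
          insert_at i (v[j := x]) u + insert_at i (v[j := y]) u) \<and>
        (\<forall>c. \<forall>x\<in>carr H. insert_at i (v[j := scl H c x]) u = tscale c (insert_at i (v[j := x]) u)))"
      and v: "v \<in> tuples (carr H) m" and j: "j < m" "j \<noteq> i" and u: "u \<in> tpower H 2"
    for mlin_pos v j u
  proof -
    \<comment> \<open>Replacing slot \<open>i\<close> by two entries moves every later slot one
      place to the right.\<close>
    define j' where "j' = (if j < i then j else Suc j)"
    have len: "length v = m" using v by (rule tuples_length)
    have ins: "insert_at i (v[j := x]) (ptensor H d) = ptensor H ((take i v @ d @ drop (Suc i) v)[j' := x])"
      if "d \<in> tuples (carr H) 2" "x \<in> carr H" for d x
      using that i j len tuples_length[OF that(1)]
      by (subst insert_at_ptensor[OF tuples_update[OF v] i])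
         (auto simp: j'_def list_update_append drop_update_swap take_update_swap list_update_beyond not_less Suc_diff_le
               intro!: arg_cong[of _ _ "ptensor H"])
    have j'm: "j' < Suc m" using j by (auto simp: j'_def)
    have tl: "tlin H 2 tscale (insert_at i (v[j := x]))" if "x \<in> carr H" for x
      using that by (intro tlin_insert_at[OF tuples_update[OF v] i])
    have "insert_at i (v[j := x + y]) u = insert_at i (v[j := x]) u + insert_at i (v[j := y]) u"
      if "x \<in> carr H" "y \<in> carr H" for x y
      by (rule tlin_eqI[OF u tl tlin_add_fun[OF vector_space_tscale tl tl]])
         (use that i v j'm in \<open>auto simp: ins intro!: mlinD(2)[OF mlin_ptensor] tuples_insert_at\<close>)
    moreover have "insert_at i (v[j := scl H c x]) u = tscale c (insert_at i (v[j := x]) u)"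
      if "x \<in> carr H" for c x
      by (rule tlin_eqI[OF u tl tlin_scale_fun[OF vector_space_tscale tl]])
         (use that i v j'm in \<open>auto simp: ins intro!: mlinD(3)[OF mlin_ptensor] tuples_insert_at\<close>)
    ultimately show ?thesis using that(1) by blast
  qed
  have same: "insert_at i (v[i := x]) = insert_at i v" for v x
    by (simp add: insert_at_def fun_eq_iff)
  fix v j assume v: "v \<in> tuples (carr H) m" and j: "j < m"
  have len: "length v = m" using v by (rule tuples_length)
  show "insert_at i (v[j := x + y]) (comult H (v[j := x + y] ! i)) =
      insert_at i (v[j := x]) (comult H (v[j := x] ! i)) + insert_at i (v[j := y]) (comult H (v[j := y] ! i))"
    if "x \<in> carr H" "y \<in> carr H" for x y
    using that i j v len other[OF refl v j, of "comult H (v ! i)"]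
    by (cases "j = i") (auto simp: same delta_add tlinD(1)[OF tlin_insert_at[OF v i]] tuples_nth)
  show "insert_at i (v[j := scl H c x]) (comult H (v[j := scl H c x] ! i)) =
      tscale c (insert_at i (v[j := x]) (comult H (v[j := x] ! i)))"
    if "x \<in> carr H" for c x
    using that i j v len other[OF refl v j, of "comult H (v ! i)"]
    by (cases "j = i") (auto simp: same delta_scl tlinD(2)[OF tlin_insert_at[OF v i]] tuples_nth)
qed

lemma comult_at_eq: "comult_at H i m t = tlift H m (\<lambda>v. insert_at i v (comult H (v ! i))) t"
  by (simp add: comult_at_def insert_at_def)

lemma tlin_comult_at: "i < m \<Longrightarrow> tlin H m tscale (comult_at H i m)"
  using tlin_tlift[OF mlin_comult_at] by (simp add: comult_at_eq[abs_def])

lemma comult_at_ptensor: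
  "v \<in> tuples (carr H) m \<Longrightarrow> i < m \<Longrightarrow>
    comult_at H i m (ptensor H v) = insert_at i v (comult H (v ! i))"
  unfolding comult_at_eq by (rule tlift_ptensor[OF mlin_comult_at])

lemma comult_at_closed [simp, intro]:
  assumes "t \<in> tpower H m" "i < m"
  shows "comult_at H i m t \<in> tpower H (Suc m)"
  by (rule tlin_closed[OF assms(1) tlin_comult_at[OF assms(2)]])
     (use assms(2) in \<open>auto simp: comult_at_ptensor intro!: insert_at_closed tuples_nth\<close>)

lemma comult_at_mult:
  assumes "t \<in> tpower H m" "u \<in> tpower H m" "i < m"
  shows "comult_at H i m (tmul H m t u) = tmul H (Suc m) (comult_at H i m t) (comult_at H i m u)"
proof (rule tmul_homI[OF tlin_comult_at _ k_algebra_axioms])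
  fix v w assume v: "v \<in> tuples (carr H) m" and w: "w \<in> tuples (carr H) m"
  have "map2 (*) v w ! i = v ! i * w ! i"
    using assms(3) v w by (simp add: tuples_length)
  then show "comult_at H i m (ptensor H (map2 (*) v w)) =
      tmul H (Suc m) (comult_at H i m (ptensor H v)) (comult_at H i m (ptensor H w))"
    using v w assms(3)
    by (simp add: comult_at_ptensor delta_mult insert_at_mult[OF v w assms(3)] tuples_nth)
qed (use assms in auto)

lemma comult_at_tone: "i < m \<Longrightarrow> comult_at H i m (tone H m) = tone H (Suc m)"
proof -
  assume i: "i < m"
  have "replicate i 1 @ replicate 2 1 @ replicate (m - Suc i) 1 = replicate (Suc m) (1::'a)"
    using i unfolding replicate_add[symmetric] by simp
  then show ?thesis
    using i by (subst tone_def, subst comult_at_ptensor[of _ m])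
      (auto simp: delta_one tone_def insert_at_ptensor[of _ m])
qed

end

sublocale quasi_hopf_algebra \<subseteq> comult_algebra H
  by unfold_locales (fact comult_closed comult_add comult_scl comult_mult comult_one)+

section \<open>Twisting a Hopf algebra\<close>

text \<open>Tensor operations see only the carrier and the scalar multiplication. Twisting changes
  neither, so all of them agree for \<open>H\<close> and its twist.\<close>

lemma tpower_cong: "carr B = carr A \<Longrightarrow> scl B = scl A \<Longrightarrow> tpower B = tpower A"
  by (simp add: tpower_def is_decomposition_def ptensor_cong_scl[of B A] fun_eq_iff)

lemma tlift_cong: "carr B = carr A \<Longrightarrow> scl B = scl A \<Longrightarrow> tlift B = tlift A"
  by (simp add: tlift_def is_decomposition_def ptensor_cong_scl[of B A] fun_eq_iff)

lemma tmul_cong: "carr B = carr A \<Longrightarrow> scl B = scl A \<Longrightarrow> tmul B = tmul A"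
  by (simp add: tmul_def tlift_cong[of B A] ptensor_cong_scl[of B A] fun_eq_iff)

lemma tone_cong: "scl B = scl A \<Longrightarrow> tone B = tone A"
  by (simp add: tone_def ptensor_cong_scl[of B A] fun_eq_iff)

lemma twisted_simps [simp]:
  "carr (twisted H J) = carr H" "scl (twisted H J) = scl H"
  "comult (twisted H J) = twist_comult H J" "counit (twisted H J) = counit H"
  "assoc (twisted H J) = twist_assoc H J" "antip (twisted H J) = twist_antip H J"
  by (simp_all add: twisted_def)

lemma twisted_tensor_simps [simp]:
  "tpower (twisted H J) = tpower H" "tlift (twisted H J) = tlift H"
  "tmul (twisted H J) = tmul H" "ptensor (twisted H J) = ptensor H"
  "tone (twisted H J) = tone H"
  by (rule tpower_cong tlift_cong tmul_cong ptensor_cong_scl tone_cong; simp)+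

context k_algebra
begin

text \<open>The analogue of \<open>tmul_homI\<close> for targets that are algebras: the counit maps
  take values in the algebra itself, pairs and triples of characters in the field.\<close>

lemma tmul_ring_homI:
  fixes F :: "('k, 'a) tensor \<Rightarrow> 'c::ring_1"
  assumes F: "tlin A m sC F" and sC: "vector_space sC" and m: "m > 0"
    and "\<And>c x y. sC c (x * y) = sC c x * y" "\<And>c x y. sC c (x * y) = x * sC c y"
    and pure: "\<And>v w. v \<in> tuples (carr A) m \<Longrightarrow> w \<in> tuples (carr A) m \<Longrightarrow>
          F (ptensor A (map2 (*) v w)) = F (ptensor A v) * F (ptensor A w)"
    and t: "t \<in> tpower A m" and u: "u \<in> tpower A m"
  shows "F (tmul A m t u) = F t * F u"
proof (rule tlin_eqI[OF t])
  show "tlin A m sC (\<lambda>t. F (tmul A m t u))"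
    using u m by (intro tlin_comp[OF tlin_tmul_left _ F]) auto
  show "tlin A m sC (\<lambda>t. F t * F u)"
    using F assms(4) by (auto simp: tlin_def distrib_right)
  fix v assume v: "v \<in> tuples (carr A) m"
  show "F (tmul A m (ptensor A v) u) = F (ptensor A v) * F u"
  proof (rule tlin_eqI[OF u])
    show "tlin A m sC (\<lambda>u. F (tmul A m (ptensor A v) u))"
      using v m by (intro tlin_comp[OF tlin_tmul_right _ F]) (auto simp: tpower_ptensor)
    show "tlin A m sC (\<lambda>u. F (ptensor A v) * F u)"
      using F assms(5) by (auto simp: tlin_def distrib_left)
  qed (use v m pure in \<open>simp add: tmul_ptensor\<close>)
qed

lemma vector_space_scl: "vector_space (scl A)"
  by unfold_locales

text \<open>Stated for right-nested products, so that its instances are rewrite rules that cancel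
  adjacent inverse factors inside a long product.\<close>

lemma tmul_cancel:
  assumes "tmul A m a b = tone A m" "a \<in> tpower A m" "b \<in> tpower A m" "u \<in> tpower A m" "m > 0"
  shows "tmul A m a (tmul A m b u) = u"
  using assms by (simp add: tmul_assoc[symmetric])

end

context comult_algebra
begin

lemma insert_at_1_ones: "insert_at 1 [1, 1] t = one_tensor H 2 t"
  by (simp add: insert_at_def one_tensor_def)

lemma insert_at_0_ones: "insert_at 0 [1, 1] t = tensor_one H 2 t"
  by (simp add: insert_at_def tensor_one_def)

lemma comult_at_tmul_2:
  assumes "t \<in> tpower H 2" "u \<in> tpower H 2" "i < 2"
  shows "comult_at H i 2 (tmul H 2 t u) = tmul H 3 (comult_at H i 2 t) (comult_at H i 2 u)"
  using comult_at_mult[OF assms] by (simp)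

lemma degree_3_closed [simp, intro]:
  "t \<in> tpower H 2 \<Longrightarrow> i < 2 \<Longrightarrow> comult_at H i 2 t \<in> tpower H 3"
  "t \<in> tpower H 2 \<Longrightarrow> one_tensor H 2 t \<in> tpower H 3"
  "t \<in> tpower H 2 \<Longrightarrow> tensor_one H 2 t \<in> tpower H 3"
  using comult_at_closed[of t 2 i] one_tensor_closed[of t 2] tensor_one_closed[of t 2]
  by (simp_all)

end

text \<open>Kept apart from \<open>hopf_twist\<close> because the invariance argument twists an
  arbitrary quasi-Hopf algebra by an arbitrary invertible tensor.\<close>

locale twist_of = comult_algebra H for H :: "('k::field, 'a::ring_1) qhopf" +
  fixes J :: "('k, 'a) tensor"
  assumes J_invertible: "tinvertible H 2 J"
begin

abbreviation "J' \<equiv> tinverse H 2 J"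

lemma J_closed [simp, intro]: "J \<in> tpower H 2"
  and J'_closed [simp, intro]: "J' \<in> tpower H 2"
  and J_J' [simp]: "tmul H 2 J J' = tone H 2"
  and J'_J [simp]: "tmul H 2 J' J = tone H 2"
  using tinvertibleD[OF J_invertible] by simp_all

lemma one_tensor_J:
  "tmul H 3 (one_tensor H 2 J) (one_tensor H 2 J') = tone H 3"
  "tmul H 3 (one_tensor H 2 J') (one_tensor H 2 J) = tone H 3"
  using one_tensor_mult[of J 2 J'] one_tensor_mult[of J' 2 J] one_tensor_tone[of 2]
  by (simp_all)

lemma tensor_one_J:
  "tmul H 3 (tensor_one H 2 J) (tensor_one H 2 J') = tone H 3"
  "tmul H 3 (tensor_one H 2 J') (tensor_one H 2 J) = tone H 3"
  using tensor_one_mult[of J 2 J'] tensor_one_mult[of J' 2 J] tensor_one_tone[of 2]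
  by (simp_all)

lemma comult_at_J:
  assumes "i < 2"
  shows "tmul H 3 (comult_at H i 2 J) (comult_at H i 2 J') = tone H 3"
    "tmul H 3 (comult_at H i 2 J') (comult_at H i 2 J) = tone H 3"
  using comult_at_tmul_2[of J J' i] comult_at_tmul_2[of J' J i] comult_at_tone[OF assms] assms
  by (simp_all)

lemma tinverse_tensor_one_J: "tinverse H 3 (tensor_one H 2 J) = tensor_one H 2 J'"
  by (rule tinverse_eqI) (auto simp: tensor_one_J)

lemma comult_algebra_twisted: "comult_algebra (twisted H J)"
proof -
  have k: "k_algebra (twisted H J)"
    using k_algebra_axioms by (simp add: k_algebra_def k_algebra_axioms_def)
  have lin: "tlin H 2 tscale (\<lambda>t. tmul H 2 (tmul H 2 J t) J')"
    by (intro tlin_comp[OF tlin_tmul_right _ tlin_tmul_left]) auto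
  have "twist_comult H J (h * h') = tmul H 2 (twist_comult H J h) (twist_comult H J h')"
    if "h \<in> carr H" "h' \<in> carr H" for h h'
    using that by (simp add: twist_comult_def delta_mult tmul_assoc tmul_cancel)
  with k lin show ?thesis
    by (intro comult_algebra.intro comult_algebra_axioms.intro)
       (auto simp: twist_comult_def delta_add delta_scl delta_one tlin_def)
qed

sublocale T: comult_algebra "twisted H J"
  by (rule comult_algebra_twisted)

text \<open>By \<open>insert_at_mult\<close> with unit entries, conjugating an inserted coproduct by
  \<open>J\<close> is the same as conjugating the whole tensor by
  \<open>insert_at i [1, 1] J\<close>. This is \<open>1 \<otimes> J\<close> for \<open>i = 1\<close>
  and \<open>J \<otimes> 1\<close> for \<open>i = 0\<close>.\<close>

lemma comult_at_twisted:
  assumes t: "t \<in> tpower H 2"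
  shows "comult_at (twisted H J) 1 2 t =
      tmul H 3 (tmul H 3 (one_tensor H 2 J) (comult_at H 1 2 t)) (one_tensor H 2 J')" (is ?th1)
    and "comult_at (twisted H J) 0 2 t =
      tmul H 3 (tmul H 3 (tensor_one H 2 J) (comult_at H 0 2 t)) (tensor_one H 2 J')" (is ?th0)
proof -
  have ins: "T.insert_at = insert_at"
    by (simp add: T.insert_at_def insert_at_def fun_eq_iff)
  have *: "comult_at (twisted H J) i 2 t =
      tmul H 3 (tmul H 3 (insert_at i [1, 1] J) (comult_at H i 2 t)) (insert_at i [1, 1] J')"
    if i: "i < 2" for i
  proof (rule tlin_eqI[OF t])
    have c: "insert_at i [1, 1] u \<in> tpower H 3" if "u \<in> tpower H 2" for u
      using insert_at_closed[of "[1, 1]" 2 i u] that i by (simp)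
    have L: "tlin H 2 tscale (comult_at H i 2)"
      using i by (rule tlin_comult_at)
    show "tlin H 2 tscale (comult_at (twisted H J) i 2)"
      using T.tlin_comult_at[OF i] by (simp add: tlin_def)
    show "tlin H 2 tscale (\<lambda>t. tmul H 3 (tmul H 3 (insert_at i [1, 1] J) (comult_at H i 2 t))
        (insert_at i [1, 1] J'))"
      using c i
      by (intro tlin_comp[OF tlin_comp[OF L _ tlin_tmul_right] _ tlin_tmul_left]) auto
    fix v assume v: "v \<in> tuples (carr H) 2"
    then have vi: "v ! i \<in> carr H" using i by (auto intro: tuples_nth)
    have o: "[1, 1] \<in> tuples (carr H) 2" by simp
    have o1: "map2 (*) [1, 1] v = v" and o2: "map2 (*) v [1, 1] = v"
      using v by (auto elim!: tuples_2E)
    have "insert_at i v (tmul H 2 (tmul H 2 J (comult H (v ! i))) J') =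
      tmul H 3 (tmul H 3 (insert_at i [1, 1] J) (insert_at i v (comult H (v ! i)))) (insert_at i [1, 1] J')"
      using insert_at_mult[OF v o i, of "tmul H 2 J (comult H (v ! i))" J']
        insert_at_mult[OF o v i, of J "comult H (v ! i)"] vi
      by (simp add: o1 o2)
    moreover have "comult_at (twisted H J) i 2 (ptensor H v) =
        insert_at i v (tmul H 2 (tmul H 2 J (comult H (v ! i))) J')"
      using T.comult_at_ptensor[OF _ i, of v] v by (simp add: ins twist_comult_def)
    ultimately show "comult_at (twisted H J) i 2 (ptensor H v) =
      tmul H 3 (tmul H 3 (insert_at i [1, 1] J) (comult_at H i 2 (ptensor H v))) (insert_at i [1, 1] J')"
      using v i by (simp add: comult_at_ptensor)
  qed
  show ?th1 using *[of 1] by (simp add: insert_at_1_ones[simplified])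
  show ?th0 using *[of 0] by (simp add: insert_at_0_ones[simplified])
qed

end

section \<open>Antipode and counit maps on the second tensor power\<close>

context quasi_hopf_algebra
begin

text \<open>The middle element \<open>c\<close> is a parameter because a product of tensors then
  becomes a composition in \<open>c\<close>. Antipode axioms and the elements
  \<open>\<alpha>\<^sub>J\<close>, \<open>\<beta>\<^sub>J\<close> are all values of this map and of
  its mirror image.\<close>

definition antip_left :: "'a \<Rightarrow> ('k, 'a) tensor \<Rightarrow> 'a" where
  "antip_left c t = tlift2 H (\<lambda>a b. antip H a * c * b) t"

definition antip_right :: "'a \<Rightarrow> ('k, 'a) tensor \<Rightarrow> 'a" where
  "antip_right c t = tlift2 H (\<lambda>a b. a * c * antip H b) t"

lemma antip_closed [simp, intro]: "h \<in> carr H \<Longrightarrow> antip H h \<in> carr H"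
  using antip_bij by (auto simp: bij_betw_def)

lemma mlin_antip_left: "mlin H (scl H) 2 (\<lambda>v. antip H (v ! 0) * c * (v ! 1))"
  by (rule mlin_2I) (auto simp: vector_space_scl antip_add antip_scl algebra_simps)

lemma mlin_antip_right: "mlin H (scl H) 2 (\<lambda>v. (v ! 0) * c * antip H (v ! 1))"
  by (rule mlin_2I) (auto simp: vector_space_scl antip_add antip_scl algebra_simps)

lemma tlin_antip_left: "tlin H 2 (scl H) (antip_left c)"
  unfolding antip_left_def[abs_def] by (rule tlin_tlift[OF mlin_antip_left]) simp

lemma tlin_antip_right: "tlin H 2 (scl H) (antip_right c)"
  unfolding antip_right_def[abs_def] by (rule tlin_tlift[OF mlin_antip_right]) simp

lemma antip_left_ptensor:
  "a \<in> carr H \<Longrightarrow> b \<in> carr H \<Longrightarrow> antip_left c (ptensor H [a, b]) = antip H a * c * b"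
  unfolding antip_left_def by (subst tlift_ptensor[OF mlin_antip_left]) auto

lemma antip_right_ptensor:
  "a \<in> carr H \<Longrightarrow> b \<in> carr H \<Longrightarrow> antip_right c (ptensor H [a, b]) = a * c * antip H b"
  unfolding antip_right_def by (subst tlift_ptensor[OF mlin_antip_right]) auto

text \<open>The antipode reverses products, so S(a p) c b r = S(p) (S(a) c b) r: the left factor of
  the tensor product ends up innermost. In \<open>antip_right\<close> it is the right
  factor.\<close>

lemma antip_left_mult:
  assumes t: "t \<in> tpower H 2" and u: "u \<in> tpower H 2"
  shows "antip_left c (tmul H 2 t u) = antip_left (antip_left c t) u"
proof (rule tlin_eqI[OF u])
  show "tlin H 2 (scl H) (\<lambda>u. antip_left c (tmul H 2 t u))"
    using t by (intro tlin_comp[OF tlin_tmul_right _ tlin_antip_left]) auto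
  fix w assume w: "w \<in> tuples (carr H) 2"
  then obtain p r where pr: "w = [p, r]" "p \<in> carr H" "r \<in> carr H" by (rule tuples_2E)
  have "antip_left c (tmul H 2 t (ptensor H w)) = antip H p * antip_left c t * r"
  proof (rule tlin_eqI[OF t])
    show "tlin H 2 (scl H) (\<lambda>t. antip_left c (tmul H 2 t (ptensor H w)))"
      using w by (intro tlin_comp[OF tlin_tmul_left _ tlin_antip_left]) (auto simp: tpower_ptensor)
    show "tlin H 2 (scl H) (\<lambda>t. antip H p * antip_left c t * r)"
      using tlin_antip_left[of c] by (auto simp: tlin_def algebra_simps)
  qed (auto elim!: tuples_2E simp: pr tmul_ptensor antip_left_ptensor antip_mult mult.assoc)
  then show "antip_left c (tmul H 2 t (ptensor H w)) = antip_left (antip_left c t) (ptensor H w)"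
    by (simp add: pr antip_left_ptensor)
qed (rule tlin_antip_left)

lemma antip_right_mult:
  assumes t: "t \<in> tpower H 2" and u: "u \<in> tpower H 2"
  shows "antip_right c (tmul H 2 t u) = antip_right (antip_right c u) t"
proof (rule tlin_eqI[OF t])
  show "tlin H 2 (scl H) (\<lambda>t. antip_right c (tmul H 2 t u))"
    using u by (intro tlin_comp[OF tlin_tmul_left _ tlin_antip_right]) auto
  fix w assume w: "w \<in> tuples (carr H) 2"
  then obtain p r where pr: "w = [p, r]" "p \<in> carr H" "r \<in> carr H" by (rule tuples_2E)
  have "antip_right c (tmul H 2 (ptensor H w) u) = p * antip_right c u * antip H r"
  proof (rule tlin_eqI[OF u])
    show "tlin H 2 (scl H) (\<lambda>u. antip_right c (tmul H 2 (ptensor H w) u))"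
      using w by (intro tlin_comp[OF tlin_tmul_right _ tlin_antip_right]) (auto simp: tpower_ptensor)
    show "tlin H 2 (scl H) (\<lambda>u. p * antip_right c u * antip H r)"
      using tlin_antip_right[of c] by (auto simp: tlin_def algebra_simps)
  qed (auto elim!: tuples_2E simp: pr tmul_ptensor antip_right_ptensor antip_mult mult.assoc)
  then show "antip_right c (tmul H 2 (ptensor H w) u) = antip_right (antip_right c u) (ptensor H w)"
    by (simp add: pr antip_right_ptensor)
qed (rule tlin_antip_right)

lemma mlin_counit_left: "mlin H (scl H) 2 (\<lambda>v. scl H (counit H (v ! 0)) (v ! 1))"
  by (rule mlin_2I)
     (auto simp: vector_space_scl counit_add counit_scl scale_left_distrib scale_right_distrib mult.commute)

lemma mlin_counit_right: "mlin H (scl H) 2 (\<lambda>v. scl H (counit H (v ! 1)) (v ! 0))"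
  by (rule mlin_2I)
     (auto simp: vector_space_scl counit_add counit_scl scale_left_distrib scale_right_distrib mult.commute)

lemma counit_left_mult:
  assumes "t \<in> tpower H 2" "u \<in> tpower H 2"
  shows "tlift2 H (\<lambda>a b. scl H (counit H a) b) (tmul H 2 t u) =
    tlift2 H (\<lambda>a b. scl H (counit H a) b) t * tlift2 H (\<lambda>a b. scl H (counit H a) b) u"
  by (rule tmul_ring_homI[OF tlin_tlift[OF mlin_counit_left] vector_space_scl _ _ _ _ assms])
     (auto elim!: tuples_2E simp: tlift_ptensor[OF mlin_counit_left, unfolded One_nat_def] counit_mult mult.commute)

lemma counit_right_mult:
  assumes "t \<in> tpower H 2" "u \<in> tpower H 2"
  shows "tlift2 H (\<lambda>a b. scl H (counit H b) a) (tmul H 2 t u) =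
    tlift2 H (\<lambda>a b. scl H (counit H b) a) t * tlift2 H (\<lambda>a b. scl H (counit H b) a) u"
  by (rule tmul_ring_homI[OF tlin_tlift[OF mlin_counit_right] vector_space_scl _ _ _ _ assms])
     (auto elim!: tuples_2E simp: tlift_ptensor[OF mlin_counit_right, unfolded One_nat_def] counit_mult mult.commute)

lemma counit_left_tone: "tlift2 H (\<lambda>a b. scl H (counit H a) b) (tone H 2) = 1"
  unfolding tone_def by (subst tlift_ptensor[OF mlin_counit_left]) (auto simp: counit_one)

lemma counit_right_tone: "tlift2 H (\<lambda>a b. scl H (counit H b) a) (tone H 2) = 1"
  unfolding tone_def by (subst tlift_ptensor[OF mlin_counit_right]) (auto simp: counit_one)

end

section \<open>The axioms for the twist of a Hopf algebra\<close>

locale hopf_twist = hopf_algebra H for H :: "('k::field, 'a::ring_1) qhopf" +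
  fixes J :: "('k, 'a) tensor"
  assumes twist: "is_twist H J"
    and beta_invertible: "alg_invertible H (twist_beta H J)"

sublocale hopf_twist \<subseteq> twist_of H J
  using twist by unfold_locales (simp add: is_twist_def)

context hopf_twist
begin

abbreviation "\<beta>J \<equiv> twist_beta H J"
abbreviation "\<beta>J' \<equiv> alg_inverse H \<beta>J"

lemma beta_closed [simp, intro]: "\<beta>J \<in> carr H"
  and beta'_closed [simp, intro]: "\<beta>J' \<in> carr H"
  and beta_beta' [simp]: "\<beta>J * \<beta>J' = 1" and beta'_beta [simp]: "\<beta>J' * \<beta>J = 1"
  using beta_invertible alg_inverse_eqI[of \<beta>J] by (auto simp: alg_invertible_def)

lemma twisted_counit:
  assumes h: "h \<in> carr H"
  shows "tlift2 H (\<lambda>a b. scl H (counit H a) b) (twist_comult H J h) = h"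
    and "tlift2 H (\<lambda>a b. scl H (counit H b) a) (twist_comult H J h) = h"
proof -
  let ?L = "\<lambda>t. tlift2 H (\<lambda>a b. scl H (counit H a) b) t"
  let ?R = "\<lambda>t. tlift2 H (\<lambda>a b. scl H (counit H b) a) t"
  have L: "?L J = 1" and R: "?R J = 1" using twist by (auto simp: is_twist_def)
  have "?L J' = 1" "?R J' = 1"
    using counit_left_mult[of J J'] counit_right_mult[of J J'] L R
    by (simp_all add: counit_left_tone[unfolded One_nat_def] counit_right_tone[unfolded One_nat_def])
  then show "?L (twist_comult H J h) = h" "?R (twist_comult H J h) = h"
    using h L R
    by (simp_all add: twist_comult_def counit_left_mult[unfolded One_nat_def]
          counit_right_mult[unfolded One_nat_def] counit_left[unfolded One_nat_def]
          counit_right[unfolded One_nat_def])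
qed

lemma coassoc: "h \<in> carr H \<Longrightarrow> comult_at H 1 2 (comult H h) = comult_at H 0 2 (comult H h)"
  using quasi_coassoc[of h] by (simp add: assoc_trivial tinverse_tone)

lemma twist_assoc_eq:
  "twist_assoc H J = tmul H 3 (tmul H 3 (tmul H 3
     (one_tensor H 2 J) (comult_at H 1 2 J)) (comult_at H 0 2 J')) (tensor_one H 2 J')"
  by (simp add: twist_assoc_def assoc_trivial tinverse_tensor_one_J)

lemma twist_assoc_inverse:
  "twist_assoc H J \<in> tpower H 3"
  "tinverse H 3 (twist_assoc H J) = tmul H 3 (tmul H 3 (tmul H 3
     (tensor_one H 2 J) (comult_at H 0 2 J)) (comult_at H 1 2 J')) (one_tensor H 2 J')"
proof -
  show "twist_assoc H J \<in> tpower H 3" by (simp add: twist_assoc_eq)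
  show "tinverse H 3 (twist_assoc H J) = tmul H 3 (tmul H 3 (tmul H 3
     (tensor_one H 2 J) (comult_at H 0 2 J)) (comult_at H 1 2 J')) (one_tensor H 2 J')"
    by (rule tinverse_eqI)
       (simp_all add: twist_assoc_eq tmul_assoc tmul_cancel[OF tensor_one_J(1)]
          tmul_cancel[OF tensor_one_J(2)] tmul_cancel[OF one_tensor_J(1)]
          tmul_cancel[OF one_tensor_J(2)] tmul_cancel[OF comult_at_J(1)]
          tmul_cancel[OF comult_at_J(2)] one_tensor_J tensor_one_J)
qed

text \<open>After expansion all factors built from \<open>J\<close> meet their inverses between the
  coproducts, and ordinary coassociativity of \<open>H\<close> remains.\<close>

lemma twisted_quasi_coassoc:
  assumes h: "h \<in> carr H"
  shows "comult_at (twisted H J) 1 2 (twist_comult H J h) =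
    tmul H 3 (tmul H 3 (twist_assoc H J) (comult_at (twisted H J) 0 2 (twist_comult H J h)))
      (tinverse H 3 (twist_assoc H J))"
  unfolding twist_assoc_inverse(2) using h
  by (simp add: twist_assoc_eq comult_at_twisted[unfolded One_nat_def] twist_comult_def
          comult_at_tmul_2 coassoc[unfolded One_nat_def] tmul_assoc tmul_cancel[OF tensor_one_J(1)]
          tmul_cancel[OF tensor_one_J(2)] tmul_cancel[OF one_tensor_J(1)]
          tmul_cancel[OF one_tensor_J(2)] tmul_cancel[OF comult_at_J(1)]
          tmul_cancel[OF comult_at_J(2)])

lemma twist_beta_eq: "\<beta>J = antip_right 1 J"
  by (simp add: twist_beta_def antip_right_def bet_trivial)

lemma twist_alpha_eq: "twist_alpha H J = antip_left 1 J'"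
  by (simp add: twist_alpha_def antip_left_def alph_trivial)

lemma antip_left_scl: "t \<in> tpower H 2 \<Longrightarrow> antip_left (scl H c 1) t = scl H c (antip_left 1 t)"
proof (rule tlin_eqI[OF _ tlin_antip_left])
  show "tlin H 2 (scl H) (\<lambda>t. scl H c (antip_left 1 t))"
    by (rule tlin_scale_fun[OF vector_space_scl tlin_antip_left])
qed (auto elim!: tuples_2E simp: antip_left_ptensor)

lemma antip_right_scl: "t \<in> tpower H 2 \<Longrightarrow> antip_right (scl H c 1) t = scl H c (antip_right 1 t)"
proof (rule tlin_eqI[OF _ tlin_antip_right])
  show "tlin H 2 (scl H) (\<lambda>t. scl H c (antip_right 1 t))"
    by (rule tlin_scale_fun[OF vector_space_scl tlin_antip_right])
qed (auto elim!: tuples_2E simp: antip_right_ptensor)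

text \<open>Conjugation by \<open>\<beta>\<^sub>J\<close> in the twisted antipode only contributes a
  factor \<open>\<beta>\<^sub>J\<close> on the left. As \<open>\<alpha>\<^sub>J\<close> is
  \<open>antip_left 1\<close> at the inverse of \<open>J\<close>, it is absorbed into the argument,
  where it cancels the left \<open>J\<close> of the twisted coproduct. The antipode axiom of
  \<open>H\<close> then applies and the right inverse of \<open>J\<close> gives
  \<open>\<alpha>\<^sub>J\<close> back.\<close>

lemma twisted_antip_alph:
  assumes h: "h \<in> carr H"
  shows "tlift2 H (\<lambda>a b. twist_antip H J a * (\<beta>J * twist_alpha H J) * b) (twist_comult H J h) =
    scl H (counit H h) (\<beta>J * twist_alpha H J)"
proof -
  let ?\<alpha> = "twist_alpha H J"
  have lin: "tlin H 2 (scl H) (\<lambda>t. \<beta>J * antip_left ?\<alpha> t)"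
    using tlin_antip_left[of ?\<alpha>] by (auto simp: tlin_def algebra_simps)
  have ml: "mlin H (scl H) 2 (\<lambda>v. \<beta>J * (antip H (v ! 0) * ?\<alpha> * (v ! 1)))"
    by (rule mlin_2I) (auto simp: vector_space_scl antip_add antip_scl algebra_simps)
  have c: "twist_comult H J h \<in> tpower H 2"
    using T.delta_closed[of h] h by simp
  have "twist_antip H J a * (\<beta>J * ?\<alpha>) * b = \<beta>J * (antip H a * ?\<alpha> * b)" for a b
    unfolding twist_antip_def by (metis beta'_beta mult.assoc mult_1_left)
  then have "tlift2 H (\<lambda>a b. twist_antip H J a * (\<beta>J * ?\<alpha>) * b) (twist_comult H J h)
      = tlift2 H (\<lambda>a b. \<beta>J * (antip H a * ?\<alpha> * b)) (twist_comult H J h)"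
    by simp
  also have "\<dots> = \<beta>J * antip_left ?\<alpha> (twist_comult H J h)"
    by (rule tlin_eqI[OF c tlin_tlift[OF ml] lin])
       (auto elim!: tuples_2E simp: tlift_ptensor[OF ml, unfolded One_nat_def] antip_left_ptensor)
  also have "antip_left ?\<alpha> (twist_comult H J h) =
      antip_left 1 (tmul H 2 J' (twist_comult H J h))"
    using c by (simp add: antip_left_mult twist_alpha_eq)
  also have "tmul H 2 J' (twist_comult H J h) = tmul H 2 (comult H h) J'"
    using h by (simp add: twist_comult_def tmul_assoc tmul_cancel)
  also have "antip_left 1 \<dots> = antip_left (antip_left 1 (comult H h)) J'"
    using h by (simp add: antip_left_mult)
  also have "antip_left 1 (comult H h) = scl H (counit H h) 1"
    using antip_alph[OF h] by (simp add: antip_left_def alph_trivial)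
  also have "antip_left \<dots> J' = scl H (counit H h) ?\<alpha>"
    by (simp add: antip_left_scl twist_alpha_eq)
  finally show ?thesis by simp
qed

text \<open>Mirror image of the previous argument: \<open>\<beta>\<^sub>J\<close> is
  \<open>antip_right 1\<close> at \<open>J\<close> and cancels the right factor of the twisted
  coproduct.\<close>

lemma twisted_antip_bet:
  assumes h: "h \<in> carr H"
  shows "tlift2 H (\<lambda>a b. a * 1 * twist_antip H J b) (twist_comult H J h) = scl H (counit H h) 1"
proof -
  have lin: "tlin H 2 (scl H) (\<lambda>t. antip_right \<beta>J t * \<beta>J')"
    using tlin_antip_right[of \<beta>J] by (auto simp: tlin_def algebra_simps)
  have ml: "mlin H (scl H) 2 (\<lambda>v. ((v ! 0) * \<beta>J * antip H (v ! 1)) * \<beta>J')"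
    by (rule mlin_2I) (auto simp: vector_space_scl antip_add antip_scl algebra_simps)
  have c: "twist_comult H J h \<in> tpower H 2"
    using T.delta_closed[of h] h by simp
  have "tlift2 H (\<lambda>a b. a * 1 * twist_antip H J b) (twist_comult H J h)
      = tlift2 H (\<lambda>a b. (a * \<beta>J * antip H b) * \<beta>J') (twist_comult H J h)"
    by (simp add: twist_antip_def mult.assoc)
  also have "\<dots> = antip_right \<beta>J (twist_comult H J h) * \<beta>J'"
    by (rule tlin_eqI[OF c tlin_tlift[OF ml] lin])
       (auto elim!: tuples_2E simp: tlift_ptensor[OF ml, unfolded One_nat_def] antip_right_ptensor)
  also have "antip_right \<beta>J (twist_comult H J h) =
      antip_right 1 (tmul H 2 (twist_comult H J h) J)"
    using c by (simp add: antip_right_mult twist_beta_eq)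
  also have "tmul H 2 (twist_comult H J h) J = tmul H 2 J (comult H h)"
    using h by (simp add: twist_comult_def tmul_assoc)
  also have "antip_right 1 \<dots> = antip_right (antip_right 1 (comult H h)) J"
    using h by (simp add: antip_right_mult)
  also have "antip_right 1 (comult H h) = scl H (counit H h) 1"
    using antip_bet[OF h] by (simp add: antip_right_def bet_trivial)
  also have "antip_right \<dots> J = scl H (counit H h) \<beta>J"
    by (simp add: antip_right_scl twist_beta_eq)
  finally show ?thesis by simp
qed

lemma twist_antip_closed [simp, intro]: "h \<in> carr H \<Longrightarrow> twist_antip H J h \<in> carr H"
  by (simp add: twist_antip_def)

lemma twist_antip_simps:
  "h \<in> carr H \<Longrightarrow> h' \<in> carr H \<Longrightarrow> twist_antip H J (h + h') = twist_antip H J h + twist_antip H J h'"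
  "h \<in> carr H \<Longrightarrow> twist_antip H J (scl H c h) = scl H c (twist_antip H J h)"
  "h \<in> carr H \<Longrightarrow> h' \<in> carr H \<Longrightarrow> twist_antip H J (h * h') = twist_antip H J h' * twist_antip H J h"
  "twist_antip H J 1 = 1"
proof -
  have c: "\<beta>J' * (\<beta>J * a) = a" for a
    by (simp add: mult.assoc[symmetric])
  show "h \<in> carr H \<Longrightarrow> h' \<in> carr H \<Longrightarrow> twist_antip H J (h + h') = twist_antip H J h + twist_antip H J h'"
    "h \<in> carr H \<Longrightarrow> twist_antip H J (scl H c h) = scl H c (twist_antip H J h)"
    "h \<in> carr H \<Longrightarrow> h' \<in> carr H \<Longrightarrow> twist_antip H J (h * h') = twist_antip H J h' * twist_antip H J h"
    "twist_antip H J 1 = 1"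
    by (simp_all add: twist_antip_def antip_add antip_scl antip_mult antip_one algebra_simps c)
qed

lemma inj_on_twist_antip: "inj_on (twist_antip H J) (carr H)"
proof (rule inj_onI)
  fix h h' assume *: "h \<in> carr H" "h' \<in> carr H" "twist_antip H J h = twist_antip H J h'"
  have "\<beta>J' * twist_antip H J u * \<beta>J = antip H u" for u
    unfolding twist_antip_def by (metis beta'_beta mult.assoc mult_1_left mult_1_right)
  then have "antip H h = antip H h'" using *(3) by metis
  then show "h = h'" using antip_bij * by (auto simp: bij_betw_def inj_on_def)
qed

end

section \<open>Diagonal tensors with respect to a system of orthogonal idempotents\<close>

lemma sum_tuples_snoc:
  "(\<Sum>zs\<in>tuples Z (Suc m). f zs) = (\<Sum>zs\<in>tuples Z m. \<Sum>z\<in>Z. f (zs @ [z]))"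
proof -
  have "(\<Sum>zs\<in>tuples Z m. \<Sum>z\<in>Z. f (zs @ [z])) = (\<Sum>(zs, z)\<in>tuples Z m \<times> Z. f (zs @ [z]))"
    by (rule sum.cartesian_product)
  also have "\<dots> = (\<Sum>zs\<in>tuples Z (Suc m). f zs)"
    by (rule sum.reindex_bij_witness[where i = "\<lambda>zs. (butlast zs, last zs)"
          and j = "\<lambda>(zs, z). zs @ [z]"])
       (auto simp: tuples_def length_Suc_conv_rev)
  finally show ?thesis ..
qed

lemma tuples_map: "zs \<in> tuples Z m \<Longrightarrow> (\<And>z. z \<in> Z \<Longrightarrow> f z \<in> C) \<Longrightarrow> map f zs \<in> tuples C m"
  by (auto simp: tuples_def)

text \<open>Coefficients are functions on index lists. For these tensors multiplication is
  pointwise, while tensoring with 1 and applying the coproduct only substitute in the index list, so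
  identities between them become identities of functions.\<close>

definition diag ::
    "('k::field, 'a::ring_1, 'm) alg_scheme \<Rightarrow> (nat \<Rightarrow> 'a) \<Rightarrow> nat \<Rightarrow> nat \<Rightarrow> (nat list \<Rightarrow> 'k)
      \<Rightarrow> ('k, 'a) tensor" where
  "diag A e N m \<phi> = (\<Sum>zs\<in>tuples {..<N} m. tscale (\<phi> zs) (ptensor A (map e zs)))"

lemma diag_cong:
  "(\<And>zs. zs \<in> tuples {..<N} m \<Longrightarrow> \<phi> zs = \<psi> zs) \<Longrightarrow> diag A e N m \<phi> = diag A e N m \<psi>"
  by (simp add: diag_def)

locale idem_system = k_algebra A
  for A :: "('k::field, 'a::ring_1, 'm) alg_scheme" +
  fixes e :: "nat \<Rightarrow> 'a" and N :: nat
  assumes N_pos: "N > 0"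
    and e_closed [simp, intro]: "e z \<in> carr A"
    and e_mult: "z < N \<Longrightarrow> w < N \<Longrightarrow> e z * e w = (if z = w then e z else 0)"
    and e_sum: "(\<Sum>z<N. e z) = 1"
begin

abbreviation "dt \<equiv> diag A e N"

definition de :: "(nat \<Rightarrow> 'k) \<Rightarrow> 'a" where
  "de \<phi> = (\<Sum>z<N. scl A (\<phi> z) (e z))"

lemma de_closed [simp, intro]: "de \<phi> \<in> carr A"
  unfolding de_def by (intro carr_sum) auto

lemma de_cong: "(\<And>z. z < N \<Longrightarrow> \<phi> z = \<psi> z) \<Longrightarrow> de \<phi> = de \<psi>"
  by (simp add: de_def)

lemma e_tuples: "zs \<in> tuples {..<N} m \<Longrightarrow> map e zs \<in> tuples (carr A) m"
  by (rule tuples_map) auto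

lemma e_de:
  assumes "w < N"
  shows "e w * de \<phi> = scl A (\<phi> w) (e w)" "de \<phi> * e w = scl A (\<phi> w) (e w)"
proof -
  have "e w * de \<phi> = (\<Sum>z<N. if z = w then scl A (\<phi> w) (e w) else 0)"
    unfolding de_def sum_distrib_left using assms by (intro sum.cong) (auto simp: e_mult)
  then show "e w * de \<phi> = scl A (\<phi> w) (e w)" using assms by simp
  have "de \<phi> * e w = (\<Sum>z<N. if z = w then scl A (\<phi> w) (e w) else 0)"
    unfolding de_def sum_distrib_right using assms by (intro sum.cong) (auto simp: e_mult)
  then show "de \<phi> * e w = scl A (\<phi> w) (e w)" using assms by simp
qed

lemma de_mult: "de \<phi> * de \<psi> = de (\<lambda>z. \<phi> z * \<psi> z)"
proof -
  have "de \<phi> * de \<psi> = (\<Sum>z<N. scl A (\<phi> z) (e z * de \<psi>))"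
    by (simp add: de_def[of \<phi>] sum_distrib_right)
  also have "\<dots> = de (\<lambda>z. \<phi> z * \<psi> z)"
    by (simp add: e_de de_def[of "\<lambda>z. \<phi> z * \<psi> z"])
  finally show ?thesis .
qed

lemma de_one: "de (\<lambda>_. 1) = 1"
  by (simp add: de_def e_sum)

lemma dt_closed [simp, intro]: "m > 0 \<Longrightarrow> dt m \<phi> \<in> tpower A m"
  unfolding diag_def by (intro tpower_sum tpower_tscale tpower_ptensor e_tuples)

lemma tlin_dt:
  assumes "tlin A m sC F" "m > 0"
  shows "F (dt m \<phi>) = (\<Sum>zs\<in>tuples {..<N} m. sC (\<phi> zs) (F (ptensor A (map e zs))))"
  unfolding diag_def
  by (subst tlin_sum[OF assms(1)])
     (use assms(2) in \<open>auto intro!: tpower_tscale tpower_ptensor e_tuples sum.cong tlinD(2)[OF assms(1)]\<close>)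

lemma tlift_dt:
  assumes "mlin A sC m \<psi>" "m > 0"
  shows "tlift A m \<psi> (dt m \<phi>) = (\<Sum>zs\<in>tuples {..<N} m. sC (\<phi> zs) (\<psi> (map e zs)))"
  using tlin_dt[OF tlin_tlift[OF assms] assms(2)] by (simp add: tlift_ptensor[OF assms(1) e_tuples])

lemma dt_mult: "m > 0 \<Longrightarrow> tmul A m (dt m \<phi>) (dt m \<psi>) = dt m (\<lambda>zs. \<phi> zs * \<psi> zs)"
proof -
  assume m: "m > 0"
  have pure: "ptensor A (map2 (*) (map e zs) (map e ws)) = (if zs = ws then ptensor A (map e zs) else 0)"
    if zs: "zs \<in> tuples {..<N} m" and ws: "ws \<in> tuples {..<N} m" for zs ws
  proof (cases "zs = ws")
    case True
    then have "map2 (*) (map e zs) (map e ws) = map e zs"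
      using zs by (intro nth_equalityI) (auto simp: tuples_iff_nth e_mult)
    then show ?thesis using True by simp
  next
    case False
    \<comment> \<open>Different lists differ in some slot, where the product of idempotents is 0; a
      pure tensor with a zero entry vanishes.\<close>
    then obtain i where i: "i < m" "zs ! i \<noteq> ws ! i"
      using zs ws by (auto simp: tuples_def list_eq_iff_nth_eq)
    let ?v = "map2 (*) (map e zs) (map e ws)"
    have v: "?v \<in> tuples (carr A) m" using zs ws by (intro tuples_map2 e_tuples)
    have vi: "?v ! i = 0"
      using i zs ws by (auto simp: tuples_iff_nth e_mult)
    have "ptensor A (?v[i := 0]) = 0"
      using mlinD(3)[OF mlin_ptensor v i(1), of 0 0] by simp
    moreover have "?v[i := 0] = ?v" using list_update_id[of ?v i] unfolding vi .
    ultimately show ?thesis using False by simp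
  qed
  have "tmul A m (dt m \<phi>) (dt m \<psi>) =
      (\<Sum>zs\<in>tuples {..<N} m. tscale (\<phi> zs) (tmul A m (ptensor A (map e zs)) (dt m \<psi>)))"
    using m by (intro tlin_dt[OF tlin_tmul_left]) auto
  also have "\<dots> = (\<Sum>zs\<in>tuples {..<N} m. tscale (\<phi> zs) (\<Sum>ws\<in>tuples {..<N} m. tscale (\<psi> ws)
      (tmul A m (ptensor A (map e zs)) (ptensor A (map e ws)))))"
    using m by (intro sum.cong refl arg_cong2[of _ _ _ _ tscale] tlin_dt[OF tlin_tmul_right])
      (auto intro!: tpower_ptensor e_tuples)
  also have "\<dots> = (\<Sum>zs\<in>tuples {..<N} m. tscale (\<phi> zs) (\<Sum>ws\<in>tuples {..<N} m.
      if zs = ws then tscale (\<psi> zs) (ptensor A (map e zs)) else 0))"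
    using m by (intro sum.cong refl arg_cong2[of _ _ _ _ tscale])
      (auto simp: tmul_ptensor e_tuples pure)
  also have "\<dots> = dt m (\<lambda>zs. \<phi> zs * \<psi> zs)"
    unfolding diag_def by (intro sum.cong refl) (simp add: finite_tuples)
  finally show ?thesis .
qed

lemma ptensor_de:
  "ptensor A (map de \<phi>s) = dt (length \<phi>s) (\<lambda>zs. \<Prod>i<length \<phi>s. (\<phi>s ! i) (zs ! i))"
  using mlin_expand[OF mlin_ptensor[of "length \<phi>s"], where Z = "{..<N}" and u = e and us = "[]"
      and cs = \<phi>s]
  by (simp add: diag_def de_def[abs_def])

lemma dt_one: "tone A m = dt m (\<lambda>_. 1)"
  using ptensor_de[of "replicate m (\<lambda>_. 1)"] by (simp add: tone_def de_one)

lemma dt_sum: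
  assumes "finite I"
  shows "(\<Sum>i\<in>I. tscale (c i) (dt m (\<phi> i))) = dt m (\<lambda>zs. \<Sum>i\<in>I. c i * \<phi> i zs)"
proof -
  have "(\<Sum>i\<in>I. tscale (c i) (dt m (\<phi> i))) =
      (\<Sum>i\<in>I. \<Sum>zs\<in>tuples {..<N} m. tscale (c i * \<phi> i zs) (ptensor A (map e zs)))"
    by (simp add: diag_def tvs.scale_sum_right)
  also have "\<dots> = dt m (\<lambda>zs. \<Sum>i\<in>I. c i * \<phi> i zs)"
    unfolding diag_def by (subst sum.swap) (simp add: tvs.scale_sum_left)
  finally show ?thesis .
qed

lemma dt_unit:
  assumes "m > 0" "\<And>zs. zs \<in> tuples {..<N} m \<Longrightarrow> \<phi> zs \<noteq> 0"
  shows "tmul A m (dt m \<phi>) (dt m (\<lambda>zs. inverse (\<phi> zs))) = tone A m"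
    and "tmul A m (dt m (\<lambda>zs. inverse (\<phi> zs))) (dt m \<phi>) = tone A m"
  using assms by (auto simp: dt_mult dt_one intro!: diag_cong)

lemma one_tensor_dt: "m > 0 \<Longrightarrow> one_tensor A m (dt m \<phi>) = dt (Suc m) (\<lambda>zs. \<phi> (tl zs))"
proof -
  assume m: "m > 0"
  have 1: "ptensor A (1 # map e zs) = (\<Sum>z<N. ptensor A (map e (z # zs)))"
    if "zs \<in> tuples {..<N} m" for zs
    using mlin_sum[OF mlin_ptensor[of "Suc m"], where us = "[]" and ws = "map e zs" and Z = "{..<N}"
        and u = e and c = "\<lambda>_. 1"] that e_tuples[OF that] by (simp add: tuples_def e_sum)
  have "one_tensor A m (dt m \<phi>) =
     (\<Sum>zs\<in>tuples {..<N} m. tscale (\<phi> zs) (one_tensor A m (ptensor A (map e zs))))"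
    by (rule tlin_dt[OF tlin_one_tensor[OF m] m])
  also have "\<dots> = (\<Sum>zs\<in>tuples {..<N} m. \<Sum>z<N. tscale (\<phi> zs) (ptensor A (map e (z # zs))))"
    by (simp add: one_tensor_ptensor e_tuples 1 tvs.scale_sum_right del: list.map)
  also have "\<dots> = dt (Suc m) (\<lambda>zs. \<phi> (tl zs))"
    by (subst sum.swap) (simp add: diag_def sum_tuples_Suc)
  finally show ?thesis .
qed

lemma tensor_one_dt: "m > 0 \<Longrightarrow> tensor_one A m (dt m \<phi>) = dt (Suc m) (\<lambda>zs. \<phi> (butlast zs))"
proof -
  assume m: "m > 0"
  have 1: "ptensor A (map e zs @ [1]) = (\<Sum>z<N. ptensor A (map e (zs @ [z])))"
    if "zs \<in> tuples {..<N} m" for zs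
    using mlin_sum[OF mlin_ptensor[of "Suc m"], where us = "map e zs" and ws = "[]" and Z = "{..<N}"
        and u = e and c = "\<lambda>_. 1"] that e_tuples[OF that] by (simp add: tuples_def e_sum)
  have "tensor_one A m (dt m \<phi>) =
     (\<Sum>zs\<in>tuples {..<N} m. tscale (\<phi> zs) (tensor_one A m (ptensor A (map e zs))))"
    by (rule tlin_dt[OF tlin_tensor_one[OF m] m])
  also have "\<dots> = (\<Sum>zs\<in>tuples {..<N} m. \<Sum>z<N. tscale (\<phi> zs) (ptensor A (map e (zs @ [z]))))"
    by (simp add: tensor_one_ptensor e_tuples 1 tvs.scale_sum_right del: map_append)
  also have "\<dots> = dt (Suc m) (\<lambda>zs. \<phi> (butlast zs))"
    by (simp add: diag_def sum_tuples_snoc)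
  finally show ?thesis .
qed

end

text \<open>The coproduct dual to addition in Z/N: \<open>e z\<close> behaves like the indicator
  function of z on that group.\<close>

locale comult_idem = comult_algebra H + idem_system H e N
  for H :: "('k::field, 'a::ring_1) qhopf" and e N +
  assumes delta_e: "z < N \<Longrightarrow> comult H (e z) =
    (\<Sum>y<N. \<Sum>w<N. if (y + w) mod N = z then ptensor H [e y, e w] else 0)"
begin

text \<open>The coproduct splits the index in slot \<open>i\<close> into all pairs with that sum. A
  longer list determines the shorter one by adding its neighbours \<open>i\<close> and
  \<open>Suc i\<close> modulo N, which is the substitution in the coefficient.\<close>

lemma comult_at_dt:
  assumes i: "i < m"
  shows "comult_at H i m (dt m \<phi>) =
    dt (Suc m) (\<lambda>ws. \<phi> (take i ws @ ((ws ! i + ws ! Suc i) mod N) # drop (Suc (Suc i)) ws))"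
proof -
  let ?Z = "{..<N}"
  let ?ins = "\<lambda>zs y w. take i zs @ [y, w] @ drop (Suc i) zs"
  let ?mrg = "\<lambda>ws. take i ws @ ((ws ! i + ws ! Suc i) mod N) # drop (Suc (Suc i)) ws"
  have m: "m > 0" using i by simp
  have pure: "comult_at H i m (ptensor H (map e zs)) =
      (\<Sum>y<N. \<Sum>w<N. if (y + w) mod N = zs ! i then ptensor H (map e (?ins zs y w)) else 0)"
    if zs: "zs \<in> tuples ?Z m" for zs
  proof -
    have lin: "tlin H 2 tscale (insert_at i (map e zs))"
      by (rule tlin_insert_at[OF e_tuples[OF zs] i])
    have "comult_at H i m (ptensor H (map e zs)) = insert_at i (map e zs) (comult H (e (zs ! i)))"
      using zs i by (simp add: comult_at_ptensor e_tuples tuples_length)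
    also have "\<dots> = insert_at i (map e zs)
        (\<Sum>y<N. \<Sum>w<N. if (y + w) mod N = zs ! i then ptensor H [e y, e w] else 0)"
      using tuples_nth[OF zs i] by (simp add: delta_e)
    also have "\<dots> = (\<Sum>y<N. \<Sum>w<N. insert_at i (map e zs)
        (if (y + w) mod N = zs ! i then ptensor H [e y, e w] else 0))"
      by (subst tlin_sum[OF lin], force intro!: tpower_sum tpower_ptensor,
          intro sum.cong refl, subst tlin_sum[OF lin]) (force intro!: tpower_ptensor)+
    also have "\<dots> = (\<Sum>y<N. \<Sum>w<N. if (y + w) mod N = zs ! i then ptensor H (map e (?ins zs y w)) else 0)"
      using zs by (intro sum.cong refl)
        (auto simp: insert_at_ptensor[OF e_tuples[OF zs] i] tlin_0[OF lin] take_map drop_map)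
    finally show ?thesis .
  qed
  have "comult_at H i m (dt m \<phi>) =
      (\<Sum>zs\<in>tuples ?Z m. tscale (\<phi> zs) (comult_at H i m (ptensor H (map e zs))))"
    by (rule tlin_dt[OF tlin_comult_at[OF i] m])
  also have "\<dots> = (\<Sum>zs\<in>tuples ?Z m. \<Sum>(y, w)\<in>?Z \<times> ?Z. if (y + w) mod N = zs ! i
      then tscale (\<phi> zs) (ptensor H (map e (?ins zs y w))) else 0)"
    by (simp add: pure tvs.scale_sum_right sum.cartesian_product)
       (auto intro!: sum.cong)
  also have "\<dots> = (\<Sum>(zs, y, w)\<in>tuples ?Z m \<times> (?Z \<times> ?Z). if (y + w) mod N = zs ! i
      then tscale (\<phi> zs) (ptensor H (map e (?ins zs y w))) else 0)"
    by (subst sum.cartesian_product) (auto intro!: sum.cong)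
  also have "\<dots> = (\<Sum>(zs, y, w)\<in>{(zs, y, w). zs \<in> tuples ?Z m \<and> y \<in> ?Z \<and> w \<in> ?Z \<and> (y + w) mod N = zs ! i}.
      tscale (\<phi> zs) (ptensor H (map e (?ins zs y w))))"
    by (intro sum.mono_neutral_cong_right) (auto simp: finite_tuples)
  also have "\<dots> = (\<Sum>ws\<in>tuples ?Z (Suc m). tscale (\<phi> (?mrg ws)) (ptensor H (map e ws)))"
  proof (rule sum.reindex_bij_witness[where i = "\<lambda>ws. (?mrg ws, ws ! i, ws ! Suc i)"
        and j = "\<lambda>(zs, y, w). ?ins zs y w"], goal_cases)
    case (1 p)
    then obtain zs y w where p: "p = (zs, y, w)" and zs: "zs \<in> tuples ?Z m"
      and yw: "y < N" "w < N" "(y + w) mod N = zs ! i" by auto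
    have "take i zs @ zs ! i # drop (Suc i) zs = zs"
      using i zs by (simp add: tuples_length id_take_nth_drop[symmetric])
    then show ?case using zs yw i by (simp add: p nth_append tuples_length)
  next
    case (2 p)
    then obtain zs y w where p: "p = (zs, y, w)" and zs: "zs \<in> tuples ?Z m"
      and yw: "y < N" "w < N" "(y + w) mod N = zs ! i" by auto
    have "set (take i zs) \<subseteq> ?Z" "set (drop (Suc i) zs) \<subseteq> ?Z"
      using zs by (auto simp: tuples_def dest: in_set_takeD in_set_dropD)
    then show ?case using zs yw i by (auto simp: p tuples_def)
  next
    case (3 ws)
    then have len: "length ws = Suc m" by (rule tuples_length)
    have "ws = take i ws @ ws ! i # drop (Suc i) ws"
      using i len by (intro id_take_nth_drop) simp
    also have "drop (Suc i) ws = ws ! Suc i # drop (Suc (Suc i)) ws"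
      using i len by (intro Cons_nth_drop_Suc[symmetric]) simp
    finally show ?case using i len by simp
  next
    case (4 ws)
    then have len: "length ws = Suc m" and "set ws \<subseteq> ?Z" by (auto simp: tuples_def)
    then show ?case
      using i N_pos by (auto simp: tuples_def nth_append dest: in_set_takeD in_set_dropD
          intro!: nth_mem[THEN subsetD[OF \<open>set ws \<subseteq> ?Z\<close>], simplified])
  next
    case (5 p)
    then obtain zs y w where p: "p = (zs, y, w)" and zs: "zs \<in> tuples ?Z m"
      and yw: "y < N" "w < N" "(y + w) mod N = zs ! i" by auto
    have "take i zs @ zs ! i # drop (Suc i) zs = zs"
      using i zs by (simp add: tuples_length id_take_nth_drop[symmetric])
    then show ?case using zs yw i by (simp add: p nth_append tuples_length)
  qed
  finally show ?thesis by (simp add: diag_def)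
qed

end

section \<open>Subalgebras generated by two skew-commuting elements\<close>

context k_algebra
begin

lemma skew_power:
  assumes "u * v = scl A c (v * u)" "c \<noteq> 0"
  shows "u ^ i * v = scl A (c ^ i) (v * u ^ i)" "v ^ j * u ^ i = scl A (inverse c ^ (i * j)) (u ^ i * v ^ j)"
proof -
  show 1: "u ^ i * v = scl A (c ^ i) (v * u ^ i)" for i
  proof (induction i)
    case (Suc i)
    have "u ^ Suc i * v = u ^ i * (u * v)" by (simp add: power_Suc2 mult.assoc del: power_Suc)
    also have "\<dots> = scl A c (u ^ i * v * u)" by (simp add: assms mult.assoc)
    also have "\<dots> = scl A (c ^ Suc i) (v * u ^ Suc i)"
      unfolding Suc by (simp add: mult.assoc power_Suc2 del: power_Suc)
    finally show ?case .
  qed simp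
  have 2: "v * u ^ i = scl A (inverse c ^ i) (u ^ i * v)" for i
    using assms(2) by (simp add: 1 power_mult_distrib[symmetric])
  show "v ^ j * u ^ i = scl A (inverse c ^ (i * j)) (u ^ i * v ^ j)"
  proof (induction j)
    case (Suc j)
    have "v ^ Suc j * u ^ i = v ^ j * (v * u ^ i)" by (simp add: power_Suc2 mult.assoc del: power_Suc)
    also have "\<dots> = scl A (inverse c ^ i) (v ^ j * u ^ i * v)" by (simp add: 2 mult.assoc)
    also have "\<dots> = scl A (inverse c ^ (i * Suc j)) (u ^ i * v ^ Suc j)"
      unfolding Suc by (simp add: mult.assoc power_Suc2 power_add[symmetric] add.commute del: power_Suc)
    finally show ?case .
  qed simp
qed

lemma span_mult_closed:
  assumes M: "\<And>a b. a \<in> M \<Longrightarrow> b \<in> M \<Longrightarrow> a * b \<in> span M" and a: "a \<in> span M" and b: "b \<in> span M"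
  shows "a * b \<in> span M"
  using a
proof (induction a rule: span_induct_alt)
  case (step c x y)
  have "x * b \<in> span M" using b
  proof (induction b rule: span_induct_alt)
    case (step c' x' y')
    then show ?case
      using M[OF \<open>x \<in> M\<close>] by (simp add: distrib_left span_add span_scale)
  qed (simp add: span_zero)
  then show ?case using step by (simp add: distrib_right span_add span_scale)
qed (simp add: span_zero)

lemma generated_subalgebra_mono:
  "subalgebra (scl A) B \<Longrightarrow> X \<subseteq> B \<Longrightarrow> generated_subalgebra (scl A) X \<subseteq> B"
  by (auto simp: generated_subalgebra_def)

lemma subalgebra_generated: "subalgebra (scl A) (generated_subalgebra (scl A) X)"
  unfolding generated_subalgebra_def subalgebra_def
  by (auto simp: subspace_def)

lemma generator_in: "u \<in> X \<Longrightarrow> u \<in> generated_subalgebra (scl A) X"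
  by (auto simp: generated_subalgebra_def)

lemma subalgebra_power: "subalgebra (scl A) B \<Longrightarrow> u \<in> B \<Longrightarrow> u ^ i \<in> B"
  by (induction i) (auto simp: subalgebra_def)

text \<open>Skew commutation sorts a product of two monomials into one monomial up to a scalar, and
  the two power relations bound the exponents. Used for the generators g, x of \<open>H\<close> and
  for \<open>g ^ n\<close>, x of \<open>A(q)\<close>.\<close>

lemma generated_eq_span:
  assumes uv: "u * v = scl A c (v * u)" "c \<noteq> 0" and u: "u ^ p = 1" "p > 0" and v: "v ^ r = 0"
  shows "generated_subalgebra (scl A) {u, v} = span ((\<lambda>(i, j). u ^ i * v ^ j) ` ({..<p} \<times> {..<r}))"
    (is "_ = span ?M")
proof
  have mem: "u ^ i * v ^ j \<in> span ?M" for i j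
  proof (cases "j < r")
    case True
    have "u ^ i = (u ^ p) ^ (i div p) * u ^ (i mod p)"
      by (simp only: power_mult[symmetric] power_add[symmetric] mult_div_mod_eq)
    then have "u ^ i * v ^ j = u ^ (i mod p) * v ^ j" by (simp add: u)
    moreover have "u ^ (i mod p) * v ^ j \<in> ?M"
      using True u(2) by force
    ultimately show ?thesis by (simp add: span_base)
  next
    case False
    then have "v ^ j = v ^ r * v ^ (j - r)" by (simp add: power_add[symmetric])
    then show ?thesis by (simp add: v span_zero)
  qed
  have prod: "(u ^ i * v ^ j) * (u ^ i' * v ^ j') \<in> span ?M" for i j i' j'
  proof -
    have "(u ^ i * v ^ j) * (u ^ i' * v ^ j') = u ^ i * (v ^ j * u ^ i') * v ^ j'"
      by (simp add: mult.assoc)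
    also have "\<dots> = scl A (inverse c ^ (i' * j)) (u ^ (i + i') * v ^ (j + j'))"
      by (simp add: skew_power[OF uv] power_add mult.assoc)
    finally show ?thesis using mem by (simp add: span_scale)
  qed
  have "subalgebra (scl A) (span ?M)"
    unfolding subalgebra_def
  proof (intro conjI ballI)
    show "1 \<in> span ?M" using mem[of 0 0] by simp
    fix a b assume "a \<in> span ?M" "b \<in> span ?M"
    then show "a * b \<in> span ?M" by (rule span_mult_closed[rotated]) (auto simp: prod)
  qed (rule subspace_span)
  moreover have "{u, v} \<subseteq> span ?M" using mem[of 1 0] mem[of 0 1] by simp
  ultimately show "generated_subalgebra (scl A) {u, v} \<subseteq> span ?M"
    by (rule generated_subalgebra_mono)
  have G: "subalgebra (scl A) (generated_subalgebra (scl A) {u, v})"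
    by (rule subalgebra_generated)
  have "?M \<subseteq> generated_subalgebra (scl A) {u, v}"
    using G subalgebra_power[OF G] by (auto simp: generator_in subalgebra_def)
  then show "span ?M \<subseteq> generated_subalgebra (scl A) {u, v}"
    using G by (intro span_minimal) (auto simp: subalgebra_def)
qed

text \<open>Turns the dimension condition on the Taft algebra into independence of its monomials: a
  basis chosen within the family already has to exhaust the index set.\<close>

lemma independent_if_card_dim:
  assumes "finite I" "V \<subseteq> span (f ` I)" "dim V = card I"
  shows "independent (f ` I)" "inj_on f I"
proof -
  obtain B where B: "B \<subseteq> f ` I" "independent B" "f ` I \<subseteq> span B"
    using maximal_independent_subset[of "f ` I"] by blast
  have fin: "finite B" using B(1) assms(1) finite_subset by blast
  have "V \<subseteq> span B" using assms(2) B(3) span_minimal[of "f ` I" "span B"] by auto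
  then have "card I \<le> card B" using dim_le_card[of V B] fin assms(3) by simp
  moreover have "card B \<le> card (f ` I)" using B(1) assms(1) by (intro card_mono) auto
  moreover have "card (f ` I) \<le> card I" using assms(1) by (rule card_image_le)
  ultimately have "card (f ` I) = card I" "card B = card (f ` I)" by linarith+
  then show "inj_on f I" "independent (f ` I)"
    using assms(1) B card_subset_eq[of "f ` I" B] by (auto intro: eq_card_imp_inj_on)
qed

end

section \<open>The idempotents of the Taft algebra\<close>

lemma sum_powers_root_of_unity:
  fixes r :: "'k::field"
  assumes "r ^ m = 1"
  shows "(\<Sum>j<m. r ^ j) = (if r = 1 then of_nat m else 0)"
  using assms by (simp add: geometric_sum)

lemma sum_shift_mod:
  fixes f :: "nat \<Rightarrow> 'c::ab_group_add"
  assumes "m > 0"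
  shows "(\<Sum>j<m. f (Suc j mod m)) = (\<Sum>j<m. f j)"
proof -
  obtain l where l: "m = Suc l" using assms by (cases m) auto
  have "(\<Sum>j<l. f (Suc j mod Suc l)) = (\<Sum>j<l. f (Suc j))"
    by (intro sum.cong) auto
  then show ?thesis
    unfolding l by (subst (2) sum.lessThan_Suc_shift) (simp add: add.commute)
qed

lemma (in comult_algebra) delta_sum:
  assumes "\<And>i. i \<in> I \<Longrightarrow> f i \<in> carr H"
  shows "comult H (\<Sum>i\<in>I. scl H (c i) (f i)) = (\<Sum>i\<in>I. tscale (c i) (comult H (f i)))"
  using assms
proof (induction I rule: infinite_finite_induct)
  case empty
  show ?case using delta_scl[of 0 0] by simp
next
  case (infinite I)
  then show ?case using delta_scl[of 0 0] by simp
next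
  case (insert i I)
  then show ?case by (simp add: delta_add delta_scl carr_sum)
qed

context idem_system
begin

lemma ptensor_de_2: "ptensor A [de \<phi>, de \<psi>] = dt 2 (\<lambda>v. \<phi> (v ! 0) * \<psi> (v ! 1))"
  using ptensor_de[of "[\<phi>, \<psi>]"] by (simp add: numeral_2_eq_2)

lemma dt_2: "dt 2 \<phi> = (\<Sum>y<N. \<Sum>z<N. tscale (\<phi> [y, z]) (ptensor A [e y, e z]))"
  by (simp add: diag_def sum_tuples_2)

end

locale taft_root = taft n q H g x
  for n :: nat and q :: "'k::field" and H :: "('k, 'a::ring_1) qhopf" and g x :: 'a +
  assumes n2: "n \<ge> 2"
    and char: "CHAR('k) = 0 \<or> coprime CHAR('k) n"
    and root: "primitive_root_of_unity (n\<^sup>2) q"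
begin

abbreviation N :: nat where "N \<equiv> n\<^sup>2"

lemma N_gt_0: "N > 0" and q_N: "q ^ N = 1"
  using root by (auto simp: primitive_root_of_unity_def)

lemma q_nz [simp]: "q \<noteq> 0"
  using q_N N_gt_0 by (metis power_0_left less_irrefl zero_neq_one)

lemma q_mod: "q ^ (a mod N) = q ^ a"
proof -
  have "q ^ a = (q ^ N) ^ (a div N) * q ^ (a mod N)"
    by (simp only: power_mult[symmetric] power_add[symmetric] mult_div_mod_eq)
  then show ?thesis by (simp add: q_N)
qed

lemma q_cong: "a mod N = b mod N \<Longrightarrow> q ^ a = q ^ b"
  using q_mod[of a] q_mod[of b] by simp

lemma q_eq_iff: "q ^ a = q ^ b \<longleftrightarrow> a mod N = b mod N"
proof
  have *: False if "a < b" "b < N" "q ^ a = q ^ b" for a b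
  proof -
    have "q ^ a * q ^ (b - a) = q ^ b"
      using that(1) by (simp only: power_add[symmetric] le_add_diff_inverse less_imp_le)
    then have "q ^ a * q ^ (b - a) = q ^ a" using that by simp
    then have "q ^ (b - a) = 1" by simp
    then show False using root that by (auto simp: primitive_root_of_unity_def)
  qed
  assume "q ^ a = q ^ b"
  then have "q ^ (a mod N) = q ^ (b mod N)" by (simp add: q_mod)
  then show "a mod N = b mod N"
    using *[of "a mod N" "b mod N"] *[of "b mod N" "a mod N"] N_gt_0
    by (metis linorder_neqE_nat mod_less_divisor)
qed (rule q_cong)

lemma of_nat_n_nz: "of_nat n \<noteq> (0::'k)"
proof
  assume "of_nat n = (0::'k)"
  then have "CHAR('k) dvd n" by (simp add: of_nat_eq_0_iff_char_dvd)
  then have "CHAR('k) = 0 \<or> CHAR('k) = 1"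
    using char by (metis coprime_common_divisor dvd_refl nat_dvd_1_iff_1)
  moreover have "CHAR('k) \<noteq> 1"
    using of_nat_CHAR[where 'a = 'k] by (metis of_nat_1 zero_neq_one)
  ultimately show False
    using \<open>CHAR('k) dvd n\<close> n2 by auto
qed

definition invN :: 'k where
  "invN = inverse (of_nat N)"

lemma invN [simp]: "invN * (of_nat n)\<^sup>2 = 1" "(of_nat n)\<^sup>2 * invN = 1"
  using of_nat_n_nz by (simp_all add: invN_def)

lemma fourier:
  assumes "z < N"
  shows "(\<Sum>j<N. invN * inverse q ^ (z * j) * q ^ (w * j)) = (if w mod N = z then 1 else 0)"
proof -
  let ?r = "inverse q ^ z * q ^ w"
  have r1: "?r = 1 \<longleftrightarrow> w mod N = z"
    using q_eq_iff[of w z] assms by (simp add: field_simps)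
  have "?r ^ N = 1"
    by (simp add: power_mult_distrib power_mult[symmetric] mult.commute[of _ N])
       (simp add: power_mult power_inverse q_N)
  then have "(\<Sum>j<N. ?r ^ j) = (if w mod N = z then of_nat N else 0)"
    using sum_powers_root_of_unity[of ?r N] by (simp add: r1)
  moreover have "(\<Sum>j<N. invN * inverse q ^ (z * j) * q ^ (w * j)) = (\<Sum>j<N. invN * ?r ^ j)"
    by (simp add: power_mult power_mult_distrib mult.assoc)
  ultimately show ?thesis
    by (simp add: sum_distrib_left[symmetric])
qed

text \<open>If powers of g are sent by a linear map to sums of terms scaled by q^(f w j), the image
  of \<open>e z\<close> consists of the terms with f w = z modulo N. Products, coproduct and
  antipode of the idempotents are all computed in this way.\<close>

lemma fourier_pick:
  assumes "vector_space sC" "z < N"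
  shows "(\<Sum>j<N. sC (invN * inverse q ^ (z * j)) (\<Sum>w\<in>W. sC (q ^ (f w * j)) (v w)))
    = (\<Sum>w\<in>W. if f w mod N = z then v w else 0)"
proof -
  interpret C: vector_space sC by fact
  have "(\<Sum>j<N. sC (invN * inverse q ^ (z * j)) (\<Sum>w\<in>W. sC (q ^ (f w * j)) (v w)))
     = (\<Sum>w\<in>W. sC (\<Sum>j<N. invN * inverse q ^ (z * j) * q ^ (f w * j)) (v w))"
    unfolding C.scale_sum_right C.scale_sum_left by (subst sum.swap) simp
  also have "\<dots> = (\<Sum>w\<in>W. if f w mod N = z then v w else 0)"
    using fourier[OF assms(2)] by (intro sum.cong) auto
  finally show ?thesis .
qed

text \<open>The Fourier formula. That these are the idempotents \<open>idem\<close> of the twist is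
  shown in \<open>idem_eq\<close>, which needs that they do not vanish.\<close>

definition e :: "nat \<Rightarrow> 'a" where
  "e z = (\<Sum>j<N. scl H (invN * inverse q ^ (z * j)) (g ^ j))"

lemma g_power_e: "g ^ j * e z = scl H (q ^ (z * j)) (e z)"
proof -
  define f where "f j = scl H (invN * inverse q ^ (z * j)) (g ^ j)" for j
  have e: "e z = (\<Sum>j<N. f j)" by (simp add: e_def f_def)
  have gf: "g * f j = scl H (q ^ z) (f (Suc j))" for j
    by (simp add: f_def power_add mult.assoc mult.commute[of "inverse q ^ z"]
          power_mult_distrib[symmetric])
  have "inverse q ^ (z * N) = 1"
    by (simp add: mult.commute[of z] power_mult power_inverse q_N)
  then have "f N = f 0" by (simp add: f_def g_power)
  then have "(\<Sum>j<N. f (Suc j)) = (\<Sum>j<N. f j)"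
    using sum.lessThan_Suc[of f N] sum.lessThan_Suc_shift[of f N] by simp
  then have 1: "g * e z = scl H (q ^ z) (e z)"
    by (simp add: e sum_distrib_left gf scale_sum_right[symmetric])
  show ?thesis
  proof (induction j)
    case (Suc j)
    have "g ^ Suc j * e z = g ^ j * (g * e z)"
      by (simp only: power_Suc2 mult.assoc)
    then show ?case by (simp add: 1 Suc power_add mult.commute)
  qed simp
qed

lemma g_power_mod: "g ^ (k mod N) = g ^ k"
proof -
  have "g ^ k = (g ^ N) ^ (k div N) * g ^ (k mod N)"
    by (simp only: power_mult[symmetric] power_add[symmetric] mult_div_mod_eq)
  then show ?thesis by (simp add: g_power)
qed

text \<open>Fourier inversion. For k = 0 it is the partition of unity; in general it makes the
  powers of g diagonal.\<close>

lemma g_eq_sum: "g ^ k = (\<Sum>w<N. scl H (q ^ (k * w)) (e w))"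
proof -
  have "(\<Sum>w<N. scl H (q ^ (k * w)) (e w)) =
      (\<Sum>j<N. scl H (\<Sum>w<N. invN * inverse q ^ (j * w) * q ^ (k * w)) (g ^ j))"
    unfolding e_def scale_sum_right scale_sum_left
    by (subst sum.swap) (simp add: mult_ac)
  also have "\<dots> = (\<Sum>j<N. if j = k mod N then g ^ j else 0)"
    by (intro sum.cong refl) (auto simp: fourier)
  also have "\<dots> = g ^ (k mod N)"
    using N_gt_0 by simp
  finally show ?thesis by (simp add: g_power_mod)
qed

lemma e_orthogonal:
  assumes "z < N" "w < N"
  shows "e z * e w = (if z = w then e z else 0)"
proof -
  have "e z * e w = (\<Sum>j<N. scl H (invN * inverse q ^ (z * j)) (\<Sum>w\<in>{w}. scl H (q ^ (w * j)) (e w)))"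
    by (subst (1) e_def) (simp add: sum_distrib_right g_power_e)
  also have "\<dots> = (\<Sum>w\<in>{w}. if w mod N = z then e w else 0)"
    by (rule fourier_pick[OF vector_space_scl assms(1)])
  finally show ?thesis using assms by auto
qed

sublocale idem_system H e N
proof
  show "e z \<in> carr H" for z
    unfolding e_def using g_closed by (intro carr_sum) auto
  show "(\<Sum>z<N. e z) = 1" using g_eq_sum[of 0] by simp
qed (use N_gt_0 e_orthogonal in auto)

lemma de_power: "de (\<lambda>w. q ^ (k * w)) = g ^ k"
  by (simp add: de_def g_eq_sum)

lemma comult_g_power: "comult H (g ^ j) = ptensor H [g ^ j, g ^ j]"
proof (induction j)
  case 0
  show ?case by (simp add: comult_one tone_def numeral_2_eq_2)
next
  case (Suc j)
  then show ?case using g_closed by (simp add: comult_mult comult_g tmul_ptensor)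
qed

lemma comult_e:
  assumes z: "z < N"
  shows "comult H (e z) = (\<Sum>y<N. \<Sum>w<N. if (y + w) mod N = z then ptensor H [e y, e w] else 0)"
proof -
  have g: "comult H (g ^ j) = (\<Sum>p\<in>{..<N} \<times> {..<N}. tscale (q ^ ((fst p + snd p) * j)) (ptensor H [e (fst p), e (snd p)]))"
    for j
  proof -
    have "comult H (g ^ j) = ptensor H [de (\<lambda>w. q ^ (j * w)), de (\<lambda>w. q ^ (j * w))]"
      by (simp add: comult_g_power de_power)
    also have "\<dots> = (\<Sum>y<N. \<Sum>w<N. tscale (q ^ ((y + w) * j)) (ptensor H [e y, e w]))"
      unfolding ptensor_de_2 dt_2 by (simp add: power_add[symmetric] algebra_simps)
    finally show ?thesis by (simp add: sum.cartesian_product case_prod_beta)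
  qed
  have "comult H (e z) = (\<Sum>j<N. tscale (invN * inverse q ^ (z * j)) (comult H (g ^ j)))"
    unfolding e_def using g_closed by (intro delta_sum) auto
  also have "\<dots> = (\<Sum>p\<in>{..<N} \<times> {..<N}. if (fst p + snd p) mod N = z then ptensor H [e (fst p), e (snd p)] else 0)"
    unfolding g by (rule fourier_pick[OF vector_space_tscale z])
  finally show ?thesis
    by (simp add: sum.cartesian_product case_prod_beta)
qed

sublocale CI: comult_idem H e N
  by unfold_locales (rule comult_e)

lemma counit_e: "z < N \<Longrightarrow> counit H (e z) = (if z = 0 then 1 else 0)"
proof -
  assume z: "z < N"
  have g: "counit H (g ^ j) = 1" for j
    by (induction j) (auto simp: counit_one counit_mult counit_g g_closed)
  have "counit H (\<Sum>j\<in>I. scl H (c j) (g ^ j)) = (\<Sum>j\<in>I. c j)" if "finite I" for I and c :: "nat \<Rightarrow> 'k"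
    using that counit_scl[of 0 0]
    by (induction I) (auto simp: counit_add counit_scl carr_sum g_closed g)
  then have "counit H (e z) = (\<Sum>j<N. invN * inverse q ^ (z * j) * q ^ (0 * j))"
    unfolding e_def by simp
  then show ?thesis by (subst (asm) fourier[OF z]) auto
qed

text \<open>Negation in Z/N on the representatives below N; the outer \<open>mod\<close> sends 0 to
  0 instead of N.\<close>

definition neg :: "nat \<Rightarrow> nat" where
  "neg z = (N - z) mod N"

lemma neg_less [simp]: "neg z < N"
  using N_gt_0 by (simp add: neg_def)

lemma neg_0 [simp]: "neg 0 = 0"
  by (simp add: neg_def)

lemma neg_eq: "0 < z \<Longrightarrow> z < N \<Longrightarrow> neg z = N - z"
  by (simp add: neg_def)

lemma neg_neg: "z < N \<Longrightarrow> neg (neg z) = z"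
  by (cases "z = 0") (auto simp: neg_eq)

lemma neg_iff: "z < N \<Longrightarrow> w < N \<Longrightarrow> z = neg w \<longleftrightarrow> w = neg z"
  by (metis neg_neg)

lemma alg_inverse_g: "alg_inverse H g = g ^ (N - 1)"
proof (rule alg_inverse_eqI)
  have "g * g ^ (N - 1) = g ^ N" "g ^ (N - 1) * g = g ^ N"
    using N_gt_0 by (simp_all add: power_Suc[symmetric] power_Suc2[symmetric] del: power_Suc)
  then show "g * g ^ (N - 1) = 1" "g ^ (N - 1) * g = 1"
    by (simp_all add: g_power)
qed (use g_closed in auto)

lemma antip_e:
  assumes z: "z < N"
  shows "antip H (e z) = e (neg z)"
proof -
  have g: "antip H (g ^ j) = (\<Sum>w<N. scl H (q ^ (((N - 1) * w) * j)) (e w))" for j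
  proof -
    have "antip H (g ^ j) = g ^ ((N - 1) * j)"
      by (induction j)
         (auto simp: antip_one antip_mult antip_g g_closed alg_inverse_g power_add[symmetric] add.commute)
    also have "\<dots> = (\<Sum>w<N. scl H (q ^ (((N - 1) * j) * w)) (e w))" by (rule g_eq_sum)
    finally show ?thesis by (simp add: mult_ac)
  qed
  have sum: "antip H (\<Sum>j\<in>I. scl H (c j) (g ^ j)) = (\<Sum>j\<in>I. scl H (c j) (antip H (g ^ j)))"
    if "finite I" for I and c :: "nat \<Rightarrow> 'k"
    using that antip_scl[of 0 0]
    by (induction I) (auto simp: antip_add antip_scl carr_sum g_closed)
  have iff: "((N - 1) * w) mod N = z \<longleftrightarrow> w = neg z" if w: "w < N" for w
  proof -
    have "((N - 1) * w) mod N = neg w"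
    proof (cases "w = 0")
      case False
      have "(N - 1) * w = (N - w) + (w - 1) * N"
        using w False N_gt_0 by (cases w; cases N) (auto simp: algebra_simps)
      then show ?thesis by (simp add: neg_def)
    qed simp
    then show ?thesis using neg_iff[OF z w] by auto
  qed
  have "antip H (e z) = (\<Sum>w<N. if ((N - 1) * w) mod N = z then e w else 0)"
    unfolding e_def[of z] by (subst sum) (simp_all add: g fourier_pick[OF vector_space_scl z])
  also have "\<dots> = (\<Sum>w<N. if w = neg z then e w else 0)"
    by (intro sum.cong refl) (simp only: lessThan_iff iff)
  finally show ?thesis by simp
qed

text \<open>The relation between g and x says that x raises the exponent of the g-eigenvalue by one.
  All later computations with x are such index shifts.\<close>

lemma e_x: "e (Suc z mod N) * x = x * e z"
proof -
  have *: "inverse q ^ (Suc z mod N * j) * q ^ j = inverse q ^ (z * j)" for j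
  proof -
    have "q ^ (Suc z mod N * j) = q ^ (Suc z * j)"
      by (rule q_cong) (simp add: mod_mult_left_eq)
    then show ?thesis by (simp add: power_inverse power_add field_simps)
  qed
  have "g ^ j * x = scl H (q ^ j) (x * g ^ j)" for j
    by (rule skew_power[OF g_x q_nz])
  then show ?thesis
    unfolding e_def by (simp add: sum_distrib_left sum_distrib_right mult.assoc *)
qed

lemma carr_eq_span: "carr H = span ((\<lambda>(i, j). g ^ i * x ^ j) ` ({..<N} \<times> {..<N}))"
  using generated_eq_span[OF g_x q_nz g_power N_gt_0 x_power] by (simp add: generated)

lemma monomials_independent:
  "independent ((\<lambda>(i, j). g ^ i * x ^ j) ` ({..<N} \<times> {..<N}))"
  "inj_on (\<lambda>(i, j). g ^ i * x ^ j) ({..<N} \<times> {..<N})"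
proof -
  have "dim (carr H) = card ({..<N} \<times> {..<N})"
    using dimension by (simp add: alg_dim_def power2_eq_square power4_eq_xxxx)
  from independent_if_card_dim[OF _ _ this, of "\<lambda>(i, j). g ^ i * x ^ j"] carr_eq_span
  show "independent ((\<lambda>(i, j). g ^ i * x ^ j) ` ({..<N} \<times> {..<N}))"
    "inj_on (\<lambda>(i, j). g ^ i * x ^ j) ({..<N} \<times> {..<N})" by auto
qed

end

section \<open>Characters of the Taft algebra\<close>

context taft_root
begin

abbreviation "taft_basis \<equiv> (\<lambda>(i, j). g ^ i * x ^ j) ` ({..<N} \<times> {..<N})"

text \<open>The character with g sent to q^z and x to 0. No presentation is at hand to define it by,
  so it is read off from the coefficients of the basis monomials without x. It serves to show that
  the idempotents are nonzero and, later, to evaluate the associator.\<close>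

definition chi :: "nat \<Rightarrow> 'a \<Rightarrow> 'k" where
  "chi z h = (\<Sum>i<N. q ^ (z * i) * representation taft_basis h (g ^ i))"

lemma chi_add: "h \<in> carr H \<Longrightarrow> h' \<in> carr H \<Longrightarrow> chi z (h + h') = chi z h + chi z h'"
  unfolding carr_eq_span
  by (simp add: chi_def representation_add[OF monomials_independent(1)] distrib_left sum.distrib)

lemma chi_scl: "h \<in> carr H \<Longrightarrow> chi z (scl H c h) = c * chi z h"
  unfolding carr_eq_span
  by (simp add: chi_def representation_scale[OF monomials_independent(1)] sum_distrib_left mult.left_commute)

lemma chi_0: "chi z 0 = 0"
  by (simp add: chi_def representation_zero)

lemma chi_monomial: "chi z (g ^ i * x ^ j) = (if j = 0 then q ^ (z * i) else 0)"
proof (cases "j < N")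
  case True
  have i: "i mod N < N" using N_gt_0 by simp
  have b: "g ^ (i mod N) * x ^ j \<in> taft_basis" using True i by force
  have "chi z (g ^ i * x ^ j) = chi z (g ^ (i mod N) * x ^ j)"
    by (simp add: g_power_mod)
  also have "\<dots> = (\<Sum>i'<N. q ^ (z * i') * (if i' = i mod N \<and> j = 0 then 1 else 0))"
    unfolding chi_def
  proof (intro sum.cong refl)
    fix i' assume i': "i' \<in> {..<N}"
    have "g ^ i' = g ^ (i mod N) * x ^ j \<longleftrightarrow> (i', 0) = (i mod N, j)"
      using inj_on_eq_iff[OF monomials_independent(2), of "(i', 0)" "(i mod N, j)"] i i' True N_gt_0
      by simp
    then show "q ^ (z * i') * representation taft_basis (g ^ (i mod N) * x ^ j) (g ^ i') =
        q ^ (z * i') * (if i' = i mod N \<and> j = 0 then 1 else 0)"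
      by (auto simp: representation_basis[OF monomials_independent(1) b])
  qed
  also have "\<dots> = (\<Sum>i'<N. if i' = i mod N then (if j = 0 then q ^ (z * i') else 0) else 0)"
    by (intro sum.cong) auto
  also have "\<dots> = (if j = 0 then q ^ (z * (i mod N)) else 0)"
    using i by simp
  also have "q ^ (z * (i mod N)) = q ^ (z * i)"
    by (rule q_cong) (simp add: mod_mult_right_eq)
  finally show ?thesis .
next
  case False
  then have "x ^ j = x ^ N * x ^ (j - N)" by (simp add: power_add[symmetric])
  moreover have "j \<noteq> 0" using False N_gt_0 by (intro notI) simp
  ultimately show ?thesis by (simp add: x_power chi_0)
qed

lemma chi_g_power: "chi z (g ^ i) = q ^ (z * i)"
  using chi_monomial[of z i 0] by simp

lemma chi_one: "chi z 1 = 1"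
  using chi_g_power[of z 0] by simp

lemma chi_x: "chi z x = 0"
  using chi_monomial[of z 0 1] by simp

text \<open>For monomials, moving x^j past g^k costs a power of q. It is 1 for j = 0, and for j > 0
  both sides vanish. The identity then extends linearly, first in the right factor and then in the
  left one.\<close>

lemma chi_mult:
  assumes "h \<in> carr H" "h' \<in> carr H"
  shows "chi z (h * h') = chi z h * chi z h'"
proof -
  have mono: "chi z (a * b) = chi z a * chi z b" if "a \<in> taft_basis" "b \<in> taft_basis" for a b
  proof -
    have "\<exists>i j. a = g ^ i * x ^ j" "\<exists>k l. b = g ^ k * x ^ l" using that by auto
    then obtain i j k l where a: "a = g ^ i * x ^ j" and b: "b = g ^ k * x ^ l"
      by blast
    have "a * b = g ^ i * (x ^ j * g ^ k) * x ^ l"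
      by (simp add: a b mult.assoc)
    also have "\<dots> = scl H (inverse q ^ (k * j)) (g ^ (i + k) * x ^ (j + l))"
      by (simp add: skew_power[OF g_x q_nz] power_add mult.assoc)
    finally have "chi z (a * b) = inverse q ^ (k * j) * chi z (g ^ (i + k) * x ^ (j + l))"
      using g_closed x_closed by (simp add: chi_scl)
    moreover have "chi z a = (if j = 0 then q ^ (z * i) else 0)" "chi z b = (if l = 0 then q ^ (z * k) else 0)"
      unfolding a b by (rule chi_monomial)+
    ultimately show ?thesis
      unfolding chi_monomial by (simp add: power_add distrib_left)
  qed
  have sub: "taft_basis \<subseteq> carr H" using g_closed x_closed by auto
  have right: "chi z (a * b) = chi z a * chi z b" if a: "a \<in> taft_basis" and b: "b \<in> carr H" for a b
  proof -
    have "a \<in> carr H" using a sub by blast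
    then have S: "subspace {b. b \<in> carr H \<and> chi z (a * b) = chi z a * chi z b}" (is "subspace ?S")
      unfolding subspace_def by (auto simp: chi_0 distrib_left chi_add chi_scl)
    have "taft_basis \<subseteq> ?S"
      by (rule subsetI, rule CollectI, rule conjI, erule subsetD[OF sub], erule mono[OF a])
    then have "span taft_basis \<subseteq> ?S" by (rule span_minimal[OF _ S])
    then have "b \<in> ?S" using b unfolding carr_eq_span by (rule subsetD)
    then show ?thesis by simp
  qed
  have S: "subspace {h. h \<in> carr H \<and> chi z (h * h') = chi z h * chi z h'}" (is "subspace ?S")
    using assms(2) unfolding subspace_def by (auto simp: chi_0 distrib_right chi_add chi_scl)
  have "taft_basis \<subseteq> ?S"
    by (rule subsetI, rule CollectI, rule conjI, erule subsetD[OF sub], erule right[OF _ assms(2)])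
  then have "span taft_basis \<subseteq> ?S" by (rule span_minimal[OF _ S])
  then have "h \<in> ?S" using assms(1) unfolding carr_eq_span by (rule subsetD)
  then show ?thesis by simp
qed

lemma chi_e:
  assumes "w < N"
  shows "chi z (e w) = (if z mod N = w then 1 else 0)"
proof -
  have "chi z (\<Sum>j\<in>I. scl H (c j) (g ^ j)) = (\<Sum>j\<in>I. c j * q ^ (z * j))" if "finite I" for I and c :: "nat \<Rightarrow> 'k"
    using that by (induction I) (auto simp: chi_0 chi_add chi_scl carr_sum g_closed chi_g_power)
  then show ?thesis
    unfolding e_def using fourier[OF assms] by simp
qed

lemma e_nonzero: "w < N \<Longrightarrow> e w \<noteq> 0"
  using chi_e[of w w] chi_0[of w] by auto

section \<open>The twist\<close>

lemma de_inject: "w < N \<Longrightarrow> de \<phi> = de \<psi> \<Longrightarrow> \<phi> w = \<psi> w"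
  using e_de(1)[of w \<phi>] e_de(1)[of w \<psi>] e_nonzero[of w] by simp

lemma generated_g: "generated_subalgebra (scl H) {g} \<subseteq> range de"
proof (rule generated_subalgebra_mono)
  have "de \<phi> + de \<psi> = de (\<lambda>z. \<phi> z + \<psi> z)" for \<phi> \<psi>
    by (simp add: de_def scale_left_distrib sum.distrib)
  moreover have "scl H c (de \<phi>) = de (\<lambda>z. c * \<phi> z)" for c \<phi>
    by (simp add: de_def scale_sum_right)
  moreover have "0 = de (\<lambda>z. 0)" by (simp add: de_def)
  ultimately show "subalgebra (scl H) (range de)"
    unfolding subalgebra_def subspace_def by (auto simp: de_mult de_one[symmetric])
  show "{g} \<subseteq> range de" using de_power[of 1] by (metis empty_subsetI insert_subset power_one_right rangeI)
qed

text \<open>Every element of k[g] is some \<open>de \<phi>\<close>. A summand in an orthogonal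
  splitting of \<open>e z\<close> is a multiple of \<open>e z\<close>, and orthogonality kills one
  of the two. Conversely the eigenvalue condition concentrates \<open>\<phi>\<close> at z, since the
  powers of q below N are distinct, and idempotency makes the value there 1.\<close>

lemma idem_eq:
  assumes z: "z < N"
  shows "idem q H g z = e z"
proof -
  let ?R = "generated_subalgebra (scl H) {g}"
  have R: "subalgebra (scl H) ?R" by (rule subalgebra_generated)
  have eR: "e w \<in> ?R" for w
    unfolding e_def
  proof (rule subspace_sum)
    show "subspace ?R" using R by (simp add: subalgebra_def)
    show "scl H c (g ^ j) \<in> ?R" for c j
      using R subalgebra_power[OF R, of g j] by (auto simp: generator_in subalgebra_def subspace_def)
  qed
  have ge: "g * e z = scl H (q ^ z) (e z)" using g_power_e[of 1 z] by simp
  have ee: "e z * e z = e z" using z by (simp add: e_mult)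
  have prim: "primitive_idempotent ?R (e z)"
    unfolding primitive_idempotent_def
  proof (intro conjI ballI impI eR ee e_nonzero[OF z])
    fix e1 e2 assume "e1 \<in> ?R" "e2 \<in> ?R"
      and *: "e1 * e1 = e1 \<and> e2 * e2 = e2 \<and> e1 * e2 = 0 \<and> e2 * e1 = 0 \<and> e z = e1 + e2"
    then obtain \<phi> \<psi> where e12: "e1 = de \<phi>" "e2 = de \<psi>" using generated_g by blast
    have prod: "\<phi> w * \<psi> w = 0" if "w < N" for w
      using * de_inject[OF that, of "\<lambda>w. \<phi> w * \<psi> w" "\<lambda>_. 0"]
      by (auto simp: e12 de_mult) (simp add: de_def)
    have "e1 = e1 * e z" using * by (simp add: distrib_left)
    then have 1: "e1 = scl H (\<phi> z) (e z)" using e_de(2)[OF z] by (simp add: e12)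
    have "e2 = e2 * e z" using * by (simp add: distrib_left)
    then have 2: "e2 = scl H (\<psi> z) (e z)" using e_de(2)[OF z] by (simp add: e12)
    show "e1 = 0 \<or> e2 = 0" using prod[OF z] 1 2 by auto
  qed
  show ?thesis
    unfolding idem_def
  proof (rule the_equality)
    show "primitive_idempotent ?R (e z) \<and> g * e z = scl H (q ^ z) (e z)"
      using prim ge by simp
    fix r assume r: "primitive_idempotent ?R r \<and> g * r = scl H (q ^ z) r"
    then have "r \<in> range de" using generated_g by (auto simp: primitive_idempotent_def)
    then obtain \<phi> where \<phi>: "r = de \<phi>" by blast
    have "de (\<lambda>w. q ^ (1 * w)) * de \<phi> = g ^ 1 * r" by (simp only: de_power \<phi>)
    then have gr: "g * r = de (\<lambda>w. q ^ w * \<phi> w)" by (simp add: de_mult)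
    have other: "\<phi> w = 0" if "w < N" "w \<noteq> z" for w
    proof -
      have "scl H (q ^ w * \<phi> w) (e w) = e w * (g * r)"
        using that by (simp add: gr e_de)
      also have "\<dots> = scl H (q ^ z * \<phi> w) (e w)"
        using r that by (simp add: \<phi> e_de)
      finally have "q ^ w * \<phi> w = q ^ z * \<phi> w" using e_nonzero that by simp
      moreover have "q ^ w \<noteq> q ^ z" using that z by (simp add: q_eq_iff)
      ultimately show ?thesis by simp
    qed
    have r1: "r = scl H (\<phi> z) (e z)"
    proof -
      have "r = (\<Sum>w<N. if w = z then scl H (\<phi> z) (e z) else 0)"
        unfolding \<phi> de_def using other by (intro sum.cong) auto
      then show ?thesis using z by simp
    qed
    have "r * r = r" "r \<noteq> 0" using r by (auto simp: primitive_idempotent_def)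
    then have "\<phi> z * \<phi> z = \<phi> z" "\<phi> z \<noteq> 0" using e_nonzero[OF z] by (auto simp: r1 ee)
    then show "r = e z" by (simp add: r1)
  qed
qed

text \<open>The coefficients of the twist are the inverses of \<open>K z y = q\<^bsup>z (y - y')\<^esup>\<close>, where \<open>y - y' = n (y div n)\<close>.\<close>

definition K :: "nat \<Rightarrow> nat \<Rightarrow> 'k" where
  "K z y = q ^ (z * (n * (y div n)))"

text \<open>The carry, 0 or 1, from adding the last digits to the base n:
  \<open>n * carry y w\<close> is y' + w' - (y + w)'.\<close>

definition carry :: "nat \<Rightarrow> nat \<Rightarrow> nat" where
  "carry y w = (y mod n + w mod n) div n"

lemma K_nz [simp]: "K z y \<noteq> 0"
  by (simp add: K_def)

lemma K_mod_left [simp]: "K (z mod N) y = K z y"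
  unfolding K_def by (rule q_cong) (simp add: mod_mult_left_eq)

text \<open>Reducing y modulo N changes the upper digit by a multiple of n, hence the exponent of q
  by a multiple of N.\<close>

lemma K_mod_right [simp]: "K z (y mod N) = K z y"
proof -
  have "y mod N div n = (y div n) mod n"
    using n2 by (simp add: power2_eq_square mod_mult2_eq)
  then have "n * (y mod N div n) = (n * (y div n)) mod N"
    by (simp only: power2_eq_square mult_mod_right)
  then show ?thesis
    unfolding K_def by (intro q_cong) (simp add: mod_mult_right_eq)
qed

lemma K_add_left: "K (z + z') y = K z y * K z' y"
  by (simp add: K_def power_add distrib_right)

text \<open>\<open>K\<close> is multiplicative in the first argument, but in the second the upper
  digits do not simply add up. This carry factor is the source of the associator.\<close>

lemma K_add_right: "K z (y + w) = K z y * K z w * q ^ (z * (n * carry y w))"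
  by (simp add: K_def carry_def div_add1_eq[of y w] power_add distrib_left)

lemma K_0_left [simp]: "K 0 y = 1" and K_0_right [simp]: "K z 0 = 1"
  by (simp_all add: K_def)

lemma K_N [simp]: "K z N = 1" "K N y = 1"
  using K_mod_right[of z N] K_mod_left[of N y] by simp_all

lemma K_1_right [simp]: "K z (Suc 0) = 1"
  using n2 by (simp add: K_def)

lemma K_neg_left: "z < N \<Longrightarrow> K (neg z) y = inverse (K z y)"
  using K_add_left[of "N - z" z y] by (simp add: neg_def field_simps)

lemma K_neg_right: "z < N \<Longrightarrow> K w z * K w (neg z) = inverse (q ^ (w * (n * carry z (neg z))))"
  using K_add_right[of w z "N - z"] n2
  by (simp add: neg_def field_simps) (simp add: carry_def power2_eq_square mod_mod_cancel)

abbreviation "J \<equiv> taft_twist n q H g"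

lemma J_eq: "J = dt 2 (\<lambda>v. inverse (K (v ! 0) (v ! 1)))"
proof -
  have "q powi (- (int z * (int y - int (y mod n)))) = inverse (K z y)" for z y
  proof -
    have "int y - int (y mod n) = int (n * (y div n))"
      by (metis add_diff_cancel_right' mult_div_mod_eq of_nat_add)
    then have "- (int z * (int y - int (y mod n))) = - int (z * (n * (y div n)))"
      by simp
    then show ?thesis
      unfolding K_def by (simp only: power_int_minus power_int_of_nat)
  qed
  then show ?thesis
    by (simp add: taft_twist_def dt_2 idem_eq)
qed

lemma J_unit:
  "tmul H 2 J (dt 2 (\<lambda>v. K (v ! 0) (v ! 1))) = tone H 2"
  "tmul H 2 (dt 2 (\<lambda>v. K (v ! 0) (v ! 1))) J = tone H 2"
  unfolding J_eq by (auto simp: dt_mult dt_one intro!: diag_cong)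

lemma J_in: "J \<in> tpower H 2"
  unfolding J_eq by simp

lemma tinverse_J: "tinverse H 2 J = dt 2 (\<lambda>v. K (v ! 0) (v ! 1))"
  using J_unit J_in by (intro tinverse_eqI) auto

lemma is_twist_J: "is_twist H J"
  unfolding is_twist_def
proof (intro conjI)
  show "tinvertible H 2 J"
    unfolding tinvertible_def using J_unit J_in by (auto intro: dt_closed)
  have "tlift2 H (\<lambda>f g. scl H (counit H f) g) J =
      (\<Sum>z<N. \<Sum>y<N. if z = 0 then e y else 0)"
    unfolding J_eq by (subst tlift_dt[OF mlin_counit_left])
      (auto simp: sum_tuples_2 counit_e intro!: sum.cong)
  also have "\<dots> = (\<Sum>z<N. if z = 0 then 1 else 0)"
    by (intro sum.cong refl) (auto simp: e_sum)
  finally show "tlift2 H (\<lambda>f g. scl H (counit H f) g) J = 1" using N_gt_0 by simp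
  have "tlift2 H (\<lambda>f g. scl H (counit H g) f) J =
      (\<Sum>z<N. \<Sum>y<N. if y = 0 then e z else 0)"
    unfolding J_eq tlift_dt[OF mlin_counit_right zero_less_numeral] sum_tuples_2
    by (intro sum.cong refl) (auto simp: counit_e)
  also have "\<dots> = 1"
    using N_gt_0 by (simp add: e_sum)
  finally show "tlift2 H (\<lambda>f g. scl H (counit H g) f) J = 1" .
qed

lemma e_mult_e_neg: "z < N \<Longrightarrow> y < N \<Longrightarrow> e z * e (neg y) = (if y = neg z then e z else 0)"
  using neg_iff[of z y] by (simp add: e_mult)

lemma e_neg_mult_e: "z < N \<Longrightarrow> y < N \<Longrightarrow> e (neg z) * e y = (if z = neg y then e y else 0)"
  using neg_iff[of z y] by (auto simp: e_mult)

section \<open>The elements \<open>\<alpha>\<^sub>J\<close> and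
  \<open>\<beta>\<^sub>J\<close>\<close>

lemma twist_beta_J: "twist_beta H J = de (\<lambda>z. inverse (K z (neg z)))"
proof -
  have "twist_beta H J = (\<Sum>z<N. \<Sum>y<N. scl H (inverse (K z y)) (e z * e (neg y)))"
    unfolding twist_beta_def J_eq by (subst tlift_dt[OF mlin_antip_right])
      (auto simp: sum_tuples_2 bet_trivial antip_e intro!: sum.cong)
  also have "\<dots> = (\<Sum>z<N. \<Sum>y<N. if y = neg z then scl H (inverse (K z (neg z))) (e z) else 0)"
    by (intro sum.cong refl) (auto simp: e_mult_e_neg)
  finally show ?thesis by (simp add: de_def)
qed

lemma twist_alpha_J: "twist_alpha H J = de (\<lambda>z. K (neg z) z)"
proof -
  have "twist_alpha H J = (\<Sum>z<N. \<Sum>y<N. scl H (K z y) (e (neg z) * e y))"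
    unfolding twist_alpha_def tinverse_J by (subst tlift_dt[OF mlin_antip_left])
      (auto simp: sum_tuples_2 alph_trivial antip_e intro!: sum.cong)
  also have "\<dots> = (\<Sum>y<N. \<Sum>z<N. if z = neg y then scl H (K (neg y) y) (e y) else 0)"
    by (subst sum.swap) (intro sum.cong refl, auto simp: e_neg_mult_e)
  finally show ?thesis by (simp add: de_def)
qed

text \<open>The last digits of z and -z add up to n, with carry 1, unless n divides z; in that case
  the carry is 0 but \<open>q ^ (z * n)\<close> is 1 anyway.\<close>

lemma carry_neg: "z < N \<Longrightarrow> q ^ (z * (n * carry z (neg z))) = q ^ (z * n)"
proof -
  assume z: "z < N"
  have nn: "neg z mod n = (N - z) mod n"
    by (simp add: neg_def power2_eq_square mod_mod_cancel)
  show ?thesis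
  proof (cases "z mod n = 0")
    case True
    then obtain m where m: "z = n * m" by (metis mod_0_imp_dvd dvdE)
    have "(N - z) mod n = 0"
      by (simp add: m power2_eq_square diff_mult_distrib2[symmetric])
    then have "carry z (neg z) = 0" using True by (simp add: carry_def nn)
    moreover have "q ^ (z * n) = (q ^ N) ^ m" by (simp add: m power_mult[symmetric] power2_eq_square mult_ac)
    ultimately show ?thesis by (simp add: q_N)
  next
    case False
    have "(z mod n + (N - z) mod n) mod n = 0"
      using z by (simp add: mod_add_eq)
    then obtain m where m: "z mod n + (N - z) mod n = n * m" by (metis mod_0_imp_dvd dvdE)
    have "n * m < n * 2" "n * m > 0"
      using False n2 mod_less_divisor[of n z] mod_less_divisor[of n "N - z"] unfolding m[symmetric]
      by linarith+
    then have "m = 1" by simp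
    then have "carry z (neg z) = 1" using m n2 by (simp add: carry_def nn)
    then show ?thesis by simp
  qed
qed

lemma K_self_neg: "z < N \<Longrightarrow> K z z * K z (neg z) = inverse (q ^ (z * n))"
  by (simp add: K_neg_right carry_neg)

text \<open>The origin of \<open>\<alpha> = a\<close>: the coefficient at z is the inverse of
  \<open>K z z * K z (neg z)\<close>, which is the carry factor of z and -z.\<close>

lemma beta_alpha_J: "twist_beta H J * twist_alpha H J = g ^ n"
proof -
  have "twist_beta H J * twist_alpha H J = de (\<lambda>z. q ^ (n * z))"
    unfolding twist_beta_J twist_alpha_J de_mult
  proof (rule de_cong)
    fix z assume z: "z < N"
    have "inverse (K z (neg z)) * K (neg z) z = inverse (K z z * K z (neg z))"
      using z by (simp add: K_neg_left)
    then show "inverse (K z (neg z)) * K (neg z) z = q ^ (n * z)"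
      using z by (simp add: K_self_neg mult.commute)
  qed
  then show ?thesis by (simp add: de_power)
qed

lemma de_unit:
  assumes "\<And>z. z < N \<Longrightarrow> \<phi> z \<noteq> 0"
  shows "de \<phi> * de (\<lambda>z. inverse (\<phi> z)) = 1" "de (\<lambda>z. inverse (\<phi> z)) * de \<phi> = 1"
  unfolding de_mult de_one[symmetric] using assms by (auto intro!: de_cong)

lemma beta_invertible_J: "alg_invertible H (twist_beta H J)"
  unfolding alg_invertible_def twist_beta_J
  using de_unit[of "\<lambda>z. inverse (K z (neg z))"] by (auto intro: de_closed)

sublocale hopf_twist H J
  by unfold_locales (rule is_twist_J, rule beta_invertible_J)

end

section \<open>The quasi-Hopf algebra \<open>A(q)\<close>\<close>

context taft_root
begin

abbreviation "A \<equiv> A_taft n q H g x"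

lemma A_simps [simp]:
  "scl A = scl H" "comult A = twist_comult H J" "counit A = counit H"
  "assoc A = twist_assoc H J" "antip A = twist_antip H J" "alph A = g ^ n" "bet A = 1"
  by (simp_all add: A_taft_def Let_def)

lemma carr_A: "carr A = generated_subalgebra (scl H) {g ^ n, x}"
  by (simp add: A_taft_def Let_def)

lemma subalgebra_A: "subalgebra (scl H) (carr A)"
  unfolding carr_A by (rule subalgebra_generated)

lemma g_n_in_A [simp]: "g ^ n \<in> carr A" and x_in_A [simp]: "x \<in> carr A"
  unfolding carr_A by (auto intro: generator_in)

lemma carr_A_sub: "carr A \<subseteq> carr H"
  unfolding carr_A using g_closed x_closed
  by (intro generated_subalgebra_mono subalgebra_carr) auto

lemma A_minimal: "subalgebra (scl H) B \<Longrightarrow> g ^ n \<in> B \<Longrightarrow> x \<in> B \<Longrightarrow> carr A \<subseteq> B"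
  unfolding carr_A by (intro generated_subalgebra_mono) auto

lemma k_algebra_A: "k_algebra A"
  using vector_space_scl subalgebra_A
  by (auto simp: k_algebra_def k_algebra_axioms_def)

sublocale SA: k_subalgebra H A
  using k_algebra_axioms k_algebra_A carr_A_sub by (auto simp: k_subalgebra_def k_subalgebra_axioms_def)

lemma carr_A_span:
  "carr A = span ((\<lambda>(i, j). (g ^ n) ^ i * x ^ j) ` ({..<n} \<times> {..<N}))"
  unfolding carr_A
proof (rule generated_eq_span)
  show "g ^ n * x = scl H (q ^ n) (x * g ^ n)" by (rule skew_power[OF g_x q_nz])
  show "(g ^ n) ^ n = 1" using g_power by (simp add: power_mult[symmetric] power2_eq_square)
qed (use n2 x_power in auto)

lemma de_sum: "(\<Sum>i\<in>I. scl H (c i) (de (\<phi> i))) = de (\<lambda>z. \<Sum>i\<in>I. c i * \<phi> i z)"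
proof -
  have "(\<Sum>i\<in>I. scl H (c i) (de (\<phi> i))) = (\<Sum>i\<in>I. \<Sum>z<N. scl H (c i * \<phi> i z) (e z))"
    by (simp add: de_def scale_sum_right)
  also have "\<dots> = de (\<lambda>z. \<Sum>i\<in>I. c i * \<phi> i z)"
    unfolding de_def by (subst sum.swap) (simp add: scale_sum_left)
  finally show ?thesis .
qed

definition res :: "nat \<Rightarrow> nat \<Rightarrow> 'k" where
  "res r z = (if z mod n = r then 1 else 0)"

text \<open>Fourier inversion on Z/n with the root q^n: \<open>de (res r)\<close>, the sum of all
  \<open>e z\<close> with z in the residue class r, is the idempotent of k[g^n] for the eigenvalue
  q^(n r).\<close>

lemma de_res_in_A:
  assumes r: "r < n"
  shows "de (res r) \<in> carr A"
proof -
  define c where "c j = inverse (of_nat n) * inverse q ^ (n * r * j)" for j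
  have "(\<Sum>j<n. c j * q ^ (n * j * z)) = res r z" for z
  proof -
    let ?r = "inverse q ^ (n * r) * q ^ (n * z)"
    have "?r = 1 \<longleftrightarrow> q ^ (n * z) = q ^ (n * r)" by (simp add: field_simps)
    also have "\<dots> \<longleftrightarrow> z mod n = r"
      using r by (simp add: q_eq_iff power2_eq_square)
    finally have r1: "?r = 1 \<longleftrightarrow> z mod n = r" .
    have "?r ^ n = inverse (q ^ N) ^ r * (q ^ N) ^ z"
      by (simp add: power_mult_distrib power_mult[symmetric] power2_eq_square power_inverse mult_ac)
    then have "(\<Sum>j<n. ?r ^ j) = (if z mod n = r then of_nat n else 0)"
      using sum_powers_root_of_unity[of ?r n] by (simp add: q_N r1)
    moreover have "(\<Sum>j<n. c j * q ^ (n * j * z)) = inverse (of_nat n) * (\<Sum>j<n. ?r ^ j)"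
      unfolding c_def sum_distrib_left
      by (intro sum.cong refl) (simp add: power_mult_distrib power_mult[symmetric] mult_ac)
    ultimately show ?thesis using of_nat_n_nz by (simp add: res_def)
  qed
  then have "de (res r) = (\<Sum>j<n. scl H (c j) (de (\<lambda>z. q ^ (n * j * z))))"
    unfolding de_sum by (intro de_cong) simp
  also have "\<dots> = (\<Sum>j<n. scl H (c j) ((g ^ n) ^ j))"
    unfolding de_power by (simp add: power_mult)
  also have "\<dots> \<in> carr A"
    using SA.B.carr_sum[of "{..<n}" "\<lambda>j. scl H (c j) ((g ^ n) ^ j)"] SA.B.carr_scl SA.B.carr_power[OF g_n_in_A]
    by simp
  finally show ?thesis .
qed

lemma sum_res: "(\<Sum>r<n. c r * res r z) = c (z mod n)"
  using n2 by (simp add: res_def if_distrib[of "(*) _"] cong: if_cong)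

lemma de_in_A:
  assumes "\<And>z. z < N \<Longrightarrow> \<phi> z = \<phi> (z mod n)"
  shows "de \<phi> \<in> carr A"
proof -
  have "de \<phi> = de (\<lambda>z. \<Sum>r<n. \<phi> r * res r z)"
    using assms by (intro de_cong) (simp add: sum_res)
  also have "\<dots> = (\<Sum>r<n. scl H (\<phi> r) (de (res r)))" by (simp add: de_sum)
  also have "\<dots> \<in> carr A"
    using SA.B.carr_sum[of "{..<n}" "\<lambda>r. scl H (\<phi> r) (de (res r))"] SA.B.carr_scl[OF de_res_in_A]
    by simp
  finally show ?thesis .
qed

text \<open>A coefficient function of residues is a finite combination of indicators of residue
  tuples, and each indicator gives a pure tensor with entries \<open>de (res r)\<close>.\<close>

lemma dt_in_A:
  assumes m: "m > 0" and \<phi>: "\<And>zs. zs \<in> tuples {..<N} m \<Longrightarrow> \<phi> zs = \<phi> (map (\<lambda>z. z mod n) zs)"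
  shows "dt m \<phi> \<in> tpower A m"
proof -
  have prod: "(\<Prod>i<m. res (rs ! i) (zs ! i)) = (if rs = map (\<lambda>z. z mod n) zs then 1 else 0)"
    if "rs \<in> tuples {..<n} m" "zs \<in> tuples {..<N} m" for rs zs
    using that by (auto simp: res_def tuples_iff_nth list_eq_iff_nth_eq intro!: prod.neutral) (metis lessThan_iff)
  have "dt m \<phi> = dt m (\<lambda>zs. \<Sum>rs\<in>tuples {..<n} m. \<phi> rs * (\<Prod>i<m. res (rs ! i) (zs ! i)))"
  proof (rule diag_cong)
    fix zs assume zs: "zs \<in> tuples {..<N} m"
    have "(\<Sum>rs\<in>tuples {..<n} m. \<phi> rs * (\<Prod>i<m. res (rs ! i) (zs ! i))) =
        (\<Sum>rs\<in>tuples {..<n} m. if rs = map (\<lambda>z. z mod n) zs then \<phi> rs else 0)"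
      using zs by (intro sum.cong) (auto simp: prod)
    also have "\<dots> = \<phi> (map (\<lambda>z. z mod n) zs)"
      using zs n2 tuples_map[OF zs, of "\<lambda>z. z mod n" "{..<n}"] by (simp add: finite_tuples)
    finally show "\<phi> zs = (\<Sum>rs\<in>tuples {..<n} m. \<phi> rs * (\<Prod>i<m. res (rs ! i) (zs ! i)))"
      using \<phi>[OF zs] by simp
  qed
  also have "\<dots> = (\<Sum>rs\<in>tuples {..<n} m. tscale (\<phi> rs) (dt m (\<lambda>zs. \<Prod>i<m. res (rs ! i) (zs ! i))))"
    by (rule dt_sum[symmetric]) (simp add: finite_tuples)
  also have "\<dots> \<in> tpower A m"
  proof (intro SA.B.tpower_sum SA.B.tpower_tscale m)
    fix rs assume rs: "rs \<in> tuples {..<n} m"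
    have "dt m (\<lambda>zs. \<Prod>i<m. res (rs ! i) (zs ! i)) = ptensor H (map de (map res rs))"
      using rs by (subst ptensor_de) (auto simp: tuples_length intro!: diag_cong)
    moreover have "map de (map res rs) \<in> tuples (carr A) m"
      using tuples_map[OF rs, of "\<lambda>r. de (res r)"] de_res_in_A by (simp add: comp_def)
    ultimately show "dt m (\<lambda>zs. \<Prod>i<m. res (rs ! i) (zs ! i)) \<in> tpower A m"
      using SA.B.tpower_ptensor SA.ptensor_eq by metis
  qed
  finally show ?thesis .
qed

section \<open>The twisted coproduct on \<open>A(q)\<close>\<close>

lemma twist_comult_dt:
  assumes "comult H h = dt 2 \<phi>"
  shows "twist_comult H J h = dt 2 \<phi>"
  unfolding twist_comult_def tinverse_J unfolding J_eq assms
  by (auto simp: dt_mult intro!: diag_cong)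

text \<open>The coproduct of \<open>e z\<close> is diagonal and so commutes with \<open>J\<close>.
  Hence the twisted algebra is again a \<open>comult_idem\<close>, with the same substitution rule
  for its coproduct.\<close>

lemma twist_comult_e:
  "z < N \<Longrightarrow> twist_comult H J (e z) =
    (\<Sum>y<N. \<Sum>w<N. if (y + w) mod N = z then ptensor H [e y, e w] else 0)"
proof -
  assume z: "z < N"
  have dt: "(\<Sum>y<N. \<Sum>w<N. if (y + w) mod N = z then ptensor H [e y, e w] else 0) =
      dt 2 (\<lambda>v. if (v ! 0 + v ! 1) mod N = z then 1 else 0)"
    unfolding dt_2 by (intro sum.cong refl) auto
  show ?thesis
    unfolding dt by (rule twist_comult_dt) (rule trans[OF comult_e[OF z] dt])
qed

lemma diag_twisted: "diag (twisted H J) = diag H"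
  by (simp add: diag_def fun_eq_iff)

lemma comult_at_twisted_dt:
  assumes "i < m"
  shows "comult_at (twisted H J) i m (dt m \<phi>) =
    dt (Suc m) (\<lambda>ws. \<phi> (take i ws @ ((ws ! i + ws ! Suc i) mod N) # drop (Suc (Suc i)) ws))"
proof -
  interpret TI: comult_idem "twisted H J" e N
    using T.comult_algebra_axioms idem_system_axioms
    by (auto simp: comult_idem_def comult_idem_axioms_def idem_system_def idem_system_axioms_def
          comult_algebra_def twist_comult_e cong: if_cong)
  show ?thesis using TI.comult_at_dt[OF assms] by (simp add: diag_twisted)
qed

lemma de_x: "de \<phi> * x = x * de (\<lambda>z. \<phi> (Suc z mod N))"
proof -
  have "de \<phi> * x = (\<Sum>z<N. scl H (\<phi> z) (e z * x))"
    by (simp add: de_def sum_distrib_right)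
  also have "\<dots> = (\<Sum>z<N. scl H (\<phi> (Suc z mod N)) (e (Suc z mod N) * x))"
    by (rule sum_shift_mod[symmetric]) (rule N_gt_0)
  also have "\<dots> = x * de (\<lambda>z. \<phi> (Suc z mod N))"
    by (simp add: de_def sum_distrib_left e_x)
  finally show ?thesis .
qed

lemma pure_dt_mult:
  assumes "a \<in> carr H" "b \<in> carr H"
  shows "tmul H 2 (ptensor H [a, b]) (dt 2 \<phi>) = (\<Sum>y<N. \<Sum>z<N. tscale (\<phi> [y, z]) (ptensor H [a * e y, b * e z]))"
    "tmul H 2 (dt 2 \<phi>) (ptensor H [a, b]) = (\<Sum>y<N. \<Sum>z<N. tscale (\<phi> [y, z]) (ptensor H [e y * a, e z * b]))"
proof -
  have ab: "ptensor H [a, b] \<in> tpower H 2" using assms by (intro tpower_ptensor) simp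
  show "tmul H 2 (ptensor H [a, b]) (dt 2 \<phi>) = (\<Sum>y<N. \<Sum>z<N. tscale (\<phi> [y, z]) (ptensor H [a * e y, b * e z]))"
    by (subst tlin_dt[OF tlin_tmul_right[OF ab]]) (auto simp: sum_tuples_2 tmul_ptensor assms)
  show "tmul H 2 (dt 2 \<phi>) (ptensor H [a, b]) = (\<Sum>y<N. \<Sum>z<N. tscale (\<phi> [y, z]) (ptensor H [e y * a, e z * b]))"
    by (subst tlin_dt[OF tlin_tmul_left[OF ab]]) (auto simp: sum_tuples_2 tmul_ptensor assms)
qed

lemma dt_x_1: "tmul H 2 (dt 2 \<phi>) (ptensor H [x, 1]) =
    tmul H 2 (ptensor H [x, 1]) (dt 2 (\<lambda>v. \<phi> [Suc (v ! 0) mod N, v ! 1]))"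
proof -
  have "tmul H 2 (dt 2 \<phi>) (ptensor H [x, 1]) =
      (\<Sum>y<N. \<Sum>z<N. tscale (\<phi> [y, z]) (ptensor H [e y * x, e z]))"
    using x_closed by (simp add: pure_dt_mult)
  also have "\<dots> = (\<Sum>y<N. \<Sum>z<N. tscale (\<phi> [Suc y mod N, z]) (ptensor H [e (Suc y mod N) * x, e z]))"
    by (rule sum_shift_mod[symmetric]) (rule N_gt_0)
  finally show ?thesis
    using x_closed by (simp add: pure_dt_mult e_x)
qed

lemma dt_1_x: "tmul H 2 (dt 2 \<phi>) (ptensor H [1, x]) =
    tmul H 2 (ptensor H [1, x]) (dt 2 (\<lambda>v. \<phi> [v ! 0, Suc (v ! 1) mod N]))"
proof -
  have "tmul H 2 (dt 2 \<phi>) (ptensor H [1, x]) =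
      (\<Sum>y<N. \<Sum>z<N. tscale (\<phi> [y, z]) (ptensor H [e y, e z * x]))"
    using x_closed by (simp add: pure_dt_mult)
  also have "\<dots> = (\<Sum>y<N. \<Sum>z<N. tscale (\<phi> [y, Suc z mod N]) (ptensor H [e y, e (Suc z mod N) * x]))"
    by (intro sum.cong refl sum_shift_mod[symmetric]) (rule N_gt_0)
  finally show ?thesis
    using x_closed by (simp add: pure_dt_mult e_x)
qed

lemma K_Suc_left: "K (Suc z) y = K z y * K 1 y"
  using K_add_left[of z 1 y] by simp

text \<open>Splits the exponent into its two digits; \<open>K 1 w\<close> carries the upper
  one.\<close>

lemma q_residue: "q ^ w = K (Suc 0) w * q ^ (w mod n)"
  unfolding K_def by (simp add: power_add[symmetric])

text \<open>The root q^n has order dividing n, so its exponents matter modulo n only. This is what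
  makes the carry factors functions of residues.\<close>

lemma q_n_residue: "q ^ (z mod n * (n * c)) = q ^ (z * (n * c))"
proof -
  have "z mod n * n = (z * n) mod N"
    by (simp add: power2_eq_square mult_mod_left)
  then have "(z mod n * n * c) mod N = (z * n * c) mod N"
    by (simp add: mod_mult_left_eq)
  then show ?thesis by (intro q_cong) (simp add: mult.assoc)
qed

lemma carry_mod [simp]: "carry (y mod n) w = carry y w" "carry y (w mod n) = carry y w"
  by (simp_all add: carry_def)

lemma K_Suc_right: "K z (Suc y) = K z y * q ^ (z * (n * carry y 1))"
  using K_add_right[of z y 1] by simp

lemma twist_comult_x:
  "twist_comult H J x =
     tmul H 2 (ptensor H [x, 1]) (dt 2 (\<lambda>v. q ^ (v ! 1 mod n))) +
     tmul H 2 (ptensor H [1, x]) (dt 2 (\<lambda>v. inverse (q ^ (v ! 0 * (n * carry (v ! 1) 1)))))"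
proof -
  have x1: "ptensor H [x, 1] \<in> tpower H 2" and x2: "ptensor H [1, x] \<in> tpower H 2"
    using x_closed by (auto intro!: tpower_ptensor)
  have "ptensor H [x, g] = tmul H 2 (ptensor H [x, 1]) (ptensor H [1, g])"
    using x_closed g_closed by (simp add: tmul_ptensor)
  also have "ptensor H [1, g] = dt 2 (\<lambda>v. q ^ (v ! 1))"
    using ptensor_de_2[of "\<lambda>_. 1" "\<lambda>w. q ^ (1 * w)"] unfolding de_power de_one by simp
  finally have xg: "ptensor H [x, g] = tmul H 2 (ptensor H [x, 1]) (dt 2 (\<lambda>v. q ^ (v ! 1)))" .
  have "tmul H 2 (tmul H 2 J (ptensor H [x, g])) J' = tmul H 2 (ptensor H [x, 1])
      (dt 2 (\<lambda>v. inverse (K (Suc (v ! 0) mod N) (v ! 1)) * q ^ (v ! 1) * K (v ! 0) (v ! 1)))"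
    unfolding xg tinverse_J unfolding J_eq using x1
    by (simp add: tmul_assoc[symmetric] dt_x_1) (simp add: tmul_assoc dt_mult mult.assoc)
  also have "dt 2 (\<lambda>v. inverse (K (Suc (v ! 0) mod N) (v ! 1)) * q ^ (v ! 1) * K (v ! 0) (v ! 1)) =
      dt 2 (\<lambda>v. q ^ (v ! 1 mod n))"
  proof (rule diag_cong)
    fix v :: "nat list"
    have "inverse (K (Suc (v ! 0)) (v ! 1)) * (K (Suc 0) (v ! 1) * q ^ (v ! 1 mod n)) * K (v ! 0) (v ! 1)
        = q ^ (v ! 1 mod n)"
      by (subst K_Suc_left) (simp add: field_simps)
    then show "inverse (K (Suc (v ! 0) mod N) (v ! 1)) * q ^ (v ! 1) * K (v ! 0) (v ! 1) = q ^ (v ! 1 mod n)"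
      by (simp only: K_mod_left q_residue[symmetric])
  qed
  finally have 1: "tmul H 2 (tmul H 2 J (ptensor H [x, g])) J' =
      tmul H 2 (ptensor H [x, 1]) (dt 2 (\<lambda>v. q ^ (v ! 1 mod n)))" .
  have "tmul H 2 (tmul H 2 J (ptensor H [1, x])) J' = tmul H 2 (ptensor H [1, x])
      (dt 2 (\<lambda>v. inverse (K (v ! 0) (Suc (v ! 1) mod N)) * K (v ! 0) (v ! 1)))"
    unfolding tinverse_J unfolding J_eq using x2
    by (simp add: dt_1_x) (simp add: tmul_assoc dt_mult)
  also have "dt 2 (\<lambda>v. inverse (K (v ! 0) (Suc (v ! 1) mod N)) * K (v ! 0) (v ! 1)) =
      dt 2 (\<lambda>v. inverse (q ^ (v ! 0 * (n * carry (v ! 1) 1))))"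
    by (rule diag_cong) (simp add: K_Suc_right field_simps)
  finally have 2: "tmul H 2 (tmul H 2 J (ptensor H [1, x])) J' =
      tmul H 2 (ptensor H [1, x]) (dt 2 (\<lambda>v. inverse (q ^ (v ! 0 * (n * carry (v ! 1) 1)))))" .
  have lin: "tlin H 2 tscale (\<lambda>t. tmul H 2 (tmul H 2 J t) J')"
    by (intro tlin_comp[OF tlin_tmul_right _ tlin_tmul_left]) auto
  have "ptensor H [x, g] \<in> tpower H 2" using x_closed g_closed by (auto intro!: tpower_ptensor)
  then show ?thesis
    unfolding twist_comult_def comult_x using tlinD(1)[OF lin _ x2] 1 2 by simp
qed

text \<open>The elements with this property form a subalgebra, so \<open>g ^ n\<close> and x
  suffice. The same pattern, a set \<open>?B\<close> fed into \<open>A_minimal\<close>, recurs for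
  the antipode, the characters and the representations.\<close>

lemma comult_A_closed:
  assumes "h \<in> carr A"
  shows "twist_comult H J h \<in> tpower A 2"
proof -
  let ?B = "{h \<in> carr A. twist_comult H J h \<in> tpower A 2}"
  have sub: "h \<in> carr A \<Longrightarrow> h \<in> carr H" for h using carr_A_sub by auto
  have "subalgebra (scl H) ?B"
    unfolding subalgebra_def subspace_def
  proof (intro conjI ballI allI)
    show "0 \<in> ?B" using T.delta_scl[of 0 0] by simp
    show "1 \<in> ?B" using T.delta_one SA.B.tone_closed[of 2] by (simp add: SA.tone_eq)
    fix h h' assume "h \<in> ?B" "h' \<in> ?B"
    then show "h + h' \<in> ?B" "h * h' \<in> ?B"
      using T.delta_add[of h h'] T.delta_mult[of h h'] sub SA.tmul_sub[of "twist_comult H J h" 2 "twist_comult H J h'"]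
        SA.B.tmul_closed[of "twist_comult H J h" 2 "twist_comult H J h'"]
      by auto
  next
    fix c h assume "h \<in> ?B"
    then show "scl H c h \<in> ?B"
      using T.delta_scl[of h c] sub SA.B.carr_scl[of h c] by auto
  qed
  moreover have "g ^ n \<in> ?B"
  proof -
    have "comult H (g ^ n) = dt 2 (\<lambda>v. q ^ (n * v ! 0) * q ^ (n * v ! 1))"
      unfolding comult_g_power using ptensor_de_2[of "\<lambda>w. q ^ (n * w)" "\<lambda>w. q ^ (n * w)"]
      by (simp add: de_power)
    then have "twist_comult H J (g ^ n) = ptensor H [g ^ n, g ^ n]"
      using twist_comult_dt comult_g_power by metis
    then show ?thesis
      using SA.B.tpower_ptensor[of "[g ^ n, g ^ n]" 2] by (simp add: SA.ptensor_eq)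
  qed
  moreover have "x \<in> ?B"
  proof -
    have "dt 2 (\<lambda>v. q ^ (v ! 1 mod n)) \<in> tpower A 2"
      by (rule dt_in_A) (auto elim!: tuples_2E)
    moreover have "dt 2 (\<lambda>v. inverse (q ^ (v ! 0 * (n * carry (v ! 1) 1)))) \<in> tpower A 2"
      by (rule dt_in_A) (auto elim!: tuples_2E simp: q_n_residue)
    moreover have "ptensor H [x, 1] \<in> tpower A 2" "ptensor H [1, x] \<in> tpower A 2"
      using SA.B.tpower_ptensor[of "[x, 1]" 2] SA.B.tpower_ptensor[of "[1, x]" 2]
      by (simp_all add: SA.ptensor_eq)
    ultimately show ?thesis
      unfolding twist_comult_x
      using SA.tmul_sub[of _ 2] SA.B.tmul_closed[of _ 2] SA.B.tpower_add x_in_A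
      by (metis (no_types, lifting) mem_Collect_eq twist_comult_x zero_less_numeral)
  qed
  ultimately show ?thesis using A_minimal[of ?B] assms by auto
qed

lemma comult_algebra_A: "comult_algebra A"
proof -
  have sub: "h \<in> carr A \<Longrightarrow> h \<in> carr H" for h using carr_A_sub by auto
  show ?thesis
    using k_algebra_A T.delta_add T.delta_scl T.delta_mult T.delta_one sub comult_A_closed
    by (auto simp: comult_algebra_def comult_algebra_axioms_def SA.tone_eq SA.tmul_sub)
qed

lemma comult_at_A:
  assumes t: "t \<in> tpower A m" and i: "i < m"
  shows "comult_at A i m t = comult_at (twisted H J) i m t"
proof -
  interpret CA: comult_algebra A by (rule comult_algebra_A)
  have lin: "tlin A m tscale (comult_at (twisted H J) i m)"
    using T.tlin_comult_at[OF i] SA.tpower_sub by (auto simp: tlin_def)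
  show ?thesis
  proof (rule SA.B.tlin_eqI[OF t CA.tlin_comult_at[OF i] lin])
    fix v assume v: "v \<in> tuples (carr A) m"
    have vH: "v \<in> tuples (carr H) m" using v by (rule SA.tuples_sub)
    have vi: "v ! i \<in> carr A" using v i by (rule tuples_nth)
    have "comult_at A i m (ptensor A v) =
        tlift A 2 (\<lambda>d. ptensor H (take i v @ d @ drop (Suc i) v)) (twist_comult H J (v ! i))"
      using CA.comult_at_ptensor[OF v i] by (simp add: CA.insert_at_def SA.ptensor_eq)
    also have "\<dots> = tlift H 2 (\<lambda>d. ptensor H (take i v @ d @ drop (Suc i) v)) (twist_comult H J (v ! i))"
      by (rule SA.tlift_sub[OF mlin_insert_at[OF vH i] comult_A_closed[OF vi]])
    also have "\<dots> = comult_at (twisted H J) i m (ptensor H v)"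
      using T.comult_at_ptensor[OF _ i, of v] vH by (simp add: T.insert_at_def)
    finally show "comult_at A i m (ptensor A v) = comult_at (twisted H J) i m (ptensor A v)"
      by (simp add: SA.ptensor_eq)
  qed
qed

section \<open>The associator in diagonal coordinates\<close>

definition omega :: "nat list \<Rightarrow> 'k" where
  "omega v = K (v ! 0) (v ! 1) * K (v ! 0) (v ! 2) * inverse (K (v ! 0) (v ! 1 + v ! 2))"

lemma omega_nz: "omega v \<noteq> 0"
  by (simp add: omega_def)

lemma omega_eq: "omega v = inverse (q ^ (v ! 0 * (n * carry (v ! 1) (v ! 2))))"
  by (simp add: omega_def K_add_right field_simps)

text \<open>At (z, y, w) the four factors contribute the inverses of K(y, w) and K(z, y + w), then
  K(z + y, w) and K(z, y). Additivity in the first argument cancels K(y, w) and leaves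
  \<open>omega\<close>, exhibited as a coboundary over Z/N.\<close>

lemma assoc_eq: "twist_assoc H J = dt 3 omega"
proof -
  have "twist_assoc H J = dt 3 (\<lambda>v. inverse (K (v ! 1) (v ! 2)) *
     inverse (K (v ! 0) ((v ! 1 + v ! 2) mod N)) * K ((v ! 0 + v ! 1) mod N) (v ! 2) * K (v ! 0) (v ! 1))"
    unfolding twist_assoc_eq tinverse_J unfolding J_eq
    by (simp add: one_tensor_dt tensor_one_dt CI.comult_at_dt dt_mult)
       (auto intro!: diag_cong elim!: tuples_3E)
  also have "\<dots> = dt 3 omega"
    by (rule diag_cong) (simp add: omega_def K_add_left field_simps)
  finally show ?thesis .
qed

lemma assoc_in_A: "dt 3 omega \<in> tpower A 3" "dt 3 (\<lambda>v. inverse (omega v)) \<in> tpower A 3"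
  by (rule dt_in_A; auto elim!: tuples_3E simp: omega_eq q_n_residue)+

lemma assoc_inverse:
  "tmul A 3 (dt 3 omega) (dt 3 (\<lambda>v. inverse (omega v))) = tone A 3"
  "tmul A 3 (dt 3 (\<lambda>v. inverse (omega v))) (dt 3 omega) = tone A 3"
  "tinverse A 3 (dt 3 omega) = dt 3 (\<lambda>v. inverse (omega v))"
  "tinverse H 3 (dt 3 omega) = dt 3 (\<lambda>v. inverse (omega v))"
proof -
  note u = dt_unit[of 3 omega, OF _ omega_nz]
  show 1: "tmul A 3 (dt 3 omega) (dt 3 (\<lambda>v. inverse (omega v))) = tone A 3"
    and 2: "tmul A 3 (dt 3 (\<lambda>v. inverse (omega v))) (dt 3 omega) = tone A 3"
    using u assoc_in_A by (simp_all add: SA.tmul_sub SA.tone_eq)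
  show "tinverse A 3 (dt 3 omega) = dt 3 (\<lambda>v. inverse (omega v))"
    using 1 2 assoc_in_A by (intro SA.B.tinverse_eqI) auto
  show "tinverse H 3 (dt 3 omega) = dt 3 (\<lambda>v. inverse (omega v))"
    using u by (intro tinverse_eqI) auto
qed

section \<open>The twisted antipode on \<open>A(q)\<close>\<close>

lemma beta'_eq: "\<beta>J' = de (\<lambda>z. K z (neg z))"
  using de_unit[of "\<lambda>z. inverse (K z (neg z))"] unfolding twist_beta_J
  by (intro alg_inverse_eqI) auto

lemma antip_de: "antip H (de \<phi>) = de (\<lambda>z. \<phi> (neg z))"
proof -
  have sum: "antip H (\<Sum>z\<in>I. scl H (\<phi> z) (e z)) = (\<Sum>z\<in>I. scl H (\<phi> z) (antip H (e z)))"
    if "finite I" for I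
    using that antip_scl[of 0 0]
    by (induction I) (auto simp: antip_add antip_scl carr_sum)
  have "antip H (de \<phi>) = (\<Sum>z<N. scl H (\<phi> z) (e (neg z)))"
    unfolding de_def by (subst sum) (auto simp: antip_e)
  also have "\<dots> = de (\<lambda>z. \<phi> (neg z))"
    unfolding de_def
    by (rule sum.reindex_bij_witness[where i = neg and j = neg]) (auto simp: neg_neg)
  finally show ?thesis .
qed

text \<open>Diagonal elements commute, so conjugation by \<open>\<beta>\<^sub>J\<close> is invisible
  here.\<close>

lemma twist_antip_de: "twist_antip H J (de \<phi>) = de (\<lambda>z. \<phi> (neg z))"
  unfolding twist_antip_def beta'_eq
  unfolding twist_beta_J antip_de de_mult
  by (rule de_cong) simp

lemma twist_antip_e: "z < N \<Longrightarrow> twist_antip H J (e z) = e (neg z)"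
proof -
  assume z: "z < N"
  have 1: "e w = de (\<lambda>y. if y = w then 1 else 0)" if "w < N" for w
    using that by (simp add: de_def if_distrib[of "\<lambda>c. scl H c _"] cong: if_cong)
  have "twist_antip H J (e z) = de (\<lambda>y. if neg y = z then 1 else 0)"
    unfolding 1[OF z] twist_antip_de ..
  also have "\<dots> = e (neg z)"
  proof (subst 1[OF neg_less], rule de_cong)
    fix y assume y: "y < N"
    have "neg (neg y) = y" "neg (neg z) = z" using y z by (simp_all only: neg_neg)
    then have "neg y = z \<longleftrightarrow> y = neg z" by metis
    then show "(if neg y = z then 1 else 0) = (if y = neg z then 1 else (0::'k))" by simp
  qed
  finally show ?thesis .
qed

text \<open>The diagonal factor in the twisted antipode of x. For z < N the number
  \<open>N - 1 - z\<close> represents -(z + 1) without truncation; written with its carry and its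
  last digit, the value visibly depends on residues only.\<close>

definition psi :: "nat \<Rightarrow> 'k" where
  "psi z = q ^ (z * (n * carry (N - 1 - z) 1)) * q ^ ((N - 1 - z) mod n) * q"

lemma psi_residue: "z < N \<Longrightarrow> psi z = psi (z mod n)"
proof -
  assume z: "z < N"
  have "N - 1 - z mod n = (N - 1 - z) + (z div n) * n"
    using z div_mult_mod_eq[of z n] by linarith
  then have "(N - 1 - z mod n) mod n = (N - 1 - z) mod n" by simp
  then have "(N - 1 - z) mod n = (N - 1 - z mod n) mod n"
    "carry (N - 1 - z) 1 = carry (N - 1 - z mod n) 1"
    by (simp_all add: carry_def)
  then show ?thesis unfolding psi_def by (simp only: q_n_residue)
qed

lemma twist_antip_x: "twist_antip H J x = - (x * de psi)"
proof -
  define b where "b z = inverse (K z (neg z))" for z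
  have "twist_antip H J x = - (de b * x * g ^ (N - 1) * de (\<lambda>z. K z (neg z)))"
    unfolding twist_antip_def beta'_eq
    unfolding twist_beta_J antip_x alg_inverse_g b_def by (simp add: mult.assoc)
  also have "\<dots> = - (x * (de (\<lambda>z. b (Suc z mod N)) * de (\<lambda>z. q ^ ((N - 1) * z)) * de (\<lambda>z. K z (neg z))))"
    by (simp only: de_x de_power mult.assoc)
  also have "de (\<lambda>z. b (Suc z mod N)) * de (\<lambda>z. q ^ ((N - 1) * z)) * de (\<lambda>z. K z (neg z)) = de psi"
    unfolding de_mult
  proof (rule de_cong)
    fix z assume z: "z < N"
    \<comment> \<open>Passing \<open>\<beta>\<^sub>J\<close> through x shifts its index to z + 1, so
      its second argument is -(z + 1), represented by \<open>w\<close>.\<close>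
    define w where "w = N - 1 - z"
    have w: "neg (Suc z mod N) = w"
      using z by (cases "Suc z = N") (auto simp: w_def neg_def)
    have w1: "neg z = Suc w mod N"
      using z by (simp add: w_def neg_def Suc_diff_Suc)
    \<comment> \<open>Both powers are inverse to \<open>q ^ z\<close>; the left one comes from
      \<open>g ^ (N - 1)\<close>, the inverse of g.\<close>
    have "q ^ ((N - 1) * z) = q ^ Suc w"
    proof -
      have "(N - 1) * z + z = N * z" "Suc w + z = N"
        using z by (auto simp: w_def algebra_simps diff_mult_distrib)
      then have "q ^ ((N - 1) * z) * q ^ z = 1" "q ^ Suc w * q ^ z = 1"
        unfolding power_add[symmetric] by (simp_all only: power_mult q_N power_one)
      then show ?thesis by (metis mult_right_cancel power_not_zero q_nz)
    qed
    then have "b (Suc z mod N) * q ^ ((N - 1) * z) * K z (neg z) =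
        inverse (K (Suc z) w) * (q ^ w * q) * K z (Suc w)"
      unfolding b_def w by (simp add: w1)
    \<comment> \<open>In \<open>K (Suc z) w = K z w * K 1 w\<close> the last factor strips the upper
      digit from \<open>q ^ w\<close>, and \<open>K z w\<close> against \<open>K z (Suc w)\<close>
      leaves the carry.\<close>
    also have "\<dots> = q ^ (z * (n * carry w 1)) * q ^ (w mod n) * q"
      unfolding K_Suc_left K_Suc_right by (subst q_residue[of w]) (simp add: field_simps)
    finally show "b (Suc z mod N) * q ^ ((N - 1) * z) * K z (neg z) = psi z"
      by (simp add: psi_def w_def)
  qed
  finally show ?thesis .
qed

lemma neg_mod: "z < N \<Longrightarrow> neg z mod n = neg (z mod n) mod n"
proof -
  assume z: "z < N"
  have 1: "neg y mod n = (N - y) mod n" for y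
    by (simp add: neg_def power2_eq_square mod_mod_cancel)
  have "N - z mod n = (N - z) + (z div n) * n"
    using z div_mult_mod_eq[of z n] by linarith
  then show ?thesis by (simp add: 1)
qed

lemma twist_antip_A_closed:
  assumes "h \<in> carr A"
  shows "twist_antip H J h \<in> carr A"
proof -
  let ?B = "{h \<in> carr A. twist_antip H J h \<in> carr A}"
  have sub: "h \<in> carr A \<Longrightarrow> h \<in> carr H" for h using carr_A_sub by auto
  have "subalgebra (scl H) ?B"
    unfolding subalgebra_def subspace_def
    using twist_antip_simps(2)[of 0 0] SA.B.carr_add SA.B.carr_mult SA.B.carr_scl SA.B.carr_0 SA.B.carr_1
    by (auto simp: twist_antip_simps sub)
  moreover have "g ^ n \<in> ?B"
  proof -
    have "twist_antip H J (g ^ n) = de (\<lambda>z. q ^ (n * neg z))"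
      unfolding de_power[symmetric] twist_antip_de ..
    also have "\<dots> \<in> carr A"
    proof (rule de_in_A)
      fix z assume z: "z < N"
      have "q ^ (neg z mod n * (n * 1)) = q ^ (neg (z mod n) mod n * (n * 1))"
        by (simp only: neg_mod[OF z])
      then show "q ^ (n * neg z) = q ^ (n * neg (z mod n))"
        unfolding q_n_residue by (simp add: mult.commute)
    qed
    finally show ?thesis by simp
  qed
  moreover have "x \<in> ?B"
    unfolding mem_Collect_eq twist_antip_x
    using SA.B.carr_uminus[OF SA.B.carr_mult[OF x_in_A de_in_A[of psi]]] psi_residue by auto
  ultimately show ?thesis using A_minimal[of ?B] assms by auto
qed

text \<open>Injectivity restricts from \<open>H\<close>, but surjectivity onto the smaller carrier
  does not. The map is an antihomomorphism, so its image is a subalgebra and preimages of the two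
  generators suffice.\<close>

lemma twist_antip_A_surj: "carr A \<subseteq> twist_antip H J ` carr A"
proof -
  let ?B = "twist_antip H J ` carr A"
  have sub: "h \<in> carr A \<Longrightarrow> h \<in> carr H" for h using carr_A_sub by auto
  have "subalgebra (scl H) ?B"
    unfolding subalgebra_def subspace_def
  proof (intro conjI ballI allI)
    show "0 \<in> ?B" using twist_antip_simps(2)[of 0 0] SA.B.carr_0 by (auto simp: image_iff intro!: bexI[of _ 0])
    show "1 \<in> ?B" using twist_antip_simps(4) SA.B.carr_1 by (auto simp: image_iff intro!: bexI[of _ 1])
    fix u v assume "u \<in> ?B" "v \<in> ?B"
    then obtain h h' where h: "h \<in> carr A" "h' \<in> carr A" "u = twist_antip H J h" "v = twist_antip H J h'"
      by auto
    then show "u + v \<in> ?B" "u * v \<in> ?B"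
      using twist_antip_simps(1)[of h h'] twist_antip_simps(3)[of h' h] sub
        SA.B.carr_add[of h h'] SA.B.carr_mult[of h' h]
      by (auto simp: image_iff intro: bexI[of _ "h + h'"] bexI[of _ "h' * h"])
  next
    fix c u assume "u \<in> ?B"
    then show "scl H c u \<in> ?B"
      using twist_antip_simps(2) sub SA.B.carr_scl by (auto simp: image_iff) (metis A_simps(1))
  qed
  moreover have "g ^ n \<in> ?B"
  proof
    have "de (\<lambda>z. q ^ (n * z)) = de (\<lambda>z. q ^ (n * neg (neg z)))"
      by (rule de_cong) (simp add: neg_neg)
    then show "g ^ n = twist_antip H J (de (\<lambda>z. q ^ (n * neg z)))"
      by (simp add: twist_antip_de de_power)
    show "de (\<lambda>z. q ^ (n * neg z)) \<in> carr A"
      using twist_antip_A_closed[of "g ^ n"] twist_antip_de[of "\<lambda>z. q ^ (n * z)"] by (simp add: de_power)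
  qed
  moreover have "x \<in> ?B"
  proof
    \<comment> \<open>Chosen so that its antipode is the inverse of \<open>de psi\<close>: the
      antipode of \<open>?d * x\<close> is then -(x), and a sign gives the preimage of x.\<close>
    let ?d = "de (\<lambda>z. inverse (psi (neg z)))"
    have psi_nz: "psi z \<noteq> 0" for z by (simp add: psi_def)
    have "de (\<lambda>z. psi (neg z)) \<in> carr A"
      using twist_antip_A_closed[OF de_in_A[of psi]] psi_residue by (simp add: twist_antip_de)
    have d: "?d \<in> carr A"
    proof (rule de_in_A)
      fix z assume z: "z < N"
      have "neg (z mod n) < N" by simp
      then have "psi (neg z) = psi (neg (z mod n))"
        using psi_residue[of "neg z"] psi_residue[of "neg (z mod n)"] neg_mod[OF z] by simp
      then show "inverse (psi (neg z)) = inverse (psi (neg (z mod n)))" by simp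
    qed
    then show "- (?d * x) \<in> carr A"
      using SA.B.carr_uminus SA.B.carr_mult by simp
    have "twist_antip H J (- (?d * x)) = scl H (- 1) (twist_antip H J (?d * x))"
      using twist_antip_simps(2)[of "?d * x" "- 1"] x_closed by simp
    also have "twist_antip H J (?d * x) = - (x * (de psi * twist_antip H J ?d))"
      using x_closed by (simp add: twist_antip_simps twist_antip_x mult.assoc)
    also have "de psi * twist_antip H J ?d = 1"
      unfolding twist_antip_de de_mult de_one[symmetric]
      by (rule de_cong) (simp add: neg_neg psi_nz)
    finally show "x = twist_antip H J (- (?d * x))" by simp
  qed
  ultimately show ?thesis using A_minimal[of ?B] by auto
qed

end

context k_algebra
begin

lemma ptensor_pair:
  assumes "a \<in> carr A" "a' \<in> carr A" "b \<in> carr A"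
  shows "ptensor A [a + a', b] = ptensor A [a, b] + ptensor A [a', b]"
    "ptensor A [b, a + a'] = ptensor A [b, a] + ptensor A [b, a']"
    "ptensor A [scl A c a, b] = tscale c (ptensor A [a, b])"
    "ptensor A [b, scl A c a] = tscale c (ptensor A [b, a])"
  using mlinD(2)[OF mlin_ptensor[of 2], of "[a, b]" 0 a a'] mlinD(2)[OF mlin_ptensor[of 2], of "[b, a]" 1 a a']
    mlinD(3)[OF mlin_ptensor[of 2], of "[a, b]" 0 a c] mlinD(3)[OF mlin_ptensor[of 2], of "[b, a]" 1 a c] assms
  by simp_all

end

lemma tuples_4E:
  assumes "v \<in> tuples Z 4"
  obtains a b c d where "v = [a, b, c, d]" "a \<in> Z" "b \<in> Z" "c \<in> Z" "d \<in> Z"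
  using assms by (auto simp: tuples_def length_Suc_conv eval_nat_numeral)

context taft_root
begin

section \<open>The axioms involving only the associator\<close>

lemma K_mod_sum [simp]: "K z (y + w mod N) = K z (y + w)" "K z (y mod N + w) = K z (y + w)"
  using K_mod_right[of z "y + w mod N"] K_mod_right[of z "y mod N + w"] K_mod_right[of z "y + w"]
  by (simp_all only: mod_add_left_eq mod_add_right_eq)

lemma K_neg_sum [simp]: "z < N \<Longrightarrow> K w (z + neg z) = 1" "z < N \<Longrightarrow> K w (neg z + z) = 1"
  by (simp_all add: neg_def)

text \<open>With \<open>omega\<close> written through \<open>K\<close>, multiplicativity of
  \<open>K\<close> in its first argument turns the cocycle identity into a cancellation.\<close>

lemma omega_cocycle:
  "omega [i, j, (k + l) mod N] * omega [(i + j) mod N, k, l] =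
    omega [j, k, l] * omega [i, (j + k) mod N, l] * omega [i, j, k]"
  by (simp add: omega_def K_add_left field_simps)

lemma pentagon_A:
  "tmul A 4 (comult_at A 2 3 (dt 3 omega)) (comult_at A 0 3 (dt 3 omega)) =
    tmul A 4 (tmul A 4 (one_tensor A 3 (dt 3 omega)) (comult_at A 1 3 (dt 3 omega)))
      (tensor_one A 3 (dt 3 omega))"
proof -
  interpret CA: comult_algebra A by (rule comult_algebra_A)
  have D: "comult_at A i 3 (dt 3 omega) =
      dt 4 (\<lambda>ws. omega (take i ws @ ((ws ! i + ws ! Suc i) mod N) # drop (Suc (Suc i)) ws))"
    "comult_at A i 3 (dt 3 omega) \<in> tpower A 4" if "i < 3" for i
    using comult_at_A[OF assoc_in_A(1) that] comult_at_twisted_dt[OF that, of omega]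
      CA.comult_at_closed[OF assoc_in_A(1) that] by simp_all
  have O: "one_tensor A 3 (dt 3 omega) = dt 4 (\<lambda>ws. omega (tl ws))"
    "one_tensor A 3 (dt 3 omega) \<in> tpower A 4"
    "tensor_one A 3 (dt 3 omega) = dt 4 (\<lambda>ws. omega (butlast ws))"
    "tensor_one A 3 (dt 3 omega) \<in> tpower A 4"
    using SA.one_tensor_sub[OF assoc_in_A(1)] one_tensor_dt[of 3 omega] SA.B.one_tensor_closed[OF assoc_in_A(1)]
      SA.tensor_one_sub[OF assoc_in_A(1)] tensor_one_dt[of 3 omega] SA.B.tensor_one_closed[OF assoc_in_A(1)]
    by simp_all
  have "tmul A 4 (comult_at A 2 3 (dt 3 omega)) (comult_at A 0 3 (dt 3 omega)) =
      tmul H 4 (comult_at A 2 3 (dt 3 omega)) (comult_at A 0 3 (dt 3 omega))"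
    by (rule SA.tmul_sub) (simp_all add: D(2))
  also have "\<dots> = dt 4 (\<lambda>v. omega [v ! 0, v ! 1, (v ! 2 + v ! 3) mod N] * omega [(v ! 0 + v ! 1) mod N, v ! 2, v ! 3])"
    by (simp add: D(1) dt_mult) (auto intro!: diag_cong elim!: tuples_4E)
  also have "\<dots> = dt 4 (\<lambda>v. omega [v ! 1, v ! 2, v ! 3] * omega [v ! 0, (v ! 1 + v ! 2) mod N, v ! 3]
      * omega [v ! 0, v ! 1, v ! 2])"
    by (simp only: omega_cocycle)
  also have "\<dots> = tmul H 4 (tmul H 4 (one_tensor A 3 (dt 3 omega)) (comult_at A 1 3 (dt 3 omega)))
      (tensor_one A 3 (dt 3 omega))"
    by (simp add: D(1) O(1,3) dt_mult) (auto intro!: diag_cong elim!: tuples_4E)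
  also have "\<dots> = tmul A 4 (tmul A 4 (one_tensor A 3 (dt 3 omega)) (comult_at A 1 3 (dt 3 omega)))
      (tensor_one A 3 (dt 3 omega))"
    using SA.tmul_sub[OF O(2) D(2)[of 1]] SA.B.tmul_closed[OF O(2) D(2)[of 1]]
    by (simp add: SA.tmul_sub[OF _ O(4)])
  finally show ?thesis .
qed

lemma assoc_counit_A:
  "tlift3 A (\<lambda>x y z. ptensor A [scl A (counit A y) x, z]) (dt 3 omega) = tone A 2"
proof -
  have ml: "mlin H tscale 3 (\<lambda>v. ptensor H [scl H (counit H (v ! 1)) (v ! 0), v ! 2])"
    by (rule mlin_3I[OF vector_space_tscale])
       (simp_all add: counit_add counit_scl ptensor_pair scale_right_distrib scale_left_distrib
          tvs.scale_left_distrib tvs.scale_right_distrib mult.commute)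
  have 0: "ptensor H [0, e c] = 0" for c
    using ptensor_pair(3)[of 0 0 "e c" 0] by simp
  have "tlift3 A (\<lambda>x y z. ptensor A [scl A (counit A y) x, z]) (dt 3 omega) =
      tlift3 H (\<lambda>x y z. ptensor H [scl H (counit H y) x, z]) (dt 3 omega)"
    using SA.tlift_sub[OF ml assoc_in_A(1)] by (simp add: SA.ptensor_eq)
  also have "\<dots> = (\<Sum>a<N. \<Sum>b<N. \<Sum>c<N. if b = 0 then ptensor H [e a, e c] else 0)"
    unfolding tlift_dt[OF ml zero_less_numeral] sum_tuples_3
    by (intro sum.cong refl) (auto simp: counit_e 0 omega_def)
  also have "\<dots> = (\<Sum>a<N. \<Sum>b<N. if b = 0 then (\<Sum>c<N. ptensor H [e a, e c]) else 0)"
    by (intro sum.cong refl) auto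
  also have "\<dots> = dt 2 (\<lambda>_. 1)"
    using N_gt_0 by (simp add: dt_2)
  finally show ?thesis by (simp add: dt_one SA.tone_eq)
qed

lemma g_n_e: "g ^ n * e z = scl H (q ^ (z * n)) (e z)"
  by (rule g_power_e)

text \<open>Only indices (a, -a, a) contribute. There \<open>omega\<close> equals
  \<open>K a a * K a (neg a)\<close>, which is exactly inverse to the eigenvalue of
  \<open>g ^ n\<close> on \<open>e a\<close>.\<close>

lemma assoc_antip_A:
  "tlift3 A (\<lambda>x y z. x * bet A * antip A y * alph A * z) (dt 3 omega) = 1"
proof -
  have ml: "mlin H (scl H) 3 (\<lambda>v. (v ! 0) * 1 * twist_antip H J (v ! 1) * g ^ n * (v ! 2))"
    by (rule mlin_3I[OF vector_space_scl]) (simp_all add: twist_antip_simps algebra_simps)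
  have e: "e a * 1 * twist_antip H J (e b) * g ^ n * e c =
      (if c = a then if b = neg a then scl H (q ^ (a * n)) (e a) else 0 else 0)"
    if abc: "a < N" "b < N" "c < N" for a b c
  proof -
    have "e a * 1 * twist_antip H J (e b) * g ^ n * e c = e a * e (neg b) * (g ^ n * e c)"
      using abc by (simp add: twist_antip_e mult.assoc)
    moreover have "e a * e (neg b) = (if b = neg a then e a else 0)"
      using abc by (intro e_mult_e_neg)
    moreover have "e a * (g ^ n * e c) = (if c = a then scl H (q ^ (a * n)) (e a) else 0)"
      using abc by (auto simp: g_n_e e_mult)
    ultimately show ?thesis by (cases "b = neg a") simp_all
  qed
  have "tlift3 A (\<lambda>x y z. x * bet A * antip A y * alph A * z) (dt 3 omega) =
      tlift3 H (\<lambda>x y z. x * 1 * twist_antip H J y * g ^ n * z) (dt 3 omega)"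
    using SA.tlift_sub[OF ml assoc_in_A(1)] by simp
  also have "\<dots> = (\<Sum>a<N. \<Sum>b<N. \<Sum>c<N. if c = a then if b = neg a
      then scl H (omega [a, neg a, a] * q ^ (a * n)) (e a) else 0 else 0)"
    unfolding tlift_dt[OF ml zero_less_numeral] sum_tuples_3
    by (intro sum.cong refl) (auto simp: e simp del: mult_1_right)
  also have "\<dots> = (\<Sum>a<N. scl H (omega [a, neg a, a] * q ^ (a * n)) (e a))"
    by simp
  also have "\<dots> = (\<Sum>a<N. e a)"
  proof (intro sum.cong refl)
    fix a assume "a \<in> {..<N}"
    then have a: "a < N" by simp
    have "omega [a, neg a, a] = K a a * K a (neg a)"
      using a by (simp add: omega_def)
    then show "scl H (omega [a, neg a, a] * q ^ (a * n)) (e a) = e a"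
      using K_self_neg[OF a] by simp
  qed
  finally show ?thesis by (simp add: e_sum)
qed

text \<open>Now the indices are (-b, b, -b), and negating the first argument of \<open>K\<close>
  makes the inverse of \<open>omega\<close> the same product
  \<open>K b b * K b (neg b)\<close>.\<close>

lemma assoc_inverse_antip_A:
  "tlift3 A (\<lambda>x y z. antip A x * alph A * y * bet A * antip A z) (tinverse A 3 (dt 3 omega)) = 1"
proof -
  have ml: "mlin H (scl H) 3 (\<lambda>v. twist_antip H J (v ! 0) * g ^ n * (v ! 1) * 1 * twist_antip H J (v ! 2))"
    by (rule mlin_3I[OF vector_space_scl]) (simp_all add: twist_antip_simps algebra_simps)
  have e: "twist_antip H J (e a) * g ^ n * e b * 1 * twist_antip H J (e c) =
      (if c = neg b then if a = neg b then scl H (q ^ (b * n)) (e b) else 0 else 0)"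
    if abc: "a < N" "b < N" "c < N" for a b c
  proof -
    have "twist_antip H J (e a) * g ^ n * e b * 1 * twist_antip H J (e c) = e (neg a) * (g ^ n * e b) * e (neg c)"
      using abc by (simp add: twist_antip_e mult.assoc)
    then show ?thesis
      using abc by (auto simp: g_n_e e_mult_e_neg e_neg_mult_e)
  qed
  have "tlift3 A (\<lambda>x y z. antip A x * alph A * y * bet A * antip A z) (tinverse A 3 (dt 3 omega)) =
      tlift3 H (\<lambda>x y z. twist_antip H J x * g ^ n * y * 1 * twist_antip H J z) (dt 3 (\<lambda>v. inverse (omega v)))"
    using SA.tlift_sub[OF ml assoc_in_A(2)] by (simp add: assoc_inverse)
  also have "\<dots> = (\<Sum>a<N. \<Sum>b<N. \<Sum>c<N. if c = neg b then if a = neg b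
      then scl H (inverse (omega [neg b, b, neg b]) * q ^ (b * n)) (e b) else 0 else 0)"
    unfolding tlift_dt[OF ml zero_less_numeral] sum_tuples_3
    by (intro sum.cong refl) (auto simp: e simp del: mult_1_right)
  also have "\<dots> = (\<Sum>b<N. \<Sum>a<N. if a = neg b
      then scl H (inverse (omega [neg b, b, neg b]) * q ^ (b * n)) (e b) else 0)"
    by (subst sum.swap) simp
  also have "\<dots> = (\<Sum>b<N. scl H (inverse (omega [neg b, b, neg b]) * q ^ (b * n)) (e b))"
    by simp
  also have "\<dots> = (\<Sum>b<N. e b)"
  proof (intro sum.cong refl)
    fix b assume "b \<in> {..<N}"
    then have b: "b < N" by simp
    have "inverse (omega [neg b, b, neg b]) = K b b * K b (neg b)"
      using b by (simp add: omega_def K_neg_left)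
    then show "scl H (inverse (omega [neg b, b, neg b]) * q ^ (b * n)) (e b) = e b"
      using K_self_neg[OF b] by simp
  qed
  finally show ?thesis by (simp add: e_sum)
qed

text \<open>For an axiom with a variable h the legs of the coproduct lie in \<open>A(q)\<close>, so
  \<open>tlift_sub\<close> replaces lifts over \<open>A(q)\<close> by lifts over \<open>H\<close>
  and the axiom of the twist of \<open>H\<close> applies; \<open>beta_alpha_J\<close> identifies its
  \<open>\<alpha>\<close> with \<open>g ^ n\<close>.\<close>

lemma quasi_hopf_A: "quasi_hopf_algebra A"
proof -
  interpret CA: comult_algebra A by (rule comult_algebra_A)
  have sub: "h \<in> carr A \<Longrightarrow> h \<in> carr H" for h using carr_A_sub by auto
  have ml_left: "mlin H (scl H) 2 (\<lambda>v. twist_antip H J (v ! 0) * g ^ n * (v ! 1))"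
    and ml_right: "mlin H (scl H) 2 (\<lambda>v. (v ! 0) * 1 * twist_antip H J (v ! 1))"
    by (rule mlin_2I; simp add: vector_space_scl twist_antip_simps algebra_simps)+
  show ?thesis
  proof (rule quasi_hopf_algebra.intro[OF k_algebra_A], rule quasi_hopf_algebra_axioms.intro)
    fix h h' c
    assume h: "h \<in> carr A"
    have hH: "h \<in> carr H" using h by (rule sub)
    have cl: "twist_comult H J h \<in> tpower A 2" using h by (rule comult_A_closed)
    show "comult A h \<in> tpower A 2" using cl by simp
    show "comult A (scl A c h) = tscale c (comult A h)" using CA.delta_scl[OF h] .
    show "counit A (scl A c h) = c * counit A h" using hH by (simp add: counit_scl)
    show "tlift2 A (\<lambda>a b. scl A (counit A a) b) (comult A h) = h"
      using SA.tlift_sub[OF mlin_counit_left cl] twisted_counit(1)[OF hH] by simp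
    show "tlift2 A (\<lambda>a b. scl A (counit A b) a) (comult A h) = h"
      using SA.tlift_sub[OF mlin_counit_right cl] twisted_counit(2)[OF hH] by simp
    show "comult_at A 1 2 (comult A h) =
        tmul A 3 (tmul A 3 (assoc A) (comult_at A 0 2 (comult A h))) (tinverse A 3 (assoc A))"
    proof -
      have c: "comult_at A i 2 (twist_comult H J h) = comult_at (twisted H J) i 2 (twist_comult H J h)"
        "comult_at A i 2 (twist_comult H J h) \<in> tpower A 3" if "i < 2" for i
        using comult_at_A[OF cl that] CA.comult_at_closed[OF cl that] by simp_all
      have "tmul A 3 (tmul A 3 (dt 3 omega) (comult_at A 0 2 (twist_comult H J h))) (dt 3 (\<lambda>v. inverse (omega v)))
        = tmul H 3 (tmul H 3 (dt 3 omega) (comult_at (twisted H J) 0 2 (twist_comult H J h))) (dt 3 (\<lambda>v. inverse (omega v)))"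
        using SA.tmul_sub[OF assoc_in_A(1) c(2)[of 0]] SA.B.tmul_closed[OF assoc_in_A(1) c(2)[of 0]] c(1)[of 0]
        by (simp add: SA.tmul_sub[OF _ assoc_in_A(2)])
      also have "\<dots> = comult_at (twisted H J) 1 2 (twist_comult H J h)"
        using twisted_quasi_coassoc[OF hH] by (simp add: assoc_eq assoc_inverse)
      finally show ?thesis
        using c(1)[of 1] by (simp add: assoc_eq assoc_inverse)
    qed
    show "antip A (scl A c h) = scl A c (antip A h)" using hH by (simp add: twist_antip_simps)
    show "tlift2 A (\<lambda>a b. antip A a * alph A * b) (comult A h) = scl A (counit A h) (alph A)"
      using SA.tlift_sub[OF ml_left cl] twisted_antip_alph[OF hH] by (simp add: beta_alpha_J)
    show "tlift2 A (\<lambda>a b. a * bet A * antip A b) (comult A h) = scl A (counit A h) (bet A)"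
      using SA.tlift_sub[OF ml_right cl] twisted_antip_bet[OF hH] by simp
    assume h': "h' \<in> carr A"
    have h'H: "h' \<in> carr H" using h' by (rule sub)
    show "comult A (h + h') = comult A h + comult A h'" using CA.delta_add[OF h h'] .
    show "comult A (h * h') = tmul A 2 (comult A h) (comult A h')" using CA.delta_mult[OF h h'] .
    show "counit A (h + h') = counit A h + counit A h'" "counit A (h * h') = counit A h * counit A h'"
      using hH h'H by (simp_all add: counit_add counit_mult)
    show "antip A (h + h') = antip A h + antip A h'" "antip A (h * h') = antip A h' * antip A h"
      using hH h'H by (simp_all add: twist_antip_simps)
  next
    show "comult A 1 = tone A 2" by (rule CA.delta_one)
    show "counit A 1 = 1" by (simp add: counit_one)
    show "tinvertible A 3 (assoc A)"
      unfolding tinvertible_def using assoc_in_A assoc_inverse by (auto simp: assoc_eq)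
    show "tmul A 4 (comult_at A 2 3 (assoc A)) (comult_at A 0 3 (assoc A)) =
        tmul A 4 (tmul A 4 (one_tensor A 3 (assoc A)) (comult_at A 1 3 (assoc A))) (tensor_one A 3 (assoc A))"
      using pentagon_A by (simp add: assoc_eq)
    show "tlift3 A (\<lambda>x y z. ptensor A [scl A (counit A y) x, z]) (assoc A) = tone A 2"
      using assoc_counit_A by (simp add: assoc_eq)
    show "bij_betw (antip A) (carr A) (carr A)"
      unfolding bij_betw_def using inj_on_subset[OF inj_on_twist_antip carr_A_sub]
        twist_antip_A_surj twist_antip_A_closed by auto
    show "antip A 1 = 1" by (simp add: twist_antip_simps)
    show "alph A \<in> carr A" "bet A \<in> carr A" using SA.B.carr_1 by simp_all
    show "tlift3 A (\<lambda>x y z. x * bet A * antip A y * alph A * z) (assoc A) = 1"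
      using assoc_antip_A by (simp add: assoc_eq)
    show "tlift3 A (\<lambda>x y z. antip A x * alph A * y * bet A * antip A z) (tinverse A 3 (assoc A)) = 1"
      using assoc_inverse_antip_A by (simp add: assoc_eq)
  qed
qed

section \<open>Dimension and irreducible representations\<close>

lemma dim_A: "alg_dim A = n ^ 3"
proof -
  let ?f = "\<lambda>(i, j). (g ^ n) ^ i * x ^ j" and ?h = "\<lambda>(i, j). (n * i, j)"
  let ?I = "{..<n} \<times> {..<N}"
  have sub: "?h ` ?I \<subseteq> {..<N} \<times> {..<N}"
    using n2 by (auto simp: power2_eq_square)
  \<comment> \<open>The spanning monomials of \<open>A(q)\<close> are the basis monomials of
    \<open>H\<close> whose exponent of g is divisible by n, so independence is inherited.\<close>
  have f: "?f = (\<lambda>(i, j). g ^ i * x ^ j) \<circ> ?h"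
    by (auto simp: fun_eq_iff power_mult)
  have "inj_on ?h ?I" using n2 by (auto simp: inj_on_def)
  then have inj: "inj_on ?f ?I"
    unfolding f by (rule comp_inj_on) (rule inj_on_subset[OF monomials_independent(2) sub])
  have "?f ` ?I \<subseteq> taft_basis"
    unfolding f image_comp[symmetric] using sub by (rule image_mono)
  then have "independent (?f ` ?I)" using monomials_independent(1) independent_mono by blast
  then have "dim (carr A) = card (?f ` ?I)"
    unfolding carr_A_span by (rule dim_span_eq_card_independent)
  also have "\<dots> = card ?I" using inj by (rule card_image)
  also have "\<dots> = n ^ 3" by (simp add: power2_eq_square power3_eq_cube)
  finally show ?thesis by (simp add: alg_dim_def)
qed

lemma finite_dimensional_A: "finite_dimensional A"
  unfolding finite_dimensional_def
  by (intro exI[of _ "(\<lambda>(i, j). (g ^ n) ^ i * x ^ j) ` ({..<n} \<times> {..<N})"]) (simp add: carr_A_span)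

lemma g_n_res: "r < n \<Longrightarrow> g ^ n * de (res r) = scl H (q ^ (n * r)) (de (res r))"
proof -
  assume r: "r < n"
  have "g ^ n * de (res r) = de (\<lambda>z. q ^ (n * z) * res r z)"
    unfolding de_power[symmetric] de_mult ..
  also have "\<dots> = de (\<lambda>z. q ^ (n * r) * res r z)"
  proof (rule de_cong)
    fix z
    have "q ^ (n * z) = q ^ (n * r)" if "z mod n = r"
      using q_n_residue[of z 1] that by (simp add: mult.commute)
    then show "q ^ (n * z) * res r z = q ^ (n * r) * res r z" by (simp add: res_def)
  qed
  also have "\<dots> = scl H (q ^ (n * r)) (de (res r))"
    by (simp add: de_def scale_sum_right)
  finally show ?thesis .
qed

lemma sum_de_res: "(\<Sum>r<n. de (res r)) = 1"
  using de_sum[of "\<lambda>_. 1" res "{..<n}"] sum_res[of "\<lambda>_. 1"] by (simp add: de_one)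

text \<open>
  On an irreducible representation the kernel of the nilpotent element \<open>x\<close> is an invariant
  subspace, so \<open>x\<close> acts by zero, and an eigenvector of \<open>g\<^sup>n\<close> spans the representation.
\<close>

lemma basic_A: "basic_algebra TYPE('v::ab_group_add) A"
  unfolding basic_algebra_def
proof (intro conjI allI impI finite_dimensional_A)
  fix sV :: "'k \<Rightarrow> 'v \<Rightarrow> 'v" and W \<rho>
  assume irr: "irreducible_representation A sV W \<rho>"
  then have rep: "Defs.representation A sV W \<rho>" and W0: "W \<noteq> {0}"
    and min: "\<And>U. module.subspace sV U \<Longrightarrow> U \<subseteq> W \<Longrightarrow> (\<And>a v. a \<in> carr A \<Longrightarrow> v \<in> U \<Longrightarrow> \<rho> a v \<in> U)
        \<Longrightarrow> U = {0} \<or> U = W"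
    by (auto simp: irreducible_representation_def)
  interpret V: vector_space sV using rep by (simp add: Defs.representation_def)
  have subW: "V.subspace W" using rep by (simp add: Defs.representation_def)
  have W [simp]: "0 \<in> W" "\<And>v w. v \<in> W \<Longrightarrow> w \<in> W \<Longrightarrow> v + w \<in> W" "\<And>c v. v \<in> W \<Longrightarrow> sV c v \<in> W"
    using subW by (auto simp: V.subspace_def)
  have \<rho> [simp]: "a \<in> carr A \<Longrightarrow> v \<in> W \<Longrightarrow> \<rho> a v \<in> W"
    "a \<in> carr A \<Longrightarrow> v \<in> W \<Longrightarrow> w \<in> W \<Longrightarrow> \<rho> a (v + w) = \<rho> a v + \<rho> a w"
    "a \<in> carr A \<Longrightarrow> v \<in> W \<Longrightarrow> \<rho> a (sV c v) = sV c (\<rho> a v)"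
    "a \<in> carr A \<Longrightarrow> b \<in> carr A \<Longrightarrow> v \<in> W \<Longrightarrow> \<rho> (a + b) v = \<rho> a v + \<rho> b v"
    "a \<in> carr A \<Longrightarrow> v \<in> W \<Longrightarrow> \<rho> (scl H c a) v = sV c (\<rho> a v)"
    "a \<in> carr A \<Longrightarrow> b \<in> carr A \<Longrightarrow> v \<in> W \<Longrightarrow> \<rho> (a * b) v = \<rho> a (\<rho> b v)"
    "v \<in> W \<Longrightarrow> \<rho> 1 v = v" for a b c v w
    using rep by (simp_all add: Defs.representation_def)
  note A [simp] = SA.B.carr_add SA.B.carr_mult SA.B.carr_scl[simplified] SA.B.carr_0 SA.B.carr_1 SA.B.carr_power
  have \<rho>0: "\<rho> 0 v = 0" if "v \<in> W" for v using \<rho>(5)[of 0 v 0] that by simp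
  have \<rho>v0: "\<rho> a 0 = 0" if "a \<in> carr A" for a using \<rho>(3)[of a 0 0] that by simp
  define U where "U = {v \<in> W. \<rho> x v = 0}"
  have U0: "U \<noteq> {0}"
  proof -
    obtain w where w: "w \<in> W" "w \<noteq> 0" using W0 W(1) by blast
    \<comment> \<open>The last nonzero vector among w, x w, x^2 w, ... is killed by x.\<close>
    define k where "k = (LEAST k. \<rho> (x ^ k) w = 0)"
    have "\<rho> (x ^ N) w = 0" using w by (simp add: x_power \<rho>0)
    then have k: "\<rho> (x ^ k) w = 0" unfolding k_def by (rule LeastI)
    then have "k \<noteq> 0" using w by (metis \<rho>(7) power_0)
    then obtain l where l: "k = Suc l" by (cases k) auto
    have "\<rho> (x ^ l) w \<noteq> 0" using not_less_Least[of l "\<lambda>k. \<rho> (x ^ k) w = 0"] l k_def by auto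
    moreover have "\<rho> x (\<rho> (x ^ l) w) = 0" using k w by (simp add: l)
    then have "\<rho> (x ^ l) w \<in> U" using w by (simp add: U_def)
    ultimately show ?thesis by (metis singletonD)
  qed
  \<comment> \<open>Skew commutation keeps the kernel of x stable under
    \<open>g ^ n\<close>.\<close>
  have xg: "x * g ^ n = scl H (inverse q ^ n) (g ^ n * x)"
    using skew_power(2)[OF g_x q_nz, of 1 n] by simp
  have "U = {0} \<or> U = W"
  proof (rule min)
    show subU: "V.subspace U"
      unfolding V.subspace_def U_def by (auto simp: \<rho>v0)
    show UW: "U \<subseteq> W" by (auto simp: U_def)
    fix a v assume a: "a \<in> carr A" and v: "v \<in> U"
    let ?B = "{a \<in> carr A. \<forall>v\<in>U. \<rho> a v \<in> U}"
    have uW: "u \<in> U \<Longrightarrow> u \<in> W" for u using UW by auto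
    have "subalgebra (scl H) ?B"
      unfolding subalgebra_def subspace_def using subU
      by (auto simp: uW \<rho>0 V.subspace_def)
    moreover have "g ^ n \<in> ?B"
    proof -
      have "\<rho> x (\<rho> (g ^ n) v) = 0" if "v \<in> W" "\<rho> x v = 0" for v
      proof -
        have "\<rho> x (\<rho> (g ^ n) v) = \<rho> (x * g ^ n) v" using that by simp
        also have "\<dots> = sV (inverse q ^ n) (\<rho> (g ^ n) (\<rho> x v))" unfolding xg using that(1) by simp
        finally show ?thesis using that(2) by (simp add: \<rho>v0)
      qed
      then show ?thesis by (auto simp: U_def)
    qed
    moreover have "x \<in> ?B" by (auto simp: U_def \<rho>v0)
    ultimately show "\<rho> a v \<in> U" using A_minimal[of ?B] a v by auto
  qed
  with U0 have xW: "\<rho> x v = 0" if "v \<in> W" for v using that by (auto simp: U_def)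
  obtain w where w: "w \<in> W" "w \<noteq> 0" using W0 W(1) by blast
  have E: "de (res r) \<in> carr A" if "r < n" for r using that by (rule de_res_in_A)
  \<comment> \<open>The idempotents \<open>de (res r)\<close> sum to 1, so one of them does not kill
    \<open>w\<close>, and its image is an eigenvector of \<open>g ^ n\<close>. The eigenvalue is a
    power of q, so the field need not be algebraically closed.\<close>
  have "\<exists>r<n. \<rho> (de (res r)) w \<noteq> 0"
  proof (rule ccontr)
    assume *: "\<not> (\<exists>r<n. \<rho> (de (res r)) w \<noteq> 0)"
    have "(\<Sum>r\<in>I. de (res r)) \<in> carr A \<and> \<rho> (\<Sum>r\<in>I. de (res r)) w = 0" if "finite I" "I \<subseteq> {..<n}" for I
      using that by (induction I) (use * w E in \<open>auto simp: \<rho>0\<close>)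
    from this[of "{..<n}"] show False using w by (simp add: sum_de_res)
  qed
  then obtain r where r: "r < n" "\<rho> (de (res r)) w \<noteq> 0" by blast
  define v where "v = \<rho> (de (res r)) w"
  have v: "v \<in> W" "v \<noteq> 0" using r w E by (auto simp: v_def)
  have gv: "\<rho> (g ^ n) v = sV (q ^ (n * r)) v"
    using \<rho>(6)[of "g ^ n" "de (res r)" w] E[OF r(1)] w by (simp add: v_def g_n_res[OF r(1)])
  have "V.span {v} = {0} \<or> V.span {v} = W"
  proof (rule min)
    show "V.subspace (V.span {v})" by (rule V.subspace_span)
    show "V.span {v} \<subseteq> W" using v subW by (intro V.span_minimal) auto
    fix a u assume a: "a \<in> carr A" and u: "u \<in> V.span {v}"
    \<comment> \<open>The elements that act on \<open>v\<close> by a scalar form a subalgebra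
      containing both generators.\<close>
    let ?B = "{a \<in> carr A. \<exists>c. \<rho> a v = sV c v}"
    have "subalgebra (scl H) ?B"
      unfolding subalgebra_def subspace_def
    proof (intro conjI ballI allI)
      show "0 \<in> ?B" using v by (auto simp: \<rho>0 intro!: exI[of _ 0])
      show "1 \<in> ?B" using v by (auto intro!: exI[of _ 1])
      fix a b assume "a \<in> ?B" "b \<in> ?B"
      then obtain c d where ab: "a \<in> carr A" "b \<in> carr A" "\<rho> a v = sV c v" "\<rho> b v = sV d v" by auto
      then show "a + b \<in> ?B" "a * b \<in> ?B"
        using v by (auto simp: V.scale_left_distrib[symmetric])
    next
      fix c a assume "a \<in> ?B"
      then show "scl H c a \<in> ?B" using v by auto
    qed
    moreover have "g ^ n \<in> ?B" using gv by auto
    moreover have "x \<in> ?B" using xW[OF v(1)] by (auto intro!: exI[of _ 0])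
    ultimately have "a \<in> ?B" using A_minimal[of ?B] a by auto
    moreover obtain c where "u = sV c v" using u by (auto simp: V.span_singleton)
    ultimately show "\<rho> a u \<in> V.span {v}"
      using v a by (auto simp: V.span_singleton)
  qed
  moreover have "V.span {v} \<noteq> {0}" using v V.span_base[of v "{v}"] by auto
  ultimately have "W = V.span {v}" by simp
  moreover have "V.dim (V.span {v}) = card {v}"
    using v by (intro V.dim_span_eq_card_independent) simp
  ultimately show "V.dim W = 1" by simp
qed

end

section \<open>An invariant of twist equivalence\<close>

definition alg_character :: "('k::field, 'a::ring_1, 'm) alg_scheme \<Rightarrow> ('a \<Rightarrow> 'k) \<Rightarrow> bool" where
  "alg_character A p \<longleftrightarrow> p 1 = 1 \<and> (\<forall>a\<in>carr A. \<forall>b\<in>carr A. p (a + b) = p a + p b) \<and>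
     (\<forall>c. \<forall>a\<in>carr A. p (scl A c a) = c * p a) \<and> (\<forall>a\<in>carr A. \<forall>b\<in>carr A. p (a * b) = p a * p b)"

lemma alg_characterD:
  assumes "alg_character A p"
  shows "p 1 = 1" "a \<in> carr A \<Longrightarrow> b \<in> carr A \<Longrightarrow> p (a + b) = p a + p b"
    "a \<in> carr A \<Longrightarrow> p (scl A c a) = c * p a" "a \<in> carr A \<Longrightarrow> b \<in> carr A \<Longrightarrow> p (a * b) = p a * p b"
  using assms by (auto simp: alg_character_def)

text \<open>For characters this is multiplicative on the tensor square. Since the field is
  commutative, conjugation by an invertible tensor does not change the value; this is what makes
  characters suitable for comparing twists.\<close>

definition ev2 :: "('k::field, 'a::ring_1, 'm) alg_scheme \<Rightarrow> ('a \<Rightarrow> 'k) \<Rightarrow> ('a \<Rightarrow> 'k) \<Rightarrow> ('k, 'a) tensor \<Rightarrow> 'k" where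
  "ev2 A p r t = tlift2 A (\<lambda>a b. p a * r b) t"

definition ev3 :: "('k::field, 'a::ring_1, 'm) alg_scheme \<Rightarrow> ('a \<Rightarrow> 'k) \<Rightarrow> ('a \<Rightarrow> 'k) \<Rightarrow> ('a \<Rightarrow> 'k)
    \<Rightarrow> ('k, 'a) tensor \<Rightarrow> 'k" where
  "ev3 A p r s t = tlift3 A (\<lambda>a b c. p a * r b * s c) t"

lemma mlin_ev2:
  "alg_character A p \<Longrightarrow> alg_character A r \<Longrightarrow> mlin A (*) 2 (\<lambda>v. p (v ! 0) * r (v ! 1))"
  by (rule mlin_2I) (auto simp: vector_space_mult alg_characterD algebra_simps)

lemma mlin_ev3:
  "alg_character A p \<Longrightarrow> alg_character A r \<Longrightarrow> alg_character A s \<Longrightarrow>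
    mlin A (*) 3 (\<lambda>v. p (v ! 0) * r (v ! 1) * s (v ! 2))"
  by (rule mlin_3I) (auto simp: vector_space_mult alg_characterD algebra_simps)

context k_algebra
begin

lemma tlin_ev2: "alg_character A p \<Longrightarrow> alg_character A r \<Longrightarrow> tlin A 2 (*) (ev2 A p r)"
  unfolding ev2_def[abs_def] by (rule tlin_tlift[OF mlin_ev2]) auto

lemma tlin_ev3:
  "alg_character A p \<Longrightarrow> alg_character A r \<Longrightarrow> alg_character A s \<Longrightarrow> tlin A 3 (*) (ev3 A p r s)"
  unfolding ev3_def[abs_def] by (rule tlin_tlift[OF mlin_ev3]) auto

lemma ev2_ptensor:
  "alg_character A p \<Longrightarrow> alg_character A r \<Longrightarrow> a \<in> carr A \<Longrightarrow> b \<in> carr A \<Longrightarrow>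
    ev2 A p r (ptensor A [a, b]) = p a * r b"
  unfolding ev2_def by (subst tlift_ptensor[OF mlin_ev2]) auto

lemma ev3_ptensor:
  "alg_character A p \<Longrightarrow> alg_character A r \<Longrightarrow> alg_character A s \<Longrightarrow>
    a \<in> carr A \<Longrightarrow> b \<in> carr A \<Longrightarrow> c \<in> carr A \<Longrightarrow> ev3 A p r s (ptensor A [a, b, c]) = p a * r b * s c"
  unfolding ev3_def by (subst tlift_ptensor[OF mlin_ev3]) auto

lemma ev2_mult:
  assumes "alg_character A p" "alg_character A r" "t \<in> tpower A 2" "u \<in> tpower A 2"
  shows "ev2 A p r (tmul A 2 t u) = ev2 A p r t * ev2 A p r u"
  by (rule tmul_ring_homI[OF tlin_ev2[OF assms(1,2)] vector_space_mult _ _ _ _ assms(3,4)])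
     (auto elim!: tuples_2E simp: ev2_ptensor assms alg_characterD(4)[OF assms(1)] alg_characterD(4)[OF assms(2)])

lemma ev3_mult:
  assumes "alg_character A p" "alg_character A r" "alg_character A s" "t \<in> tpower A 3" "u \<in> tpower A 3"
  shows "ev3 A p r s (tmul A 3 t u) = ev3 A p r s t * ev3 A p r s u"
  by (rule tmul_ring_homI[OF tlin_ev3[OF assms(1-3)] vector_space_mult _ _ _ _ assms(4,5)])
     (auto elim!: tuples_3E simp: ev3_ptensor assms alg_characterD(4)[OF assms(1)]
        alg_characterD(4)[OF assms(2)] alg_characterD(4)[OF assms(3)])

lemma ev2_tone: "alg_character A p \<Longrightarrow> alg_character A r \<Longrightarrow> ev2 A p r (tone A 2) = 1"
  using ev2_ptensor[of p r 1 1] by (simp add: tone_def numeral_2_eq_2 alg_characterD(1))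

lemma ev3_tone: "alg_character A p \<Longrightarrow> alg_character A r \<Longrightarrow> alg_character A s \<Longrightarrow> ev3 A p r s (tone A 3) = 1"
  using ev3_ptensor[of p r s 1 1 1] by (simp add: tone_def numeral_3_eq_3 alg_characterD(1))

lemma ev3_one_tensor:
  assumes "alg_character A p" "alg_character A r" "alg_character A s" "t \<in> tpower A 2"
  shows "ev3 A p r s (one_tensor A 2 t) = ev2 A r s t"
proof (rule tlin_eqI[OF assms(4)])
  show "tlin A 2 (*) (\<lambda>t. ev3 A p r s (one_tensor A 2 t))"
    using assms by (intro tlin_comp[OF tlin_one_tensor _ tlin_ev3]) (auto dest: one_tensor_closed)
  show "tlin A 2 (*) (ev2 A r s)" by (intro tlin_ev2 assms)
qed (auto elim!: tuples_2E simp: assms tlin_ev2 one_tensor_ptensor ev2_ptensor ev3_ptensor alg_characterD(1)[OF assms(1)])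

lemma ev3_tensor_one:
  assumes "alg_character A p" "alg_character A r" "alg_character A s" "t \<in> tpower A 2"
  shows "ev3 A p r s (tensor_one A 2 t) = ev2 A p r t"
proof (rule tlin_eqI[OF assms(4)])
  show "tlin A 2 (*) (\<lambda>t. ev3 A p r s (tensor_one A 2 t))"
    using assms by (intro tlin_comp[OF tlin_tensor_one _ tlin_ev3]) (auto dest: tensor_one_closed)
  show "tlin A 2 (*) (ev2 A p r)" by (intro tlin_ev2 assms)
qed (auto elim!: tuples_2E simp: assms tlin_ev2 tensor_one_ptensor ev2_ptensor ev3_ptensor alg_characterD(1)[OF assms(3)])

end

context comult_algebra
begin

text \<open>Here \<open>rs\<close> is the convolution product of \<open>r\<close> and
  \<open>s\<close>; evaluating two legs of a coproduct by \<open>r\<close> and \<open>s\<close>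
  amounts to evaluating the original factor by \<open>rs\<close>.\<close>

lemma ev3_comult_at_1:
  assumes ch: "alg_character H p" "alg_character H r" "alg_character H s" "alg_character H rs"
    and conv: "\<And>h. h \<in> carr H \<Longrightarrow> ev2 H r s (comult H h) = rs h" and t: "t \<in> tpower H 2"
  shows "ev3 H p r s (comult_at H 1 2 t) = ev2 H p rs t"
proof (rule tlin_eqI[OF t])
  show "tlin H 2 (*) (\<lambda>t. ev3 H p r s (comult_at H 1 2 t))"
    using ch by (intro tlin_comp[OF tlin_comult_at _ tlin_ev3]) auto
  show "tlin H 2 (*) (ev2 H p rs)" using ch by (intro tlin_ev2)
  fix v assume "v \<in> tuples (carr H) 2"
  then obtain a b where v: "v = [a, b]" "a \<in> carr H" "b \<in> carr H" by (rule tuples_2E)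
  have v2: "[a, b] \<in> tuples (carr H) 2" using v by simp
  have "ev3 H p r s (insert_at 1 [a, b] (comult H b)) = p a * ev2 H r s (comult H b)"
  proof (rule tlin_eqI[of "comult H b" 2])
    show "tlin H 2 (*) (\<lambda>u. ev3 H p r s (insert_at 1 [a, b] u))"
      using ch insert_at_closed[OF v2, of 1]
      by (intro tlin_comp[OF tlin_insert_at[OF v2] _ tlin_ev3]) auto
    show "tlin H 2 (*) (\<lambda>u. p a * ev2 H r s u)"
      using tlin_ev2[OF ch(2,3)] by (auto simp: tlin_def algebra_simps)
    fix d assume d: "d \<in> tuples (carr H) 2"
    then show "ev3 H p r s (insert_at 1 [a, b] (ptensor H d)) = p a * ev2 H r s (ptensor H d)"
      using v ch insert_at_ptensor[OF v2 _ d, of 1]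
      by (auto elim!: tuples_2E simp: ev3_ptensor ev2_ptensor)
  qed (use v in auto)
  then show "ev3 H p r s (comult_at H 1 2 (ptensor H v)) = ev2 H p rs (ptensor H v)"
    using v ch v2 comult_at_ptensor[OF v2, of 1] by (simp add: ev2_ptensor conv)
qed

lemma ev3_comult_at_0:
  assumes ch: "alg_character H p" "alg_character H r" "alg_character H s" "alg_character H pr"
    and conv: "\<And>h. h \<in> carr H \<Longrightarrow> ev2 H p r (comult H h) = pr h" and t: "t \<in> tpower H 2"
  shows "ev3 H p r s (comult_at H 0 2 t) = ev2 H pr s t"
proof (rule tlin_eqI[OF t])
  show "tlin H 2 (*) (\<lambda>t. ev3 H p r s (comult_at H 0 2 t))"
    using ch by (intro tlin_comp[OF tlin_comult_at _ tlin_ev3]) auto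
  show "tlin H 2 (*) (ev2 H pr s)" using ch by (intro tlin_ev2)
  fix v assume "v \<in> tuples (carr H) 2"
  then obtain a b where v: "v = [a, b]" "a \<in> carr H" "b \<in> carr H" by (rule tuples_2E)
  have v2: "[a, b] \<in> tuples (carr H) 2" using v by simp
  have "ev3 H p r s (insert_at 0 [a, b] (comult H a)) = ev2 H p r (comult H a) * s b"
  proof (rule tlin_eqI[of "comult H a" 2])
    show "tlin H 2 (*) (\<lambda>u. ev3 H p r s (insert_at 0 [a, b] u))"
      using ch insert_at_closed[OF v2, of 0]
      by (intro tlin_comp[OF tlin_insert_at[OF v2] _ tlin_ev3]) auto
    show "tlin H 2 (*) (\<lambda>u. ev2 H p r u * s b)"
      using tlin_ev2[OF ch(1,2)] by (auto simp: tlin_def algebra_simps)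
    fix d assume d: "d \<in> tuples (carr H) 2"
    then show "ev3 H p r s (insert_at 0 [a, b] (ptensor H d)) = ev2 H p r (ptensor H d) * s b"
      using v ch insert_at_ptensor[OF v2 _ d, of 0]
      by (auto elim!: tuples_2E simp: ev3_ptensor ev2_ptensor)
  qed (use v in auto)
  then show "ev3 H p r s (comult_at H 0 2 (ptensor H v)) = ev2 H pr s (ptensor H v)"
    using v ch v2 comult_at_ptensor[OF v2, of 0] by (simp add: ev2_ptensor conv)
qed

end

lemma prod_shift_mod:
  fixes f :: "nat \<Rightarrow> 'c::comm_monoid_mult"
  assumes "m > 0"
  shows "(\<Prod>j<m. f (Suc j mod m)) = (\<Prod>j<m. f j)"
proof -
  obtain l where l: "m = Suc l" using assms by (cases m) auto
  have "(\<Prod>j<l. f (Suc j mod Suc l)) = (\<Prod>j<l. f (Suc j))"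
    by (intro prod.cong) auto
  then show ?thesis
    unfolding l by (subst (2) prod.lessThan_Suc_shift) (simp add: mult.commute)
qed

text \<open>
  A family of characters indexed by \<open>\<int>/n\<close> restricts the associator to a 3-cocycle on \<open>\<int>/n\<close>. A twist
  changes it by the coboundary \<open>f(j,l) f(i,j+l) / (f(i+j,l) f(i,j))\<close> of some \<open>f\<close>, whose product over
  \<open>j\<close>, for \<open>i = l = 1\<close>, cancels to \<open>1\<close>.
\<close>

lemma (in quasi_hopf_algebra) associator_product_twist:
  fixes n :: nat and \<psi> :: "nat \<Rightarrow> 'a \<Rightarrow> 'k"
  assumes n: "n > 1" and ch: "\<And>i. alg_character H (\<psi> i)"
    and conv: "\<And>i j h. i < n \<Longrightarrow> j < n \<Longrightarrow> h \<in> carr H \<Longrightarrow> ev2 H (\<psi> i) (\<psi> j) (comult H h) = \<psi> ((i + j) mod n) h"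
    and F: "tinvertible H 2 F"
  shows "(\<Prod>j<n. ev3 H (\<psi> 1) (\<psi> j) (\<psi> 1) (twist_assoc H F)) = (\<Prod>j<n. ev3 H (\<psi> 1) (\<psi> j) (\<psi> 1) (assoc H))"
proof -
  interpret F: twist_of H F by unfold_locales (rule F)
  let ?F' = "tinverse H 2 F"
  \<comment> \<open>The 2-cochain of the coboundary: the twist evaluated at pairs of
    characters.\<close>
  define f where "f i j = ev2 H (\<psi> i) (\<psi> j) F" for i j
  have F': "ev2 H (\<psi> i) (\<psi> j) ?F' = inverse (f i j)" and f_nz: "f i j \<noteq> 0" for i j
  proof -
    have "f i j * ev2 H (\<psi> i) (\<psi> j) ?F' = 1"
      using ev2_mult[OF ch[of i] ch[of j] F.J_closed F.J'_closed] by (simp add: f_def ev2_tone ch)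
    then show "ev2 H (\<psi> i) (\<psi> j) ?F' = inverse (f i j)" "f i j \<noteq> 0"
      by (auto dest: inverse_unique)
  qed
  have \<Phi>: "assoc H \<in> tpower H 3" using tinvertibleD[OF assoc_invertible] by simp
  let ?\<Phi> = "\<lambda>i j l. ev3 H (\<psi> i) (\<psi> j) (\<psi> l) (assoc H)"
  have tw: "ev3 H (\<psi> i) (\<psi> j) (\<psi> l) (twist_assoc H F) =
      f j l * f i ((j + l) mod n) * ?\<Phi> i j l * inverse (f ((i + j) mod n) l) * inverse (f i j)"
    if "i < n" "j < n" "l < n" for i j l
    unfolding twist_assoc_def F.tinverse_tensor_one_J
    using \<Phi> that
    by (simp add: ev3_mult ch ev3_one_tensor ev3_tensor_one
        ev3_comult_at_1[unfolded One_nat_def, OF ch ch ch ch conv] ev3_comult_at_0[OF ch ch ch ch conv] F'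
        f_def[symmetric])
  have "(\<Prod>j<n. ev3 H (\<psi> 1) (\<psi> j) (\<psi> 1) (twist_assoc H F)) =
      (\<Prod>j<n. f j 1 * f 1 (Suc j mod n) * ?\<Phi> 1 j 1 * inverse (f (Suc j mod n) 1) * inverse (f 1 j))"
    using n by (intro prod.cong refl) (simp add: tw)
  also have "\<dots> = (\<Prod>j<n. f j 1) * (\<Prod>j<n. f 1 (Suc j mod n)) * (\<Prod>j<n. ?\<Phi> 1 j 1) *
      inverse (\<Prod>j<n. f (Suc j mod n) 1) * inverse (\<Prod>j<n. f 1 j)"
    by (simp add: prod.distrib prod_inversef[symmetric] comp_def)
  \<comment> \<open>As j runs through Z/n so does j + 1, so the shifted factors cancel the unshifted
    ones.\<close>
  also have "(\<Prod>j<n. f 1 (Suc j mod n)) = (\<Prod>j<n. f 1 j)"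
    using n by (intro prod_shift_mod) simp
  also have "(\<Prod>j<n. f (Suc j mod n) 1) = (\<Prod>j<n. f j 1)"
    using n prod_shift_mod[of n "\<lambda>j. f j 1"] by simp
  finally show ?thesis
    using f_nz by (simp add: field_simps)
qed

context k_algebra
begin

lemma mlin_map:
  assumes "mlin B sC m \<phi>" "\<And>a. a \<in> carr A \<Longrightarrow> f a \<in> carr B"
    and "\<And>a b. a \<in> carr A \<Longrightarrow> b \<in> carr A \<Longrightarrow> f (a + b) = f a + f b"
    and "\<And>c a. a \<in> carr A \<Longrightarrow> f (scl A c a) = scl B c (f a)"
  shows "mlin A sC m (\<lambda>v. \<phi> (map f v))"
proof (rule mlinI)
  show "vector_space sC" by (rule mlinD(1)[OF assms(1)])
next
  fix v i a b assume *: "v \<in> tuples (carr A) m" "i < m" "a \<in> carr A" "b \<in> carr A"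
  then show "\<phi> (map f (v[i := a + b])) = \<phi> (map f (v[i := a])) + \<phi> (map f (v[i := b]))"
    using mlinD(2)[OF assms(1) tuples_map[OF *(1) assms(2)] *(2)] assms(2-4) by (simp add: map_update)
next
  fix v i c a assume *: "v \<in> tuples (carr A) m" "i < m" "a \<in> carr A"
  then show "\<phi> (map f (v[i := scl A c a])) = sC c (\<phi> (map f (v[i := a])))"
    using mlinD(3)[OF assms(1) tuples_map[OF *(1) assms(2)] *(2)] assms(2-4) by (simp add: map_update)
qed

end

lemma quasi_hopf_isoD:
  assumes "quasi_hopf_iso H K f"
  shows "bij_betw f (carr H) (carr K)" "h \<in> carr H \<Longrightarrow> f h \<in> carr K"
    "h \<in> carr H \<Longrightarrow> h' \<in> carr H \<Longrightarrow> f (h + h') = f h + f h'"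
    "h \<in> carr H \<Longrightarrow> f (scl H c h) = scl K c (f h)"
    "h \<in> carr H \<Longrightarrow> h' \<in> carr H \<Longrightarrow> f (h * h') = f h * f h'" "f 1 = 1"
    "h \<in> carr H \<Longrightarrow> comult K (f h) = tlift H 2 (\<lambda>v. ptensor K (map f v)) (comult H h)"
    "assoc K = tlift H 3 (\<lambda>v. ptensor K (map f v)) (assoc H)"
  using assms by (auto simp: quasi_hopf_iso_def bij_betw_def)

section \<open>The characters of \<open>A(q)\<close> and the value of the invariant\<close>

context taft_root
begin

lemma subalgebra_H: "subalgebra (scl H) B \<Longrightarrow> g \<in> B \<Longrightarrow> x \<in> B \<Longrightarrow> carr H \<subseteq> B"
  unfolding generated by (intro generated_subalgebra_mono) auto

lemma chi_character: "alg_character H (chi z)"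
  by (auto simp: alg_character_def chi_one chi_add chi_scl chi_mult)

lemma chi_character_A: "alg_character A (chi z)"
  using chi_character[of z] carr_A_sub by (auto simp: alg_character_def subset_iff)

lemma chi_conv_H:
  assumes "h \<in> carr H"
  shows "ev2 H (chi i) (chi j) (comult H h) = chi (i + j) h"
proof -
  let ?B = "{h \<in> carr H. ev2 H (chi i) (chi j) (comult H h) = chi (i + j) h}"
  note lin = tlin_ev2[OF chi_character[of i] chi_character[of j]]
  have "comult H 0 = 0" using delta_scl[of 0 0] by simp
  then have "subalgebra (scl H) ?B"
    unfolding subalgebra_def subspace_def
    by (auto simp: tlin_0[OF lin] chi_0 delta_one ev2_tone chi_character chi_one delta_add delta_scl
        delta_mult tlinD[OF lin] chi_add chi_scl chi_mult ev2_mult)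
  moreover have "g \<in> ?B"
    using g_closed chi_g_power[of _ 1]
    by (simp add: comult_g ev2_ptensor chi_character power_add)
  moreover have "x \<in> ?B"
  proof -
    have "ptensor H [x, g] \<in> tpower H 2" "ptensor H [1, x] \<in> tpower H 2"
      using x_closed g_closed by (auto intro!: tpower_ptensor)
    then show ?thesis
      using x_closed g_closed by (simp add: comult_x tlinD[OF lin] ev2_ptensor chi_character chi_x)
  qed
  ultimately show ?thesis using subalgebra_H[of ?B] assms by auto
qed

text \<open>On \<open>g ^ n\<close> the value is q^(n z), which depends on z modulo n only. So on
  \<open>A(q)\<close> the family is indexed by Z/n, as the invariant requires.\<close>

lemma chi_mod:
  assumes "h \<in> carr A"
  shows "chi (z mod n) h = chi z h"
proof -
  let ?B = "{h \<in> carr H. chi (z mod n) h = chi z h}"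
  have "subalgebra (scl H) ?B"
    unfolding subalgebra_def subspace_def
    by (auto simp: chi_0 chi_one chi_add chi_scl chi_mult)
  moreover have "g ^ n \<in> ?B"
    using g_closed q_n_residue[of z 1] by (simp add: chi_g_power)
  moreover have "x \<in> ?B" using x_closed by (simp add: chi_x)
  ultimately show ?thesis using A_minimal[of ?B] assms by auto
qed

text \<open>The values of \<open>J\<close> and its inverse cancel in the field, so the twisted and
  the original coproduct give the same convolution.\<close>

lemma chi_conv_A:
  assumes h: "h \<in> carr A"
  shows "ev2 A (chi i) (chi j) (comult A h) = chi ((i + j) mod n) h"
proof -
  have hH: "h \<in> carr H" using h carr_A_sub by auto
  have "ev2 A (chi i) (chi j) (comult A h) = ev2 H (chi i) (chi j) (twist_comult H J h)"
    unfolding ev2_def using SA.tlift_sub[OF mlin_ev2[OF chi_character chi_character] comult_A_closed[OF h]]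
    by simp
  also have "\<dots> = ev2 H (chi i) (chi j) (comult H h) * (ev2 H (chi i) (chi j) J * ev2 H (chi i) (chi j) J')"
    unfolding twist_comult_def using hH by (simp add: ev2_mult chi_character)
  also have "ev2 H (chi i) (chi j) J * ev2 H (chi i) (chi j) J' = 1"
    using ev2_mult[OF chi_character chi_character J_closed J'_closed, of i j]
    by (simp add: ev2_tone chi_character)
  finally show ?thesis using h hH by (simp add: chi_conv_H chi_mod)
qed

text \<open>Among 0, ..., n - 1 only j = n - 1 produces a carry when 1 is added, so a single factor
  differs from 1. It is the inverse of \<open>q ^ n\<close>, and \<open>q ^ n\<close> is not 1
  because n < N.\<close>

lemma associator_product_A: "(\<Prod>j<n. ev3 A (chi 1) (chi j) (chi 1) (assoc A)) \<noteq> 1"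
proof -
  have nN: "n < N" using n2 by (simp add: power2_eq_square)
  have 1: "ev3 A (chi 1) (chi j) (chi 1) (assoc A) = (if j = n - 1 then inverse (q ^ n) else 1)"
    if j: "j < n" for j
  proof -
    have ml: "mlin H (*) 3 (\<lambda>v. chi 1 (v ! 0) * chi j (v ! 1) * chi 1 (v ! 2))"
      by (intro mlin_ev3 chi_character)
    have "ev3 A (chi 1) (chi j) (chi 1) (assoc A) =
        tlift3 H (\<lambda>a b c. chi 1 a * chi j b * chi 1 c) (dt 3 omega)"
      unfolding ev3_def using SA.tlift_sub[OF ml assoc_in_A(1)] by (simp add: assoc_eq)
    also have "\<dots> = (\<Sum>a<N. \<Sum>b<N. \<Sum>c<N. if c = 1 then if b = j then if a = 1 then omega [1, j, 1] else 0 else 0 else 0)"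
      unfolding tlift_dt[OF ml zero_less_numeral] sum_tuples_3
      using j nN n2 by (intro sum.cong refl) (auto simp: chi_e)
    also have "\<dots> = omega [1, j, 1]"
      using j nN n2 by simp
    also have "\<dots> = inverse (q ^ (n * carry j 1))"
      by (simp add: omega_eq)
    also have "carry j 1 = (if j = n - 1 then 1 else 0)"
      using j n2 by (auto simp: carry_def)
    finally show ?thesis by simp
  qed
  have "(\<Prod>j<n. ev3 A (chi 1) (chi j) (chi 1) (assoc A)) = (\<Prod>j<n. if j = n - 1 then inverse (q ^ n) else 1)"
    by (intro prod.cong refl) (simp only: lessThan_iff 1)
  also have "\<dots> = inverse (q ^ n)" using n2 by simp
  finally have "(\<Prod>j<n. ev3 A (chi 1) (chi j) (chi 1) (assoc A)) = inverse (q ^ n)" .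
  moreover have "q ^ n \<noteq> 1" using q_eq_iff[of n 0] nN n2 by simp
  ultimately show ?thesis by simp
qed

text \<open>The definition of twist equivalence allows either algebra to be the twisted one. Here
  \<open>K\<close> is twisted: the characters of \<open>A(q)\<close> are carried to
  \<open>K\<close>, whose trivial associator makes the product 1.\<close>

lemma not_twist_of_hopf:
  fixes K :: "('k, 'b::ring_1) qhopf"
  assumes "hopf_algebra K"
  shows "\<not> isomorphic_to_twist A K"
proof
  interpret K: hopf_algebra K by fact
  assume "isomorphic_to_twist A K"
  then obtain F f where F: "is_twist K F" and f: "quasi_hopf_iso A (twisted K F) f"
    by (auto simp: isomorphic_to_twist_def)
  have Finv: "tinvertible K 2 F" using F by (simp add: is_twist_def)
  interpret F: twist_of K F by unfold_locales (rule Finv)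
  note f = quasi_hopf_isoD[OF f, unfolded twisted_simps twisted_tensor_simps]
  define f' where "f' = inv_into (carr A) f"
  have f': "f' k \<in> carr A" "f (f' k) = k" if "k \<in> carr K" for k
    using f(1) that by (auto simp: f'_def bij_betw_def inv_into_into f_inv_into_f)
  have f'f: "f' (f a) = a" if "a \<in> carr A" for a
    using f(1) that by (auto simp: f'_def bij_betw_def)
  define \<psi> where "\<psi> i k = chi i (f' k)" for i k
  have \<psi>f: "\<psi> i (f a) = chi i a" if "a \<in> carr A" for i a
    using that by (simp add: \<psi>_def f'f)
  have ch: "alg_character K (\<psi> i)" for i
    unfolding alg_character_def
  proof (intro conjI ballI allI)
    show "\<psi> i 1 = 1" using \<psi>f[of 1 i] f(6) SA.B.carr_1 by (simp add: chi_one)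
    fix a b c assume a: "a \<in> carr K"
    note chA = alg_characterD[OF chi_character_A]
    show "\<psi> i (scl K c a) = c * \<psi> i a"
      using \<psi>f[OF SA.B.carr_scl[OF f'(1)[OF a]], of i c] f'[OF a] by (simp add: f(4) chA \<psi>_def[of i a] del: A_simps)
    assume b: "b \<in> carr K"
    show "\<psi> i (a + b) = \<psi> i a + \<psi> i b"
      using \<psi>f[OF SA.B.carr_add[OF f'(1)[OF a] f'(1)[OF b]], of i] f'[OF a] f'[OF b]
      by (simp add: f(3) chA \<psi>_def[of i a] \<psi>_def[of i b])
    show "\<psi> i (a * b) = \<psi> i a * \<psi> i b"
      using \<psi>f[OF SA.B.carr_mult[OF f'(1)[OF a] f'(1)[OF b]], of i] f'[OF a] f'[OF b]
      by (simp add: f(5) chA \<psi>_def[of i a] \<psi>_def[of i b])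
  qed
  have map_in: "map f v \<in> tuples (carr K) m" if "v \<in> tuples (carr A) m" for v m
    using that f(2) by (rule tuples_map)
  have mlf: "mlin A tscale m (\<lambda>v. ptensor K (map f v))" for m
    using f(2-4) by (intro SA.B.mlin_map[OF K.mlin_ptensor]) auto
  have cl: "tlift A m (\<lambda>v. ptensor K (map f v)) t \<in> tpower K m" if "t \<in> tpower A m" "m > 0" for t m
    by (rule SA.B.tlin_closed[OF that(1) SA.B.tlin_tlift[OF mlf that(2)]])
       (auto simp: SA.B.tlift_ptensor[OF mlf] intro!: K.tpower_ptensor map_in)
  \<comment> \<open>Since \<open>\<psi> i\<close> after \<open>f\<close> is \<open>chi i\<close>,
    pushing a tensor forward along \<open>f\<close> and evaluating there gives the value on
    \<open>A(q)\<close>.\<close>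
  have e2: "ev2 K (\<psi> i) (\<psi> j) (tlift A 2 (\<lambda>v. ptensor K (map f v)) t) = ev2 A (chi i) (chi j) t"
    if t: "t \<in> tpower A 2" for i j t
  proof (rule SA.B.tlin_eqI[OF t])
    show "tlin A 2 (*) (\<lambda>t. ev2 K (\<psi> i) (\<psi> j) (tlift A 2 (\<lambda>v. ptensor K (map f v)) t))"
      using cl ch by (intro SA.B.tlin_comp[OF SA.B.tlin_tlift[OF mlf] _ K.tlin_ev2]) auto
    show "tlin A 2 (*) (ev2 A (chi i) (chi j))" by (intro SA.B.tlin_ev2 chi_character_A)
    fix v assume v: "v \<in> tuples (carr A) 2"
    then show "ev2 K (\<psi> i) (\<psi> j) (tlift A 2 (\<lambda>v. ptensor K (map f v)) (ptensor A v)) =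
        ev2 A (chi i) (chi j) (ptensor A v)"
      using f(2) by (auto elim!: tuples_2E
          simp: SA.B.tlift_ptensor[OF mlf] K.ev2_ptensor SA.B.ev2_ptensor ch chi_character_A \<psi>f)
  qed
  have e3: "ev3 K (\<psi> i) (\<psi> j) (\<psi> l) (tlift A 3 (\<lambda>v. ptensor K (map f v)) t) = ev3 A (chi i) (chi j) (chi l) t"
    if t: "t \<in> tpower A 3" for i j l t
  proof (rule SA.B.tlin_eqI[OF t])
    show "tlin A 3 (*) (\<lambda>t. ev3 K (\<psi> i) (\<psi> j) (\<psi> l) (tlift A 3 (\<lambda>v. ptensor K (map f v)) t))"
      using cl ch by (intro SA.B.tlin_comp[OF SA.B.tlin_tlift[OF mlf] _ K.tlin_ev3]) auto
    show "tlin A 3 (*) (ev3 A (chi i) (chi j) (chi l))" by (intro SA.B.tlin_ev3 chi_character_A)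
    fix v assume v: "v \<in> tuples (carr A) 3"
    then show "ev3 K (\<psi> i) (\<psi> j) (\<psi> l) (tlift A 3 (\<lambda>v. ptensor K (map f v)) (ptensor A v)) =
        ev3 A (chi i) (chi j) (chi l) (ptensor A v)"
      using f(2) by (auto elim!: tuples_3E
          simp: SA.B.tlift_ptensor[OF mlf] K.ev3_ptensor SA.B.ev3_ptensor ch chi_character_A \<psi>f)
  qed
  \<comment> \<open>The isomorphism controls only the twisted coproduct of \<open>K\<close>, but its
    values under characters agree with those of the original one.\<close>
  have conv: "ev2 K (\<psi> i) (\<psi> j) (comult K k) = \<psi> ((i + j) mod n) k" if k: "k \<in> carr K" for i j k
  proof -
    have FF: "ev2 K (\<psi> i) (\<psi> j) F * ev2 K (\<psi> i) (\<psi> j) (tinverse K 2 F) = 1"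
      using K.ev2_mult[OF ch ch F.J_closed F.J'_closed, of i j] by (simp add: K.ev2_tone ch)
    have "ev2 K (\<psi> i) (\<psi> j) (comult K k) =
        ev2 K (\<psi> i) (\<psi> j) F * ev2 K (\<psi> i) (\<psi> j) (comult K k) * ev2 K (\<psi> i) (\<psi> j) (tinverse K 2 F)"
      using FF by (metis mult.commute mult.left_commute mult_1_right)
    also have "\<dots> = ev2 K (\<psi> i) (\<psi> j) (twist_comult K F (f (f' k)))"
      using k by (simp add: twist_comult_def K.ev2_mult ch f')
    also have "\<dots> = ev2 A (chi i) (chi j) (comult A (f' k))"
      using f(7)[OF f'(1)[OF k]] e2[of "comult A (f' k)"] comult_A_closed[OF f'(1)[OF k]] by simp
    finally show ?thesis
      using chi_conv_A[OF f'(1)[OF k]] by (simp add: \<psi>_def)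
  qed
  have "(\<Prod>j<n. ev3 A (chi 1) (chi j) (chi 1) (assoc A)) = (\<Prod>j<n. ev3 K (\<psi> 1) (\<psi> j) (\<psi> 1) (twist_assoc K F))"
    unfolding f(8) using assoc_in_A(1) by (simp add: e3 assoc_eq)
  also have "\<dots> = (\<Prod>j<n. ev3 K (\<psi> 1) (\<psi> j) (\<psi> 1) (assoc K))"
    using n2 by (intro K.associator_product_twist ch conv Finv) auto
  also have "\<dots> = 1" by (simp add: K.assoc_trivial K.ev3_tone ch)
  finally show False using associator_product_A by simp
qed

text \<open>The opposite direction: the isomorphism carries the trivial associator of
  \<open>K\<close> to the twisted associator of \<open>A(q)\<close>, so a twist would have changed
  the product to 1.\<close>

lemma no_hopf_twist:
  fixes K :: "('k, 'b::ring_1) qhopf"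
  assumes "hopf_algebra K"
  shows "\<not> isomorphic_to_twist K A"
proof
  interpret K: hopf_algebra K by fact
  interpret QA: quasi_hopf_algebra A by (rule quasi_hopf_A)
  assume "isomorphic_to_twist K A"
  then obtain F f where F: "is_twist A F" and f: "quasi_hopf_iso K (twisted A F) f"
    by (auto simp: isomorphic_to_twist_def)
  have Finv: "tinvertible A 2 F" using F by (simp add: is_twist_def)
  note f = quasi_hopf_isoD[OF f, unfolded twisted_simps twisted_tensor_simps]
  have mlf: "mlin K tscale 3 (\<lambda>v. ptensor A (map f v))"
    using f(2-4) by (intro K.mlin_map[OF SA.B.mlin_ptensor]) auto
  have "twist_assoc A F = tone A 3"
    unfolding f(8) K.assoc_trivial using f(6)
    by (simp add: tone_def K.tlift_ptensor[OF mlf])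
  then have "(\<Prod>j<n. ev3 A (chi 1) (chi j) (chi 1) (twist_assoc A F)) = 1"
    by (simp add: SA.B.ev3_tone chi_character_A)
  moreover have "(\<Prod>j<n. ev3 A (chi 1) (chi j) (chi 1) (twist_assoc A F)) =
      (\<Prod>j<n. ev3 A (chi 1) (chi j) (chi 1) (assoc A))"
    using n2 by (intro QA.associator_product_twist chi_character_A chi_conv_A Finv) auto
  ultimately show False using associator_product_A by simp
qed

end

theorem theorem3p9:
  fixes n :: nat and q :: "'k::field" and H :: "('k, 'a::ring_1) qhopf" and g x :: 'a
  assumes "n \<ge> 2"
    and "CHAR('k) = 0 \<or> coprime CHAR('k) n"
    and "primitive_root_of_unity (n\<^sup>2) q"
    and "taft n q H g x"
  shows "quasi_hopf_algebra (A_taft n q H g x) \<and>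
         basic_algebra TYPE('v::ab_group_add) (A_taft n q H g x) \<and>
         alg_dim (A_taft n q H g x) = n ^ 3 \<and>
         (\<forall>K :: ('k, 'b::ring_1) qhopf.
            hopf_algebra K \<longrightarrow> \<not> twist_equivalent (A_taft n q H g x) K)"
proof -
  interpret taft_root n q H g x
    using assms by (simp add: taft_root_def taft_root_axioms_def)
  show ?thesis
    using quasi_hopf_A basic_A dim_A not_twist_of_hopf no_hopf_twist
    by (auto simp: twist_equivalent_def)
qed

end
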